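(* Let $A\in L^1_{\mathrm{loc}}(\mathbb{R})^{d\times d}$ be such that the propagator of $y'=A(x)y$ is exponentially bounded on $\mathbb{R}$ and such that $y'=A(x)y$ has an exponential dichotomy $Q\neq0$ on $\mathbb{R}$. Let $R\in L^1_{\mathrm{loc}}(\mathbb{R})^{d\times d}$ satisfy $$\|R\|_{\mathbb{C}^{d\times d}}\in L^1(\mathbb{R}_+;e^{\beta x}dx)$$ for some constant $\beta>0$ with $\beta>\lambda_+(Q)-\varkappa_+'(Q)$. Then the perturbed equation $y'(x)=(A(x)+R(x))y(x)$ has a unique matrix-valued Jost solution $Y_+(x)$, $x\ge0$; that is, there is a unique $d\times d$ matrix-valued solution $Y_+$ of $Y_+'(x)=(A(x)+R(x))Y_+(x)$ on $\mathbb{R}_+$ with $$\limsup_{x\to\infty}\frac{\log\|Y_+(x)-\Phi(x)Q\|_{\mathbb{C}^{d\times d}}}{x}<\varkappa_+'(Q).$$ Moreover, the map $R\mapsto Y_+(0)$ from $L^1(\mathbb{R}_+;e^{\beta x}dx)^{d\times d}$ to $\mathbb{C}^{d\times d}$ is continuous.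
   Context: $\mathbb{R}_+=[0,\infty)$; $\log 0=-\infty$. $\Phi$ is the fundamental matrix solution: $\Phi'=A\Phi$ a.e. on $\mathbb{R}$, $\Phi(0)=I_d$. The propagator is exponentially bounded on $\mathbb{R}$ if $\sup_{|x-x'|\le1}\|\Phi(x)\Phi(x')^{-1}\|<\infty$. A projection $Q$ in $\mathbb{C}^d$ is an exponential dichotomy on $\mathbb{R}$ if there are constants $\varkappa,\varkappa'>0$ and $C,C'\ge1$ with $\|\Phi(x)Q\Phi(x')^{-1}\|\le Ce^{-\varkappa(x-x')}$ for $x\ge x'$ and $\|\Phi(x)(I_d-Q)\Phi(x')^{-1}\|\le C'e^{\varkappa'(x-x')}$ for $x\le x'$, $x,x'\in\mathbb{R}$. The lower Bohl exponent on $\mathbb{R}_+$, $\varkappa_+'(Q)$, is the supremum of all $\varkappa\in\mathbb{R}$ for which there is a constant $C(\varkappa)$ with $\|\Phi(x)Q\Phi(x')^{-1}\|\le C(\varkappa)e^{\varkappa(x-x')}$ for all $0\le x\le x'$. The upper Lyapunov exponent on $\mathbb{R}_+$ is $\lambda_+(Q)=\limsup_{x\to\infty}x^{-1}\log\|\Phi(x)Q\|$. *)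

theory Defs
  imports "HOL-Analysis.Analysis"
begin

section \<open>Linear systems with locally integrable coefficients\<close>

definition locally_integrable :: "(real \<Rightarrow> 'a::euclidean_space) \<Rightarrow> bool" where
  "locally_integrable A \<longleftrightarrow> (\<forall>a b. A absolutely_integrable_on {a..b})"

text \<open>
  The members \<open>K\<close> of a division are finitely many nonempty compact intervals with pairwise
  disjoint interiors; \<open>Inf K\<close> and \<open>Sup K\<close> are the endpoints of \<open>K\<close>.
\<close>

definition absolutely_continuous_on :: "real set \<Rightarrow> (real \<Rightarrow> 'a::real_normed_vector) \<Rightarrow> bool" where
  "absolutely_continuous_on S f \<longleftrightarrow>
     (\<forall>\<epsilon>>0. \<exists>\<delta>>0. \<forall>D T. D division_of T \<and> T \<subseteq> S \<and> (\<Sum>K\<in>D. Sup K - Inf K) < \<delta> \<longrightarrow>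
        (\<Sum>K\<in>D. norm (f (Sup K) - f (Inf K))) < \<epsilon>)"

definition locally_absolutely_continuous_on ::
    "real set \<Rightarrow> (real \<Rightarrow> 'a::real_normed_vector) \<Rightarrow> bool" where
  "locally_absolutely_continuous_on S f \<longleftrightarrow>
     (\<forall>a b. {a..b} \<subseteq> S \<longrightarrow> absolutely_continuous_on {a..b} f)"

text \<open>Matrix-valued solutions (in the sense of Caratheodory) of \<open>Y' = A(x) Y\<close> on an interval \<open>S\<close>.\<close>

definition matrix_solution_on ::
    "real set \<Rightarrow> (real \<Rightarrow> complex^'d^'d) \<Rightarrow> (real \<Rightarrow> complex^'d^'d) \<Rightarrow> bool" where
  "matrix_solution_on S A Y \<longleftrightarrow>
     locally_absolutely_continuous_on S Y \<and>
     (AE x in lebesgue. x \<in> S \<longrightarrow> (Y has_vector_derivative (A x ** Y x)) (at x within S))"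

definition fundamental_matrix ::
    "(real \<Rightarrow> complex^'d^'d) \<Rightarrow> (real \<Rightarrow> complex^'d^'d) \<Rightarrow> bool" where
  "fundamental_matrix A \<Phi> \<longleftrightarrow> matrix_solution_on UNIV A \<Phi> \<and> \<Phi> 0 = mat 1"

section \<open>Dichotomies and exponents\<close>

text \<open>
  The norm on \<open>complex^'d^'d\<close> is the Euclidean (Frobenius) norm. Since all matrix norms are
  equivalent, none of the notions below depends on this choice.
\<close>

definition exp_bounded_propagator :: "(real \<Rightarrow> complex^'d^'d) \<Rightarrow> bool" where
  "exp_bounded_propagator \<Phi> \<longleftrightarrow>
     bdd_above {norm (\<Phi> x ** matrix_inv (\<Phi> x')) |x x'. \<bar>x - x'\<bar> \<le> 1}"

definition exponential_dichotomy :: "(real \<Rightarrow> complex^'d^'d) \<Rightarrow> complex^'d^'d \<Rightarrow> bool" where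
  "exponential_dichotomy \<Phi> Q \<longleftrightarrow>
     Q ** Q = Q \<and>
     (\<exists>\<kappa> \<kappa>' C C'. \<kappa> > 0 \<and> \<kappa>' > 0 \<and> C \<ge> 1 \<and> C' \<ge> 1 \<and>
        (\<forall>x x'. x \<ge> x' \<longrightarrow>
           norm (\<Phi> x ** Q ** matrix_inv (\<Phi> x')) \<le> C * exp (- \<kappa> * (x - x'))) \<and>
        (\<forall>x x'. x \<le> x' \<longrightarrow>
           norm (\<Phi> x ** (mat 1 - Q) ** matrix_inv (\<Phi> x')) \<le> C' * exp (\<kappa>' * (x - x'))))"

definition lower_Bohl :: "(real \<Rightarrow> complex^'d^'d) \<Rightarrow> complex^'d^'d \<Rightarrow> ereal" where
  "lower_Bohl \<Phi> Q =
     Sup (ereal ` {\<kappa>. \<exists>C. \<forall>x x'. 0 \<le> x \<and> x \<le> x' \<longrightarrow>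
            norm (\<Phi> x ** Q ** matrix_inv (\<Phi> x')) \<le> C * exp (\<kappa> * (x - x'))})"

text \<open>Logarithm of a nonnegative real with \<open>log 0 = -\<infinity>\<close> (whereas \<open>ln 0 = 0\<close> in the library).\<close>

definition elog :: "real \<Rightarrow> ereal" where
  "elog r = (if r = 0 then -\<infinity> else ereal (ln r))"

definition upper_Lyapunov :: "(real \<Rightarrow> complex^'d^'d) \<Rightarrow> complex^'d^'d \<Rightarrow> ereal" where
  "upper_Lyapunov \<Phi> Q = Limsup at_top (\<lambda>x. elog (norm (\<Phi> x ** Q)) / ereal x)"

section \<open>Jost solutions\<close>

text \<open>The measure \<open>e\<^sup>\<beta>\<^sup>x dx\<close> on \<open>[0,\<infinity>)\<close>.\<close>

definition exp_weight :: "real \<Rightarrow> real measure" where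
  "exp_weight \<beta> = density (lebesgue_on {0..}) (\<lambda>x. ennreal (exp (\<beta> * x)))"

definition is_Jost_solution ::
    "(real \<Rightarrow> complex^'d^'d) \<Rightarrow> (real \<Rightarrow> complex^'d^'d) \<Rightarrow> complex^'d^'d \<Rightarrow>
     (real \<Rightarrow> complex^'d^'d) \<Rightarrow> (real \<Rightarrow> complex^'d^'d) \<Rightarrow> bool" where
  "is_Jost_solution A \<Phi> Q R Y \<longleftrightarrow>
     matrix_solution_on {0..} (\<lambda>x. A x + R x) Y \<and>
     Limsup at_top (\<lambda>x. elog (norm (Y x - \<Phi> x ** Q)) / ereal x) < lower_Bohl \<Phi> Q"

text \<open>
  A solution on \<open>[0,\<infinity>)\<close> is represented by a total function that is \<open>undefined\<close> off \<open>[0,\<infinity>)\<close>, so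
  that uniqueness can be stated as equality of functions. The predicate \<open>is_Jost_solution\<close>
  only depends on the restrictions of \<open>R\<close> and \<open>Y\<close> to \<open>[0,\<infinity>)\<close>.
\<close>

definition Jost_solution ::
    "(real \<Rightarrow> complex^'d^'d) \<Rightarrow> (real \<Rightarrow> complex^'d^'d) \<Rightarrow> complex^'d^'d \<Rightarrow>
     (real \<Rightarrow> complex^'d^'d) \<Rightarrow> real \<Rightarrow> complex^'d^'d" where
  "Jost_solution A \<Phi> Q R = (THE Y. Y \<in> extensional {0..} \<and> is_Jost_solution A \<Phi> Q R Y)"

text \<open>
  Continuity on \<open>L\<^sup>1(M)\<close>, with elements given by representatives: two representatives of the same
  class have distance \<open>0\<close>, so this includes that \<open>F\<close> is well defined on classes.
\<close>

definition continuous_on_L1 ::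
    "'a measure \<Rightarrow> (('a \<Rightarrow> 'b::{banach, second_countable_topology}) \<Rightarrow> 'c::metric_space) \<Rightarrow> bool" where
  "continuous_on_L1 M F \<longleftrightarrow>
     (\<forall>f. integrable M f \<longrightarrow>
        (\<forall>\<epsilon>>0. \<exists>\<delta>>0. \<forall>g. integrable M g \<and> (\<integral>x. norm (g x - f x) \<partial>M) < \<delta> \<longrightarrow>
           dist (F g) (F f) < \<epsilon>))"

end

theory Submission
  imports Defs
begin

text \<open>
  Fix \<open>\<kappa>\<close> below the lower Bohl exponent, close enough to it that \<open>\<lambda> - \<kappa> \<le> \<beta>\<close> for some \<open>\<lambda>\<close> above the upper
  Lyapunov exponent. As \<open>\<kappa>\<close> is negative, both parts of the dichotomy give
  \<open>\<parallel>\<Phi>(x) \<Phi>(s)\<^sup>-\<^sup>1\<parallel> \<le> C exp (\<kappa> (x - s))\<close> for \<open>0 \<le> x \<le> s\<close>. By variation of constants, a solution \<open>Y\<close> of the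
  perturbed equation for which \<open>Y - \<Phi> Q\<close> decays faster than \<open>exp (\<kappa> x)\<close> satisfies the Volterra equation
  \<open>Y(x) = \<Phi>(x) (Q - \<integral>\<^sub>x\<^sup>\<infinity> \<Phi>(s)\<^sup>-\<^sup>1 R(s) Y(s) ds)\<close>; conversely, a solution of this
  equation with \<open>Y - \<Phi> Q = O(exp (\<kappa> x))\<close> is a Jost solution. After multiplication by \<open>exp (- \<kappa> x)\<close> its kernel
  is dominated by \<open>C \<parallel>R(s)\<parallel>\<close> and its inhomogeneity by \<open>exp (\<beta> s) \<parallel>R(s)\<parallel>\<close>, both integrable.
  The equation is solved by contraction in a weighted supremum norm; Gronwall's lemma gives
  uniqueness and continuous dependence on \<open>R\<close>.
\<close>

text \<open>The usual Green kernel of a dichotomy integrates the \<open>Q\<close> part forward from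
  the origin. Here decay of \<open>Y - \<Phi> Q\<close> below the lower Bohl exponent rules out the
  modes in the range of \<open>Q\<close> too, so both parts are integrated back from infinity with
  the undivided propagator. The resulting kernel is triangular, which is why \<open>R\<close> may be
  large. The obstacle is that \<open>exp (- \<kappa> x) \<Phi>(x) Q\<close> is unbounded: its growth
  rate can come close to the upper Lyapunov exponent minus \<open>\<kappa>\<close>. A solution is
  therefore sought within a bounded distance of this function, not as a bounded function, and the
  weight \<open>exp (\<beta> x)\<close> on \<open>R\<close> absorbs the growth. This is the meaning
  of the condition on \<open>\<beta>\<close>. Coefficients are merely locally integrable, so
  solutions are absolutely continuous and satisfy the equation almost everywhere; both directions of
  the fundamental theorem of calculus are established in this generality. Exponential boundedness
  enters twice: it bounds \<open>\<Phi>(x)\<^sup>-\<^sup>1\<close> locally, and it makes the lower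
  Bohl exponent finite. Its negativity comes from the dichotomy and
  \<open>Q \<noteq> 0\<close>.\<close>

section \<open>Absolutely continuous functions\<close>

text \<open>
  Lebesgue differentiation: where the difference quotients stay away from \<open>f x\<close>, Henstock's lemma
  bounds the total length of disjoint bad intervals, and Vitali's covering lemma turns this
  into a bound for the outer measure of the exceptional set.
\<close>

lemma negligible_not_has_vector_derivative_integral:
  fixes f :: "real \<Rightarrow> 'a::euclidean_space"
  assumes f: "f integrable_on {a..b}"
  shows "negligible {x \<in> {a<..<b}. \<not> ((\<lambda>t. integral {a..t} f) has_vector_derivative f x) (at x)}"
proof -
  define F where "F = (\<lambda>t. integral {a..t} f)"
  define Bad where "Bad \<eta> = {x \<in> {a<..<b}. \<forall>d>0. \<exists>h. h \<noteq> 0 \<and> \<bar>h\<bar> < d \<and> x + h \<in> {a..b} \<and>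
      norm (F (x + h) - F x - h *\<^sub>R f x) > \<eta> * \<bar>h\<bar>}" for \<eta>
  have "negligible (Bad \<eta>)" if \<eta>: "\<eta> > 0" for \<eta>
    unfolding negligible_outer_le
  proof (intro allI impI)
    fix e :: real assume "e > 0"
    \<comment> \<open>On a bad interval the error exceeds \<open>\<eta>\<close> times its length, so
      the error bound \<open>\<eta> * e / 5\<close> limits the total length to \<open>e / 5\<close>.
      The remaining 5 is the enlargement factor in Vitali's lemma.\<close>
    then have "\<eta> * e / 5 > 0" using \<eta> by simp
    then obtain \<gamma> where "gauge \<gamma>" and \<gamma>: "\<And>p. \<lbrakk>p tagged_partial_division_of (cbox a b); \<gamma> fine p\<rbrakk> \<Longrightarrow>
             sum (\<lambda>(x,k). norm(measure lborel k *\<^sub>R f x - integral k f)) p < \<eta> * e / 5"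
      by (rule Henstock_lemma[OF f[folded box_real]]) blast
    \<comment> \<open>The ball with centre \<open>c (x, h)\<close> and radius
      \<open>r (x, h)\<close> is the closed interval with endpoints \<open>x\<close> and
      \<open>x + h\<close>. Hence \<open>x\<close> lies in it and can serve as its tag.\<close>
    define c where "c = (\<lambda>(x, h). x + h / 2 :: real)"
    define r where "r = (\<lambda>(x::real, h). \<bar>h\<bar> / 2 :: real)"
    define K where "K = {(x, h). x \<in> Bad \<eta> \<and> h \<noteq> 0 \<and> \<bar>h\<bar> \<le> 1 \<and> x + h \<in> {a..b} \<and>
        cball (x + h / 2) (\<bar>h\<bar> / 2) \<subseteq> \<gamma> x \<and> norm (F (x + h) - F x - h *\<^sub>R f x) > \<eta> * \<bar>h\<bar>}"
    have "Bad \<eta> \<subseteq> (\<Union>i\<in>K. cball (c i) (r i))"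
    proof
      fix x assume x: "x \<in> Bad \<eta>"
      from \<open>gauge \<gamma>\<close> have "x \<in> \<gamma> x" "open (\<gamma> x)" by (auto simp: gauge_def)
      then obtain d where d: "d > 0" "ball x d \<subseteq> \<gamma> x" by (meson open_contains_ball)
      then have "min d 1 > 0" by simp
      with x obtain h where h: "h \<noteq> 0" "\<bar>h\<bar> < min d 1" "x + h \<in> {a..b}"
          "norm (F (x + h) - F x - h *\<^sub>R f x) > \<eta> * \<bar>h\<bar>"
        unfolding Bad_def by blast
      have "cball (x + h / 2) (\<bar>h\<bar> / 2) \<subseteq> ball x d"
        using h(2) by (auto simp: dist_real_def abs_if field_simps split: if_splits)
      then have "(x, h) \<in> K"
        using h x d(2) by (auto simp: K_def)
      moreover have "x \<in> cball (c (x, h)) (r (x, h))"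
        by (auto simp: c_def r_def dist_real_def)
      ultimately show "x \<in> (\<Union>i\<in>K. cball (c i) (r i))" by blast
    qed
    moreover have "0 < r i \<and> r i \<le> 1" if "i \<in> K" for i
      using that by (auto simp: r_def K_def)
    ultimately obtain C where C: "countable C" "C \<subseteq> K"
      "pairwise (\<lambda>i j. disjnt (cball (c i) (r i)) (cball (c j) (r j))) C"
      "Bad \<eta> \<subseteq> (\<Union>i\<in>C. cball (c i) (5 * r i))"
      by (rule Vitali_covering_lemma_cballs)
    have fin: "(\<Sum>i\<in>I. 2 * r i) \<le> e / 5" if "I \<subseteq> C" "finite I" for I
    proof -
      define B where "B = (\<lambda>i. cball (c i) (r i))"
      define g where "g = (\<lambda>i. (fst i :: real, B i))"
      have rpos: "r i > 0" if "i \<in> I" for i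
        using that \<open>I \<subseteq> C\<close> C(2) by (auto simp: r_def K_def)
      have disj: "B i \<inter> B j = {}" if "i \<in> I" "j \<in> I" "i \<noteq> j" for i j
        using C(3) that \<open>I \<subseteq> C\<close> unfolding pairwise_def disjnt_def B_def by blast
      have ne: "c i \<in> B i" if "i \<in> I" for i using rpos[OF that] by (simp add: B_def)
      have inj: "inj_on g I"
        using disj ne by (fastforce simp: inj_on_def g_def)
      have sub: "B i \<subseteq> {a..b}" "fst i \<in> B i" "B i \<subseteq> \<gamma> (fst i)" if "i \<in> I" for i
      proof -
        obtain x h where [simp]: "i = (x, h)" by (cases i)
        have "(x, h) \<in> K" using that \<open>I \<subseteq> C\<close> C(2) by auto
        then have "x \<in> {a<..<b}" "x + h \<in> {a..b}" "B i \<subseteq> \<gamma> x"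
          by (auto simp: K_def Bad_def B_def c_def r_def)
        then show "B i \<subseteq> {a..b}" "fst i \<in> B i" "B i \<subseteq> \<gamma> (fst i)"
          by (auto simp: B_def c_def r_def dist_real_def abs_if split: if_splits)
      qed
      have p: "(g ` I) tagged_partial_division_of (cbox a b)"
        unfolding tagged_partial_division_of_def
      proof (intro conjI allI impI)
        show "finite (g ` I)" using \<open>finite I\<close> by simp
      next
        fix x k assume "(x, k) \<in> g ` I"
        then obtain i where i: "i \<in> I" "x = fst i" "k = B i" by (auto simp: g_def)
        then show "x \<in> k" "k \<subseteq> cbox a b" using sub by auto
        show "\<exists>a b. k = cbox a b" unfolding i B_def cball_eq_atLeastAtMost by auto
      next
        fix x k x' k' assume "(x, k) \<in> g ` I \<and> (x', k') \<in> g ` I \<and> (x, k) \<noteq> (x', k')"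
        then obtain i j where "i \<in> I" "k = B i" "j \<in> I" "k' = B j" "i \<noteq> j" by (auto simp: g_def)
        then have "k \<inter> k' = {}" using disj by auto
        then show "interior k \<inter> interior k' = {}"
          by (metis interior_Int interior_empty)
      qed
      have "\<gamma> fine (g ` I)"
        using sub by (auto simp: fine_def g_def)
      from \<gamma>[OF p this]
      have less: "(\<Sum>i\<in>I. norm (measure lborel (B i) *\<^sub>R f (fst i) - integral (B i) f)) < \<eta> * e / 5"
        by (subst (asm) sum.reindex[OF inj]) (simp add: g_def o_def)
      have le: "\<eta> * (2 * r i) \<le> norm (measure lborel (B i) *\<^sub>R f (fst i) - integral (B i) f)" if "i \<in> I" for i
      proof -
        obtain x h where i: "i = (x, h)" by (cases i)
        have K: "(x, h) \<in> K" using that \<open>I \<subseteq> C\<close> C(2) i by auto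
        have ab: "a \<le> x" "x \<le> b" "a \<le> x + h" "x + h \<le> b"
          using K by (auto simp: K_def Bad_def)
        have B: "B i = {min x (x + h)..max x (x + h)}"
          unfolding B_def cball_eq_atLeastAtMost i c_def r_def
          by (auto simp: min_def max_def abs_if field_simps)
        have int: "f integrable_on {a..t}" if "t \<le> b" for t
          by (rule integrable_subinterval_real[OF f]) (use that in auto)
        have "norm (measure lborel (B i) *\<^sub>R f (fst i) - integral (B i) f) = norm (F (x + h) - F x - h *\<^sub>R f x)"
        proof (cases "h \<ge> 0")
          case True
          have "F x + integral {x..x + h} f = F (x + h)"
            unfolding F_def using ab True by (intro Henstock_Kurzweil_Integration.integral_combine int) auto
          then have "integral {x..x + h} f = F (x + h) - F x" by (simp add: algebra_simps)
          then show ?thesis using True unfolding B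
            by (simp add: i min_def max_def norm_minus_commute)
        next
          case False
          have "F (x + h) + integral {x + h..x} f = F x"
            unfolding F_def using ab False by (intro Henstock_Kurzweil_Integration.integral_combine int) auto
          then have F: "F x = F (x + h) + integral {x + h..x} f" by simp
          have "measure lborel (B i) *\<^sub>R f (fst i) - integral (B i) f = F (x + h) - F x - h *\<^sub>R f x"
            using False unfolding B F by (simp add: i min_def max_def)
          then show ?thesis by simp
        qed
        then show ?thesis using K by (simp add: K_def i r_def)
      qed
      have "(\<Sum>i\<in>I. \<eta> * (2 * r i)) < \<eta> * e / 5"
        by (rule le_less_trans[OF sum_mono[OF le] less])
      then have "\<eta> * (\<Sum>i\<in>I. 2 * r i) < \<eta> * (e / 5)" by (simp add: sum_distrib_left)
      then show ?thesis using \<eta> by simp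
    qed
    have bnd: "measure lebesgue (\<Union>i\<in>I. cball (c i) (5 * r i)) \<le> e" if "I \<subseteq> C" "finite I" for I
    proof -
      have "measure lebesgue (\<Union>i\<in>I. cball (c i) (5 * r i)) \<le> (\<Sum>i\<in>I. measure lebesgue (cball (c i) (5 * r i)))"
        using that by (intro measure_UNION_le) auto
      also have "\<dots> = (\<Sum>i\<in>I. 5 * (2 * r i))"
      proof (rule sum.cong[OF refl])
        fix i assume "i \<in> I"
        then have "r i > 0" using that C(2) by (auto simp: r_def K_def)
        then show "measure lebesgue (cball (c i) (5 * r i)) = 5 * (2 * r i)"
          by (simp add: cball_eq_atLeastAtMost)
      qed
      also have "\<dots> = 5 * (\<Sum>i\<in>I. 2 * r i)" by (simp add: sum_distrib_left)
      also have "\<dots> \<le> e" using fin[OF that] by simp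
      finally show ?thesis .
    qed
    show "\<exists>T. Bad \<eta> \<subseteq> T \<and> T \<in> lmeasurable \<and> measure lebesgue T \<le> e"
    proof (intro exI conjI)
      show "Bad \<eta> \<subseteq> (\<Union>i\<in>C. cball (c i) (5 * r i))" by fact
      show "(\<Union>i\<in>C. cball (c i) (5 * r i)) \<in> lmeasurable"
        by (rule fmeasurable_UN_bound[OF \<open>countable C\<close> _ bnd]) auto
      show "measure lebesgue (\<Union>i\<in>C. cball (c i) (5 * r i)) \<le> e"
        by (rule measure_UN_bound[OF \<open>countable C\<close> _ bnd]) auto
    qed
  qed
  then have neg: "negligible (\<Union>n::nat. Bad (1 / (real n + 1)))"
    by (intro negligible_Union_nat) auto
  show ?thesis
  proof (rule negligible_subset[OF neg], rule subsetI, rule ccontr)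
    fix x assume x: "x \<in> {x \<in> {a<..<b}. \<not> ((\<lambda>t. integral {a..t} f) has_vector_derivative f x) (at x)}"
      and nx: "x \<notin> (\<Union>n::nat. Bad (1 / (real n + 1)))"
    have "(F has_vector_derivative f x) (at x)"
      unfolding has_vector_derivative_def has_derivative_at_alt
    proof (intro conjI allI impI)
      fix e :: real assume "e > 0"
      then obtain n :: nat where n: "1 / (real n + 1) < e"
        using nat_approx_posE[of e] by (auto simp: add.commute)
      have "x \<notin> Bad (1 / (real n + 1))" using nx by blast
      then have "\<exists>d>0. \<forall>h. h \<noteq> 0 \<and> \<bar>h\<bar> < d \<and> x + h \<in> {a..b} \<longrightarrow>
           norm (F (x + h) - F x - h *\<^sub>R f x) \<le> 1 / (real n + 1) * \<bar>h\<bar>"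
        using x unfolding Bad_def not_less[symmetric] by blast
      then obtain d where d: "d > 0" "\<And>h. \<lbrakk>h \<noteq> 0; \<bar>h\<bar> < d; x + h \<in> {a..b}\<rbrakk> \<Longrightarrow>
           norm (F (x + h) - F x - h *\<^sub>R f x) \<le> 1 / (real n + 1) * \<bar>h\<bar>"
        by blast
      define d' where "d' = min d (min (x - a) (b - x))"
      have "d' > 0" using d x by (auto simp: d'_def)
      moreover have "norm (F y - F x - (y - x) *\<^sub>R f x) \<le> e * norm (y - x)" if "norm (y - x) < d'" for y
      proof (cases "y = x")
        case False
        then have "norm (F (x + (y - x)) - F x - (y - x) *\<^sub>R f x) \<le> 1 / (real n + 1) * \<bar>y - x\<bar>"
          by (intro d) (use that in \<open>auto simp: d'_def abs_if split: if_splits\<close>)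
        also have "\<dots> \<le> e * \<bar>y - x\<bar>" using n by (intro mult_right_mono) auto
        finally show ?thesis by simp
      qed simp
      ultimately show "\<exists>d>0. \<forall>y. norm (y - x) < d \<longrightarrow> norm (F y - F x - (y - x) *\<^sub>R f x) \<le> e * norm (y - x)"
        by blast
    qed (rule bounded_linear_scaleR_left)
    then show False using x by (simp add: F_def)
  qed
qed

text \<open>Common source of the product rule, where \<open>f\<close> and \<open>g\<close> are the
  factors, and of Lipschitz images, where both are the same function.\<close>

lemma absolutely_continuous_on_dominated:
  assumes f: "absolutely_continuous_on S f" and g: "absolutely_continuous_on S g"
    and h: "\<And>x y. x \<in> S \<Longrightarrow> y \<in> S \<Longrightarrow>
      norm (h y - h x) \<le> L * (norm (f y - f x) + norm (g y - g x))"
  shows "absolutely_continuous_on S h"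
  unfolding absolutely_continuous_on_def
proof (intro allI impI)
  fix \<epsilon> :: real assume "\<epsilon> > 0"
  \<comment> \<open>\<open>L\<close> carries no sign condition; the enlarged constant may be divided
    by.\<close>
  define B where "B = max L 1"
  have "B > 0" "L \<le> B" by (auto simp: B_def)
  have e: "\<epsilon> / (2 * B) > 0" using \<open>\<epsilon> > 0\<close> \<open>B > 0\<close> by simp
  obtain d1 where d1: "d1 > 0" "\<And>D T. \<lbrakk>D division_of T; T \<subseteq> S; (\<Sum>K\<in>D. Sup K - Inf K) < d1\<rbrakk> \<Longrightarrow>
      (\<Sum>K\<in>D. norm (f (Sup K) - f (Inf K))) < \<epsilon> / (2 * B)"
    using f e unfolding absolutely_continuous_on_def by meson
  obtain d2 where d2: "d2 > 0" "\<And>D T. \<lbrakk>D division_of T; T \<subseteq> S; (\<Sum>K\<in>D. Sup K - Inf K) < d2\<rbrakk> \<Longrightarrow>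
      (\<Sum>K\<in>D. norm (g (Sup K) - g (Inf K))) < \<epsilon> / (2 * B)"
    using g e unfolding absolutely_continuous_on_def by meson
  show "\<exists>\<delta>>0. \<forall>D T. D division_of T \<and> T \<subseteq> S \<and> (\<Sum>K\<in>D. Sup K - Inf K) < \<delta> \<longrightarrow>
        (\<Sum>K\<in>D. norm (h (Sup K) - h (Inf K))) < \<epsilon>"
  proof (intro exI[of _ "min d1 d2"] conjI allI impI)
    fix D T assume D: "D division_of T \<and> T \<subseteq> S \<and> (\<Sum>K\<in>D. Sup K - Inf K) < min d1 d2"
    have "(\<Sum>K\<in>D. norm (h (Sup K) - h (Inf K))) \<le>
       (\<Sum>K\<in>D. B * (norm (f (Sup K) - f (Inf K)) + norm (g (Sup K) - g (Inf K))))"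
    proof (rule sum_mono)
      fix K assume "K \<in> D"
      then obtain u v where K: "K = cbox u v" "K \<noteq> {}" "K \<subseteq> S"
        using D by (metis division_ofD(2,3,4) subset_trans)
      then have "Sup K \<in> S" "Inf K \<in> S" by auto
      then have "norm (h (Sup K) - h (Inf K)) \<le> L * (norm (f (Sup K) - f (Inf K)) + norm (g (Sup K) - g (Inf K)))"
        by (intro h)
      also have "\<dots> \<le> B * (norm (f (Sup K) - f (Inf K)) + norm (g (Sup K) - g (Inf K)))"
        using \<open>L \<le> B\<close> by (intro mult_right_mono) auto
      finally show "norm (h (Sup K) - h (Inf K)) \<le> B * (norm (f (Sup K) - f (Inf K)) + norm (g (Sup K) - g (Inf K)))" .
    qed
    also have "\<dots> = B * ((\<Sum>K\<in>D. norm (f (Sup K) - f (Inf K))) + (\<Sum>K\<in>D. norm (g (Sup K) - g (Inf K))))"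
      by (simp only: sum_distrib_left[symmetric] sum.distrib)
    also have "\<dots> < B * (\<epsilon> / (2 * B) + \<epsilon> / (2 * B))"
      using D d1(2)[of D T] d2(2)[of D T] \<open>B > 0\<close> by (intro mult_strict_left_mono add_strict_mono) auto
    also have "\<dots> = \<epsilon>" using \<open>B > 0\<close> by simp
    finally show "(\<Sum>K\<in>D. norm (h (Sup K) - h (Inf K))) < \<epsilon>" .
  qed (use d1 d2 in simp)
qed

lemma absolutely_continuous_on_imp_continuous_on:
  assumes "absolutely_continuous_on {a..b} f"
  shows "continuous_on {a..b} f"
  unfolding continuous_on_iff
proof (intro ballI allI impI)
  fix x and \<epsilon> :: real assume x: "x \<in> {a..b}" and "\<epsilon> > 0"
  then obtain d where d: "d > 0" "\<And>D T. \<lbrakk>D division_of T; T \<subseteq> {a..b}; (\<Sum>K\<in>D. Sup K - Inf K) < d\<rbrakk> \<Longrightarrow>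
      (\<Sum>K\<in>D. norm (f (Sup K) - f (Inf K))) < \<epsilon>"
    using assms unfolding absolutely_continuous_on_def by meson
  have *: "norm (f v - f u) < \<epsilon>" if "u \<le> v" "u \<in> {a..b}" "v \<in> {a..b}" "v - u < d" for u v
    using d(2)[of "{cbox u v}" "cbox u v"] that using division_of_self[of u v] by auto
  show "\<exists>d>0. \<forall>x'\<in>{a..b}. dist x' x < d \<longrightarrow> dist (f x') (f x) < \<epsilon>"
  proof (intro exI conjI ballI impI)
    show "d > 0" by fact
    fix x' assume "x' \<in> {a..b}" "dist x' x < d"
    then show "dist (f x') (f x) < \<epsilon>"
      using *[of x x'] *[of x' x] x by (cases "x \<le> x'") (auto simp: dist_norm norm_minus_commute abs_if split: if_splits)
  qed
qed

lemma absolutely_continuous_on_lipschitz: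
  assumes f: "absolutely_continuous_on S f"
    and h: "\<And>x y. x \<in> S \<Longrightarrow> y \<in> S \<Longrightarrow> norm (h y - h x) \<le> L * norm (f y - f x)"
  shows "absolutely_continuous_on S h"
  \<comment> \<open>The increment of \<open>f\<close> is counted twice in the domination
    hypothesis.\<close>
  by (rule absolutely_continuous_on_dominated[OF f f, where L = "L / 2"]) (use h in auto)

lemma absolutely_continuous_on_bounded_bilinear:
  assumes "bounded_bilinear h"
    and f: "absolutely_continuous_on {a..b} f" and g: "absolutely_continuous_on {a..b} g"
  shows "absolutely_continuous_on {a..b} (\<lambda>x. h (f x) (g x))"
proof -
  interpret bounded_bilinear h by fact
  obtain K where K: "K > 0" "\<And>x y. norm (h x y) \<le> norm x * norm y * K"
    using pos_bounded by blast
  have "bounded (f ` {a..b})" "bounded (g ` {a..b})"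
    using f g by (auto intro!: compact_imp_bounded compact_continuous_image absolutely_continuous_on_imp_continuous_on)
  then obtain M N where M: "M > 0" "\<And>x. x \<in> {a..b} \<Longrightarrow> norm (f x) \<le> M"
    and N: "N > 0" "\<And>x. x \<in> {a..b} \<Longrightarrow> norm (g x) \<le> N"
    unfolding bounded_pos by blast
  show ?thesis
  proof (rule absolutely_continuous_on_dominated[OF f g])
    fix x y assume xy: "x \<in> {a..b}" "y \<in> {a..b}"
    have "h (f y) (g y) - h (f x) (g x) = h (f y - f x) (g y) + h (f x) (g y - g x)"
      by (simp add: diff_left diff_right)
    then have "norm (h (f y) (g y) - h (f x) (g x)) \<le> norm (f y - f x) * norm (g y) * K + norm (f x) * norm (g y - g x) * K"
      by (metis norm_triangle_le add_mono K(2))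
    also have "\<dots> \<le> norm (f y - f x) * (M + N) * K + (M + N) * norm (g y - g x) * K"
      using M(1) N(1) M(2)[OF xy(1)] N(2)[OF xy(2)] K(1)
      by (intro add_mono mult_right_mono mult_left_mono) auto
    also have "\<dots> = (M + N) * K * (norm (f y - f x) + norm (g y - g x))"
      by (simp add: algebra_simps)
    finally show "norm (h (f y) (g y) - h (f x) (g x)) \<le> (M + N) * K * (norm (f y - f x) + norm (g y - g x))" .
  qed
qed

text \<open>Absolute continuity of the integral by truncation. By monotone convergence some
  \<open>min (r x) n\<close> misses less than \<open>\<epsilon> / 2\<close> of the integral,
  whatever the division; the truncated function contributes at most \<open>n\<close> times the total
  length.\<close>

lemma sum_integral_division_small:
  fixes r :: "real \<Rightarrow> real"
  assumes r: "r integrable_on {a..b}" and nonneg: "\<And>x. x \<in> {a..b} \<Longrightarrow> 0 \<le> r x" and "\<epsilon> > 0"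
  obtains \<delta> where "\<delta> > 0" "\<And>D T. \<lbrakk>D division_of T; T \<subseteq> {a..b}; (\<Sum>K\<in>D. Sup K - Inf K) < \<delta>\<rbrakk> \<Longrightarrow>
    (\<Sum>K\<in>D. integral K r) < \<epsilon>"
proof -
  define rn where "rn = (\<lambda>(n::nat) x. min (r x) (real n))"
  have ai: "r absolutely_integrable_on {a..b}"
    using r nonneg by (rule nonnegative_absolutely_integrable_1)
  have rn: "rn n integrable_on {a..b}" for n
    unfolding rn_def
    by (intro set_lebesgue_integral_eq_integral(1) absolutely_integrable_min_1 ai) auto
  have "(\<lambda>n. integral {a..b} (rn n)) \<longlonglongrightarrow> integral {a..b} r"
  proof (rule conjunct2[OF monotone_convergence_increasing])
    show "(\<lambda>k. rn k x) \<longlonglongrightarrow> r x" for x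
    proof (rule tendsto_eventually)
      obtain N where "r x \<le> real N" using real_arch_simple by blast
      then show "\<forall>\<^sub>F k in sequentially. rn k x = r x"
        by (auto simp: rn_def eventually_sequentially intro!: exI[of _ N])
    qed
    have "norm (integral {a..b} (rn k)) \<le> integral {a..b} r" for k
      by (intro integral_norm_bound_integral rn r) (use nonneg in \<open>auto simp: rn_def\<close>)
    then show "bounded (range (\<lambda>k. integral {a..b} (rn k)))"
      by (auto simp: bounded_iff)
  qed (use rn in \<open>auto simp: rn_def\<close>)
  then obtain n where n: "dist (integral {a..b} (rn n)) (integral {a..b} r) < \<epsilon> / 2"
    using \<open>\<epsilon> > 0\<close> by (meson half_gt_zero LIMSEQ_iff_nz metric_LIMSEQ_D order_refl)
  \<comment> \<open>The summand 1 keeps the denominator positive when the truncation level is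
    0.\<close>
  define \<delta> where "\<delta> = \<epsilon> / (2 * (real n + 1))"
  have diff: "(\<lambda>x. r x - rn n x) integrable_on {a..b}" by (intro integrable_diff r rn)
  show thesis
  proof
    show "\<delta> > 0" using \<open>\<epsilon> > 0\<close> by (simp add: \<delta>_def)
    fix D T assume D: "D division_of T" "T \<subseteq> {a..b}" "(\<Sum>K\<in>D. Sup K - Inf K) < \<delta>"
    have K: "\<exists>u v. K = {u..v} \<and> u \<le> v" "K \<subseteq> {a..b}" if "K \<in> D" for K
    proof -
      show "K \<subseteq> {a..b}" using division_ofD(2)[OF D(1) that] D(2) by auto
      show "\<exists>u v. K = {u..v} \<and> u \<le> v"
        using division_ofD(3,4)[OF D(1) that] by (metis atLeastatMost_empty_iff box_real(2))
    qed
    have int: "r integrable_on K" "rn n integrable_on K" "(\<lambda>x. r x - rn n x) integrable_on K" if "K \<in> D" for K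
      using K[OF that] integrable_on_subinterval[OF r] integrable_on_subinterval[OF rn]
        integrable_on_subinterval[OF diff] by auto
    have "(\<Sum>K\<in>D. integral K r) = (\<Sum>K\<in>D. integral K (\<lambda>x. r x - rn n x)) + (\<Sum>K\<in>D. integral K (rn n))"
      unfolding sum.distrib[symmetric] using int
      by (intro sum.cong) (auto simp: Henstock_Kurzweil_Integration.integral_diff)
    also have "(\<Sum>K\<in>D. integral K (\<lambda>x. r x - rn n x)) = integral T (\<lambda>x. r x - rn n x)"
      using int by (intro integral_combine_division_bottomup[symmetric] D)
    also have "\<dots> \<le> integral {a..b} (\<lambda>x. r x - rn n x)"
    proof (rule integral_subset_le)
      show "(\<lambda>x. r x - rn n x) integrable_on T"
        using has_integral_combine_division[OF D(1) integrable_integral[OF int(3)]]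
        by (rule has_integral_integrable)
    qed (use D diff in \<open>auto simp: rn_def\<close>)
    also have "\<dots> < \<epsilon> / 2"
      using n by (simp add: Henstock_Kurzweil_Integration.integral_diff r rn dist_real_def abs_if split: if_splits)
    also have "(\<Sum>K\<in>D. integral K (rn n)) \<le> (\<Sum>K\<in>D. real n * (Sup K - Inf K))"
    proof (rule sum_mono)
      fix k assume k: "k \<in> D"
      then obtain u v where uv: "k = {u..v}" "u \<le> v" using K by blast
      have "integral k (rn n) \<le> integral k (\<lambda>x. real n)"
        using int[OF k] uv by (intro integral_le) (auto simp: rn_def)
      then show "integral k (rn n) \<le> real n * (Sup k - Inf k)"
        using uv by (simp add: mult.commute)
    qed
    also have "\<dots> \<le> real n * \<delta>"
      using D(3) by (simp add: sum_distrib_left[symmetric] mult_left_mono)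
    also have "\<dots> \<le> \<epsilon> / 2"
      using \<open>\<epsilon> > 0\<close> by (simp add: \<delta>_def field_simps)
    finally show "(\<Sum>K\<in>D. integral K r) < \<epsilon>" by simp
  qed
qed

lemma absolutely_continuous_on_integral:
  fixes f :: "real \<Rightarrow> 'a::euclidean_space"
  assumes f: "f absolutely_integrable_on {a..b}"
  shows "absolutely_continuous_on {a..b} (\<lambda>x. integral {a..x} f)"
  unfolding absolutely_continuous_on_def
proof (intro allI impI)
  fix \<epsilon> :: real assume "\<epsilon> > 0"
  have fi: "f integrable_on {a..b}" "(\<lambda>x. norm (f x)) integrable_on {a..b}"
    using f by (auto simp: absolutely_integrable_on_def)
  obtain \<delta> where \<delta>: "\<delta> > 0" "\<And>D T. \<lbrakk>D division_of T; T \<subseteq> {a..b}; (\<Sum>K\<in>D. Sup K - Inf K) < \<delta>\<rbrakk> \<Longrightarrow>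
    (\<Sum>K\<in>D. integral K (\<lambda>x. norm (f x))) < \<epsilon>"
    using sum_integral_division_small[OF fi(2) _ \<open>\<epsilon> > 0\<close>] by auto
  show "\<exists>\<delta>>0. \<forall>D T. D division_of T \<and> T \<subseteq> {a..b} \<and> (\<Sum>K\<in>D. Sup K - Inf K) < \<delta> \<longrightarrow>
        (\<Sum>K\<in>D. norm (integral {a..Sup K} f - integral {a..Inf K} f)) < \<epsilon>"
  proof (intro exI[of _ \<delta>] conjI allI impI)
    fix D T assume D: "D division_of T \<and> T \<subseteq> {a..b} \<and> (\<Sum>K\<in>D. Sup K - Inf K) < \<delta>"
    have "(\<Sum>K\<in>D. norm (integral {a..Sup K} f - integral {a..Inf K} f)) \<le> (\<Sum>K\<in>D. integral K (\<lambda>x. norm (f x)))"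
    proof (rule sum_mono)
      fix K assume "K \<in> D"
      then have K: "K \<subseteq> {a..b}" "K \<noteq> {}"
        using D division_ofD(2,3)[of D T K] by auto
      obtain u v where uvK: "K = {u..v}"
        using D \<open>K \<in> D\<close> division_ofD(4)[of D T K] by auto
      then have uv: "K = {u..v}" "u \<le> v" "a \<le> u" "v \<le> b" using K by auto
      have "f integrable_on {a..v}" by (rule integrable_subinterval_real[OF fi(1)]) (use uv in auto)
      then have "integral {a..u} f + integral {u..v} f = integral {a..v} f"
        using uv by (intro Henstock_Kurzweil_Integration.integral_combine) auto
      then have "integral {a..Sup K} f - integral {a..Inf K} f = integral K f"
        using uv by (simp add: algebra_simps)
      also have "norm \<dots> \<le> integral K (\<lambda>x. norm (f x))"
        unfolding uv(1)
        by (rule integral_norm_bound_integral[OF integrable_subinterval_real[OF fi(1)]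
            integrable_subinterval_real[OF fi(2)]]) (use uv in auto)
      finally show "norm (integral {a..Sup K} f - integral {a..Inf K} f) \<le> integral K (\<lambda>x. norm (f x))" .
    qed
    also have "\<dots> < \<epsilon>" using D \<delta>(2) by blast
    finally show "(\<Sum>K\<in>D. norm (integral {a..Sup K} f - integral {a..Inf K} f)) < \<epsilon>" .
  qed fact
qed

text \<open>
  The gauge confines the intervals tagged in the null set \<open>N\<close> to an open set of small measure, where
  absolute continuity makes the increments of \<open>f\<close> negligible.
\<close>

lemma absolutely_continuous_on_has_integral:
  fixes f :: "real \<Rightarrow> 'a::euclidean_space"
  assumes "a \<le> b" and ac: "absolutely_continuous_on {a..b} f" and N: "negligible N"
    and deriv: "\<And>x. x \<in> {a..b} - N \<Longrightarrow> (f has_vector_derivative f' x) (at x within {a..b})"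
  shows "(f' has_integral (f b - f a)) {a..b}"
proof -
  \<comment> \<open>Setting the integrand to 0 on \<open>N\<close> does not change the integral, and
    a cell tagged in \<open>N\<close> then contributes nothing but the increment of
    \<open>f\<close>.\<close>
  define h where "h = (\<lambda>x. if x \<in> N then 0 else f' x)"
  have "(h has_integral (f b - f a)) {a..b}"
    unfolding has_integral_real
  proof (intro allI impI)
    fix \<epsilon> :: real assume "\<epsilon> > 0"
    \<comment> \<open>The summand 1 covers the case \<open>a = b\<close>.\<close>
    define e where "e = \<epsilon> / (2 * (b - a + 1))"
    have "e > 0" using \<open>\<epsilon> > 0\<close> \<open>a \<le> b\<close> by (simp add: e_def)
    have "\<epsilon> / 2 > 0" using \<open>\<epsilon> > 0\<close> by simp
    then obtain \<delta> where \<delta>: "\<delta> > 0" "\<And>D T. \<lbrakk>D division_of T; T \<subseteq> {a..b}; (\<Sum>K\<in>D. Sup K - Inf K) < \<delta>\<rbrakk> \<Longrightarrow>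
        (\<Sum>K\<in>D. norm (f (Sup K) - f (Inf K))) < \<epsilon> / 2"
      using ac unfolding absolutely_continuous_on_def by meson
    have Nl: "N \<in> lmeasurable" using N by (rule negligible_imp_measurable)
    obtain U where U: "open U" "N \<subseteq> U" "U - N \<in> lmeasurable" "emeasure lebesgue (U - N) < ennreal \<delta>"
      using sets_lebesgue_outer_open[of N \<delta>] Nl \<delta>(1) by blast
    have Ul: "U \<in> lmeasurable"
      using fmeasurable.Un[OF Nl U(3)] U(2) by (simp add: Un_Diff_cancel sup.absorb2)
    have "measure lebesgue U = measure lebesgue (U - N)"
      using N U(1) by (intro measure_Diff_null_set[symmetric]) (auto simp: negligible_iff_null_sets)
    then have mU: "measure lebesgue U < \<delta>"
      using U(3,4) \<delta>(1) by (simp add: emeasure_eq_measure2 ennreal_less_iff)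
    have "\<exists>d>0. \<forall>y\<in>{a..b}. norm (y - x) < d \<longrightarrow> norm (f y - f x - (y - x) *\<^sub>R f' x) \<le> e * norm (y - x)"
      if "x \<in> {a..b} - N" for x
      using deriv[OF that] \<open>e > 0\<close> unfolding has_vector_derivative_def has_derivative_within_alt by blast
    then obtain d where d: "\<And>x. x \<in> {a..b} - N \<Longrightarrow> d x > 0"
      "\<And>x y. \<lbrakk>x \<in> {a..b} - N; y \<in> {a..b}; norm (y - x) < d x\<rbrakk> \<Longrightarrow>
        norm (f y - f x - (y - x) *\<^sub>R f' x) \<le> e * norm (y - x)"
      by metis
    define \<gamma> where "\<gamma> = (\<lambda>x. if x \<in> N then U else if x \<in> {a..b} then ball x (d x) else ball x 1)"
    have "gauge \<gamma>"
      using U d(1) by (auto simp: gauge_def \<gamma>_def)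
    moreover have "norm ((\<Sum>(x, k)\<in>p. measure lborel k *\<^sub>R h x) - (f b - f a)) < \<epsilon>"
      if p: "p tagged_division_of {a..b}" "\<gamma> fine p" for p
    proof -
      define \<phi> where "\<phi> = (\<lambda>(x, k). measure lborel k *\<^sub>R h x - (f (Sup k) - f (Inf k)))"
      define q where "q = {z \<in> p. fst z \<in> N}"
      have finp: "finite p" using p(1) by blast
      have k: "\<exists>u v. k = {u..v} \<and> u \<le> x \<and> x \<le> v \<and> a \<le> u \<and> v \<le> b \<and> k \<subseteq> \<gamma> x" if "(x, k) \<in> p" for x k
      proof -
        have "x \<in> k" "k \<subseteq> {a..b}" "k \<subseteq> \<gamma> x"
          using tagged_division_ofD(2,3)[OF p(1) that] fineD[OF p(2) that] by auto
        moreover obtain u v where uv: "k = {u..v}"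
          using tagged_division_ofD(4)[OF p(1) \<open>(x, k) \<in> p\<close>] by auto
        ultimately show ?thesis unfolding uv by (intro exI[of _ u] exI[of _ v]) auto
      qed
      have "(\<Sum>(x, k)\<in>p. measure lborel k *\<^sub>R h x) - (f b - f a) = (\<Sum>z\<in>p. \<phi> z)"
        using additive_tagged_division_1[OF \<open>a \<le> b\<close> p(1), of f]
        by (simp add: \<phi>_def split_def sum_subtractf)
      also have "\<dots> = (\<Sum>z\<in>q. \<phi> z) + (\<Sum>z\<in>p - q. \<phi> z)"
        using finp by (subst sum.subset_diff[of q p]) (auto simp: q_def)
      also have "norm \<dots> \<le> (\<Sum>z\<in>q. norm (\<phi> z)) + (\<Sum>z\<in>p - q. norm (\<phi> z))"
        by (intro norm_triangle_mono norm_sum)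
      also have "(\<Sum>z\<in>p - q. norm (\<phi> z)) \<le> (\<Sum>(x, k)\<in>p - q. e * measure lborel k)"
      proof (rule sum_mono)
        fix z assume z: "z \<in> p - q"
        obtain x K where xk: "z = (x, K)" by (cases z)
        with z have xN: "(x, K) \<in> p" "x \<notin> N" by (auto simp: q_def)
        from k[OF xN(1)] obtain u v where uv: "K = {u..v}" "u \<le> x" "x \<le> v" "a \<le> u" "v \<le> b" "K \<subseteq> \<gamma> x" by blast
        have "{u..v} \<subseteq> ball x (d x)" using uv xN by (auto simp: \<gamma>_def)
        then have "u \<in> ball x (d x)" "v \<in> ball x (d x)" using uv by (meson atLeastAtMost_iff order_refl order_trans subsetD)+
        then have *: "norm (u - x) < d x" "norm (v - x) < d x" by (auto simp: dist_real_def)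
        have x: "x \<in> {a..b} - N" using uv xN by auto
        \<comment> \<open>Both endpoints are compared with the tag. As it lies between them, the
          distances \<open>\<bar>u - x\<bar>\<close> and \<open>\<bar>v - x\<bar>\<close> add up to
          the length of the cell.\<close>
        have "\<phi> z = (f u - f x - (u - x) *\<^sub>R f' x) - (f v - f x - (v - x) *\<^sub>R f' x)"
          using uv xN by (simp add: \<phi>_def xk h_def algebra_simps)
        also have "norm \<dots> \<le> e * norm (u - x) + e * norm (v - x)"
          using uv by (intro norm_triangle_le_diff add_mono d x *) auto
        also have "\<dots> = e * measure lborel K" using uv by (simp add: algebra_simps)
        finally show "norm (\<phi> z) \<le> (case z of (x, k) \<Rightarrow> e * measure lborel k)" by (simp add: xk)
      qed
      also have "\<dots> \<le> (\<Sum>(x, k)\<in>p. e * measure lborel k)"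
        using \<open>e > 0\<close> finp by (intro sum_mono2) auto
      also have "\<dots> = e * (b - a)"
        using additive_content_tagged_division[of p a b] p(1) \<open>a \<le> b\<close>
        by (simp add: sum_distrib_left[symmetric] split_def)
      also have "\<dots> < \<epsilon> / 2"
        using \<open>\<epsilon> > 0\<close> \<open>a \<le> b\<close> by (simp add: e_def field_simps)
      also have "(\<Sum>z\<in>q. norm (\<phi> z)) = (\<Sum>(x, k)\<in>q. norm (f (Sup k) - f (Inf k)))"
        by (intro sum.cong) (auto simp: \<phi>_def q_def h_def norm_minus_commute)
      \<comment> \<open>Replacing tagged cells by their set requires a summand that vanishes on
        degenerate cells, which could be shared by several tags. One-point cells give 0 anyway; the
        case distinction deals with the empty set, where \<open>Sup\<close> and \<open>Inf\<close>
        have no useful value.\<close>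
      also have "\<dots> = (\<Sum>(x, k)\<in>q. if k = {} then 0 else norm (f (Sup k) - f (Inf k)))"
        using k by (intro sum.cong) (fastforce simp: q_def)+
      also have "\<dots> = (\<Sum>k\<in>snd ` q. if k = {} then 0 else norm (f (Sup k) - f (Inf k)))"
      proof (rule sum.over_tagged_division_lemma)
        have "q tagged_partial_division_of {a..b}"
          using p(1) by (auto simp: q_def tagged_division_of_def intro: tagged_partial_division_subset)
        then show "q tagged_division_of \<Union>(snd ` q)" by (rule tagged_partial_division_of_Union_self)
      qed auto
      also have "\<dots> = (\<Sum>k\<in>snd ` q. norm (f (Sup k) - f (Inf k)))"
        using k by (intro sum.cong) (fastforce simp: q_def)+
      also have "\<dots> < \<epsilon> / 2"
      proof (rule \<delta>(2))
        have "q tagged_partial_division_of {a..b}"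
          using p(1) by (auto simp: q_def tagged_division_of_def intro: tagged_partial_division_subset)
        then show D: "snd ` q division_of \<Union>(snd ` q)" by (rule partial_division_of_tagged_division)
        show "\<Union>(snd ` q) \<subseteq> {a..b}" using k by (fastforce simp: q_def)
        have "compact (\<Union>(snd ` q))"
        proof (rule compact_Union)
          show "finite (snd ` q)" using finp by (simp add: q_def)
          show "compact K" if K: "K \<in> snd ` q" for K
          proof -
            from K obtain x where "(x, K) \<in> p" by (auto simp: q_def)
            from k[OF this] show ?thesis by auto
          qed
        qed
        then have meas: "\<Union>(snd ` q) \<in> lmeasurable" by (rule lmeasurable_compact)
        have "(\<Sum>K\<in>snd ` q. Sup K - Inf K) = (\<Sum>K\<in>snd ` q. integral K (\<lambda>x. 1::real))"
        proof (rule sum.cong[OF refl])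
          fix K assume "K \<in> snd ` q"
          then obtain x where "(x, K) \<in> p" by (auto simp: q_def)
          from k[OF this] show "Sup K - Inf K = integral K (\<lambda>x. 1::real)" by auto
        qed
        also have "\<dots> = integral (\<Union>(snd ` q)) (\<lambda>x. 1::real)"
          by (rule integral_combine_division_bottomup[symmetric, OF D])
            (metis D division_ofD(4) integrable_const)
        also have "\<dots> = measure lebesgue (\<Union>(snd ` q))"
          by (rule lmeasure_integral[symmetric, OF meas])
        also have "\<dots> \<le> measure lebesgue U"
        proof (rule measure_mono_fmeasurable)
          show "\<Union>(snd ` q) \<subseteq> U" using k by (fastforce simp: q_def \<gamma>_def)
          show "\<Union>(snd ` q) \<in> sets lebesgue"
            using meas by (rule fmeasurableD)
        qed fact
        also have "\<dots> < \<delta>" by fact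
        finally show "(\<Sum>K\<in>snd ` q. Sup K - Inf K) < \<delta>" .
      qed
      finally show ?thesis by simp
    qed
    ultimately show "\<exists>\<gamma>. gauge \<gamma> \<and> (\<forall>\<D>. \<D> tagged_division_of {a..b} \<and> \<gamma> fine \<D> \<longrightarrow>
        norm ((\<Sum>(x, k)\<in>\<D>. measure lborel k *\<^sub>R h x) - (f b - f a)) < \<epsilon>)"
      by (metis (no_types, lifting))
  qed
  then show ?thesis
    by (rule has_integral_spike[OF N, rotated]) (auto simp: h_def)
qed

section \<open>A Gronwall lemma on tails\<close>

lemma absolutely_integrable_on_tail:
  fixes f :: "real \<Rightarrow> 'a::euclidean_space"
  assumes "f absolutely_integrable_on {c..}" "c \<le> x"
  shows "f absolutely_integrable_on {x..}"
  by (rule set_integrable_subset[OF assms(1)]) (use assms(2) in auto)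

lemma integral_tail_split:
  fixes f :: "real \<Rightarrow> 'a::euclidean_space"
  assumes f: "f absolutely_integrable_on {c..}" and "c \<le> x" "x \<le> t"
  shows "integral {x..} f = integral {x..t} f + integral {t..} f"
proof -
  have "f absolutely_integrable_on {x..}" by (rule absolutely_integrable_on_tail[OF assms(1,2)])
  then have "f absolutely_integrable_on {x..t}" "f absolutely_integrable_on {t..}"
    using assms(3) by (auto elim!: set_integrable_subset)
  then have "integral ({x..t} \<union> {t..}) f = integral {x..t} f + integral {t..} f"
    by (intro Henstock_Kurzweil_Integration.integral_Un set_lebesgue_integral_eq_integral(1))
      (auto intro!: negligible_subset[OF negligible_sing[of t]])
  moreover have "{x..t} \<union> {t..} = {x..}" using assms(3) by auto
  ultimately show ?thesis by simp
qed

lemma tendsto_integral_tail: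
  fixes f :: "real \<Rightarrow> 'a::euclidean_space"
  assumes f: "f absolutely_integrable_on {x..}"
  shows "((\<lambda>t. integral {x..t} f) \<longlongrightarrow> integral {x..} f) at_top"
proof -
  have "((\<lambda>t. set_lebesgue_integral lebesgue {x..t} f) \<longlongrightarrow> set_lebesgue_integral lebesgue {x..} f) at_top"
    by (rule tendsto_set_lebesgue_integral_at_top[OF _ f]) auto
  moreover have "set_lebesgue_integral lebesgue {x..t} f = integral {x..t} f" for t
    by (intro set_lebesgue_integral_eq_integral(2) set_integrable_subset[OF f]) auto
  ultimately show ?thesis
    using set_lebesgue_integral_eq_integral(2)[OF f] by simp
qed

lemma continuous_on_integral_tail:
  fixes f :: "real \<Rightarrow> 'a::euclidean_space"
  assumes f: "f absolutely_integrable_on {c..}"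
  shows "continuous_on {c..} (\<lambda>x. integral {x..} f)"
proof -
  have "continuous (at x within {c..}) (\<lambda>x. integral {x..} f)" if "x \<in> {c..}" for x
  proof -
    have "continuous_on {c..x + 1} (\<lambda>t. integral {c..} f - integral {c..t} f)"
      by (intro continuous_intros indefinite_integral_continuous_1
          set_lebesgue_integral_eq_integral(1) set_integrable_subset[OF f]) auto
    then have "continuous_on {c..x + 1} (\<lambda>t. integral {t..} f)"
      by (rule continuous_on_eq) (use integral_tail_split[OF f order_refl] in auto)
    then have "continuous (at x within {c..x + 1}) (\<lambda>t. integral {t..} f)"
      using that by (simp add: continuous_on_eq_continuous_within)
    moreover have "at x within {c..x + 1} = at x within {c..}"
      by (rule at_within_nhd[of _ "{..<x + 1}"]) auto
    ultimately show ?thesis by simp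
  qed
  then show ?thesis by (simp add: continuous_on_eq_continuous_within)
qed

lemma integral_tail_nonneg:
  fixes r :: "real \<Rightarrow> real"
  assumes r: "r absolutely_integrable_on {0..}" and nonneg: "\<And>s. s \<ge> 0 \<Longrightarrow> 0 \<le> r s" and "0 \<le> x"
  shows "0 \<le> integral {x..} r"
  by (rule Henstock_Kurzweil_Integration.integral_nonneg)
    (use nonneg \<open>0 \<le> x\<close> set_lebesgue_integral_eq_integral(1)[OF absolutely_integrable_on_tail[OF r \<open>0 \<le> x\<close>]] in auto)

lemma integral_tail_antimono:
  fixes r :: "real \<Rightarrow> real"
  assumes r: "r absolutely_integrable_on {0..}" and nonneg: "\<And>s. s \<ge> 0 \<Longrightarrow> 0 \<le> r s" and "0 \<le> x" "x \<le> y"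
  shows "integral {y..} r \<le> integral {x..} r"
  by (rule integral_subset_le)
    (use nonneg \<open>0 \<le> x\<close> \<open>x \<le> y\<close> set_lebesgue_integral_eq_integral(1)[OF absolutely_integrable_on_tail[OF r \<open>0 \<le> x\<close>]]
      set_lebesgue_integral_eq_integral(1)[OF absolutely_integrable_on_tail[OF r order_trans[OF \<open>0 \<le> x\<close> \<open>x \<le> y\<close>]]] in auto)

lemma absolutely_integrable_bounded_continuous_product:
  fixes f :: "real \<Rightarrow> 'a::euclidean_space" and g :: "real \<Rightarrow> 'b::euclidean_space"
    and h :: "'a \<Rightarrow> 'b \<Rightarrow> 'c::euclidean_space"
  assumes "bounded_bilinear h" "continuous_on S f" "S \<in> sets lebesgue" "bounded (f ` S)"
    "g absolutely_integrable_on S"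
  shows "(\<lambda>x. h (f x) (g x)) absolutely_integrable_on S"
proof (rule absolutely_integrable_bounded_measurable_product[where h = h and f = f and g = g])
  show "bilinear h" using assms(1) by (simp only: bilinear_conv_bounded_bilinear)
  show "f \<in> borel_measurable (lebesgue_on S)"
    using assms(2,3) by (rule continuous_imp_measurable_on_sets_lebesgue)
qed fact+

text \<open>A Lipschitz bound for the exponential on \<open>{..B}\<close>, from
  \<open>1 + t \<le> exp t\<close>. It transfers absolute continuity from a function bounded above
  to its exponential.\<close>

lemma abs_exp_diff_le:
  fixes p q B :: real
  assumes "p \<le> B" "q \<le> B"
  shows "\<bar>exp p - exp q\<bar> \<le> exp B * \<bar>p - q\<bar>"
proof -
  have *: "exp p - exp q \<le> exp B * (p - q)" if "q \<le> p" "p \<le> B" for p q :: real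
  proof -
    have "exp p * (1 + (q - p)) \<le> exp p * exp (q - p)"
      by (intro mult_left_mono exp_ge_add_one_self) auto
    then have "exp p - exp q \<le> exp p * (p - q)"
      by (simp add: exp_diff algebra_simps)
    also have "\<dots> \<le> exp B * (p - q)" using that by (intro mult_right_mono) auto
    finally show ?thesis .
  qed
  show ?thesis
    using *[of p q] *[of q p] assms by (cases "p \<le> q") (auto simp: abs_if)
qed

text \<open>With respect to the weight \<open>w\<close>, integration against \<open>r\<close> over tails is a contraction with factor \<open>1/2\<close>.\<close>

lemma integral_tail_exp_weight:
  fixes r :: "real \<Rightarrow> real"
  assumes r: "r absolutely_integrable_on {0..}" and nonneg: "\<And>s. s \<ge> 0 \<Longrightarrow> 0 \<le> r s"
    and "0 \<le> x"
  defines "w \<equiv> \<lambda>s. exp (2 * integral {s..} r)"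
  shows "(\<lambda>s. r s * w s) absolutely_integrable_on {x..}"
    and "integral {x..} (\<lambda>s. r s * w s) \<le> w x / 2"
proof -
  have rx: "r absolutely_integrable_on {x..}" by (rule absolutely_integrable_on_tail[OF r \<open>0 \<le> x\<close>])
  have tail_mono: "integral {s..} r \<le> integral {x..} r" if "x \<le> s" for s
    by (rule integral_tail_antimono[OF r nonneg \<open>0 \<le> x\<close> that])
  have cont: "continuous_on {x..} w"
    unfolding w_def by (intro continuous_intros continuous_on_integral_tail rx)
  have "bounded (w ` {x..})"
    using tail_mono by (auto simp: bounded_iff w_def intro!: exI[of _ "exp (2 * integral {x..} r)"])
  then show int: "(\<lambda>s. r s * w s) absolutely_integrable_on {x..}"
    using absolutely_integrable_bounded_continuous_product[OF bounded_bilinear_mult cont _ _ rx]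
    by (simp add: mult.commute)
  have "integral {x..t} (\<lambda>s. r s * w s) \<le> w x / 2" if "x \<le> t" for t
  proof -
    define F where "F = (\<lambda>s. integral {x..s} r)"
    \<comment> \<open>\<open>E\<close> is \<open>w\<close> on \<open>{x..t}\<close>, rewritten with
      the indefinite integral started at \<open>x\<close>, for which absolute continuity and the
      derivative almost everywhere are known. Since \<open>E' = - 2 r w\<close> there, the integral
      of \<open>r w\<close> telescopes to \<open>(w x - w t) / 2\<close>; the contraction factor is
      the reciprocal of the 2 in the exponent of \<open>w\<close>.\<close>
    define E where "E = (\<lambda>s. exp (2 * (integral {x..} r - F s)))"
    have Ew: "E s = w s" if "x \<le> s" for s
      using integral_tail_split[OF rx order_refl that] by (simp add: E_def w_def F_def)
    have rt: "r absolutely_integrable_on {x..t}" by (rule set_integrable_subset[OF rx]) auto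
    have F: "absolutely_continuous_on {x..t} F"
      unfolding F_def by (rule absolutely_continuous_on_integral[OF rt])
    have Fnn: "0 \<le> F s" if "s \<in> {x..t}" for s
      unfolding F_def
    proof (rule Henstock_Kurzweil_Integration.integral_nonneg)
      show "r integrable_on {x..s}"
        by (rule set_lebesgue_integral_eq_integral(1), rule set_integrable_subset[OF rt]) (use that in auto)
    qed (use nonneg \<open>0 \<le> x\<close> in auto)
    have "absolutely_continuous_on {x..t} E"
    proof (rule absolutely_continuous_on_lipschitz[OF F])
      fix p q assume "p \<in> {x..t}" "q \<in> {x..t}"
      then have "\<bar>E q - E p\<bar> \<le> exp (2 * integral {x..} r) * \<bar>2 * (integral {x..} r - F q) - 2 * (integral {x..} r - F p)\<bar>"
        unfolding E_def using Fnn by (intro abs_exp_diff_le) auto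
      also have "\<dots> = (2 * exp (2 * integral {x..} r)) * \<bar>F q - F p\<bar>" by (simp add: abs_if algebra_simps)
      finally show "norm (E q - E p) \<le> (2 * exp (2 * integral {x..} r)) * norm (F q - F p)" by simp
    qed
    moreover define N where "N = {x, t} \<union> {s \<in> {x<..<t}. \<not> (F has_vector_derivative r s) (at s)}"
    have "negligible N"
      unfolding N_def F_def
      by (intro negligible_Un negligible_not_has_vector_derivative_integral
          set_lebesgue_integral_eq_integral(1) rt) auto
    moreover have "(E has_vector_derivative (- 2 * (r s * w s))) (at s within {x..t})"
      if "s \<in> {x..t} - N" for s
    proof -
      have "(F has_real_derivative r s) (at s)"
        using that by (auto simp: N_def has_real_derivative_iff_has_vector_derivative)
      then have "(E has_real_derivative (exp (2 * (integral {x..} r - F s)) * (2 * (0 - r s)))) (at s)"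
        unfolding E_def by (auto intro!: derivative_eq_intros)
      then have "(E has_real_derivative (- 2 * (r s * w s))) (at s within {x..t})"
        using Ew[of s] that by (auto simp: E_def algebra_simps intro: has_field_derivative_at_within)
      then show ?thesis by (simp add: has_real_derivative_iff_has_vector_derivative)
    qed
    ultimately have "((\<lambda>s. - 2 * (r s * w s)) has_integral (E t - E x)) {x..t}"
      by (rule absolutely_continuous_on_has_integral[OF that])
    from has_integral_mult_right[OF this, of "- 1 / 2"]
    have "((\<lambda>s. r s * w s) has_integral ((- 1 / 2) * (E t - E x))) {x..t}"
      by (rule has_integral_eq[rotated]) auto
    moreover have "(- 1 / 2) * (E t - E x) = (w x - w t) / 2"
      using that by (simp add: Ew field_simps)
    ultimately have "((\<lambda>s. r s * w s) has_integral ((w x - w t) / 2)) {x..t}"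
      by (simp only:)
    then have "integral {x..t} (\<lambda>s. r s * w s) = (w x - w t) / 2"
      by (rule integral_unique)
    then show ?thesis by (simp add: w_def)
  qed
  then have "\<forall>\<^sub>F t in at_top. integral {x..t} (\<lambda>s. r s * w s) \<le> w x / 2"
    unfolding eventually_at_top_linorder by (intro exI[of _ x]) simp
  then show "integral {x..} (\<lambda>s. r s * w s) \<le> w x / 2"
    by (rule tendsto_upperbound[OF tendsto_integral_tail[OF int]]) simp
qed

text \<open>No iteration: with \<open>m\<close> the supremum of \<open>u / w\<close>, the
  contraction property of the weight gives \<open>m \<le> a + m / 2\<close>, hence
  \<open>m \<le> 2 a\<close>. The bound \<open>M\<close> makes this supremum finite. Compared with
  the classical bound, a factor 2 is lost in front and in the exponent.\<close>

lemma gronwall_tail: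
  fixes r u :: "real \<Rightarrow> real"
  assumes r: "r absolutely_integrable_on {0..}" and nonneg: "\<And>s. s \<ge> 0 \<Longrightarrow> 0 \<le> r s"
    and u: "\<And>s. s \<ge> 0 \<Longrightarrow> u s \<le> M" and ru: "(\<lambda>s. r s * u s) absolutely_integrable_on {0..}"
    and le: "\<And>x. x \<ge> 0 \<Longrightarrow> u x \<le> a + integral {x..} (\<lambda>s. r s * u s)"
    and "0 \<le> a" "0 \<le> x"
  shows "u x \<le> 2 * a * exp (2 * integral {x..} r)"
proof -
  define w where "w = (\<lambda>s. exp (2 * integral {s..} r))"
  have w1: "1 \<le> w s" if "0 \<le> s" for s
    using integral_tail_nonneg[OF r nonneg that] by (simp add: w_def)
  define S where "S = (\<lambda>s. u s / w s) ` {0..}"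
  have "u s / w s \<le> max M 0" if "0 \<le> s" for s
  proof -
    have "u s \<le> max M 0 * 1" using u[OF that] by simp
    also have "\<dots> \<le> max M 0 * w s" using w1[OF that] by (intro mult_left_mono) auto
    finally show ?thesis using w1[OF that] by (simp add: divide_simps)
  qed
  then have bdd: "bdd_above S" by (auto simp: S_def bdd_above_def)
  \<comment> \<open>\<open>u\<close> may be negative everywhere; the integral estimate below
    multiplies by \<open>m\<close> and needs it nonnegative.\<close>
  define m where "m = max 0 (Sup S)"
  have um: "u s \<le> m * w s" if "0 \<le> s" for s
  proof -
    have "u s / w s \<le> Sup S" using bdd that by (intro cSup_upper) (auto simp: S_def)
    then have "u s / w s \<le> m" by (simp add: m_def)
    then show ?thesis using w1[OF that] by (simp add: divide_simps)
  qed
  have "u s / w s \<le> a + m / 2" if s: "0 \<le> s" for s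
  proof -
    note key = integral_tail_exp_weight[OF r nonneg s]
    have "integral {s..} (\<lambda>s. r s * u s) \<le> integral {s..} (\<lambda>s. m * (r s * w s))"
    proof (rule integral_le)
      show "(\<lambda>s. r s * u s) integrable_on {s..}"
        using absolutely_integrable_on_tail[OF ru s] by (rule set_lebesgue_integral_eq_integral(1))
      show "(\<lambda>s. m * (r s * w s)) integrable_on {s..}"
        using key(1) unfolding w_def
        by (intro integrable_on_mult_right set_lebesgue_integral_eq_integral(1)) auto
      fix y assume "y \<in> {s..}"
      then show "r y * u y \<le> m * (r y * w y)"
        using mult_left_mono[OF um[of y] nonneg[of y]] s by (simp add: mult.left_commute)
    qed
    also have "\<dots> = m * integral {s..} (\<lambda>s. r s * w s)"
      by (rule integral_mult_right)
    also have "\<dots> \<le> m * (w s / 2)"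
      using key(2) by (intro mult_left_mono) (auto simp: w_def m_def)
    finally have "u s \<le> a + m * w s / 2" using le[OF s] by simp
    also have "a \<le> a * w s" using w1[OF s] \<open>0 \<le> a\<close> by (simp add: mult_le_cancel_left1)
    finally show ?thesis using w1[OF s] by (simp add: divide_simps algebra_simps)
  qed
  then have "Sup S \<le> a + m / 2" by (intro cSup_least) (auto simp: S_def)
  then have "m \<le> 2 * a" using \<open>0 \<le> a\<close> by (simp add: m_def max_def split: if_splits)
  then have "m * w x \<le> 2 * a * w x" using w1[OF \<open>0 \<le> x\<close>] by (intro mult_right_mono) auto
  then show ?thesis using um[OF \<open>0 \<le> x\<close>] unfolding w_def by linarith
qed

section \<open>The fundamental matrix\<close>

text \<open>Cauchy-Schwarz in every entry of the product; the double sum over rows and columns then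
  factors.\<close>

lemma norm_matrix_matrix_mult_le:
  fixes A :: "complex^'n^'m" and B :: "complex^'p^'n"
  shows "norm (A ** B) \<le> norm A * norm B"
proof -
  have nv: "norm (M :: complex^'x^'y) ^ 2 = (\<Sum>i\<in>UNIV. \<Sum>j\<in>UNIV. norm (M $ i $ j) ^ 2)" for M
    by (simp add: norm_vec_def L2_set_def sum_nonneg)
  have "norm (A ** B) ^ 2 \<le> (\<Sum>i\<in>UNIV. \<Sum>j\<in>UNIV.
      (\<Sum>k\<in>UNIV. norm (A $ i $ k) ^ 2) * (\<Sum>k\<in>UNIV. norm (B $ k $ j) ^ 2))"
    unfolding nv[of "A ** B"]
  proof (intro sum_mono)
    fix i j
    have "norm ((A ** B) $ i $ j) \<le> (\<Sum>k\<in>UNIV. norm (A $ i $ k) * norm (B $ k $ j))"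
      unfolding matrix_matrix_mult_def by (simp add: norm_mult sum_norm_le)
    also have "\<dots> \<le> L2_set (\<lambda>k. norm (A $ i $ k)) UNIV * L2_set (\<lambda>k. norm (B $ k $ j)) UNIV"
      using L2_set_mult_ineq[of "\<lambda>k. norm (A $ i $ k)" "\<lambda>k. norm (B $ k $ j)" UNIV] by simp
    finally have "norm ((A ** B) $ i $ j) ^ 2 \<le> (L2_set (\<lambda>k. norm (A $ i $ k)) UNIV * L2_set (\<lambda>k. norm (B $ k $ j)) UNIV) ^ 2"
      by (rule power_mono) simp
    then show "norm ((A ** B) $ i $ j) ^ 2 \<le> (\<Sum>k\<in>UNIV. norm (A $ i $ k) ^ 2) * (\<Sum>k\<in>UNIV. norm (B $ k $ j) ^ 2)"
      by (simp add: power_mult_distrib L2_set_def sum_nonneg)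
  qed
  also have "\<dots> = (\<Sum>i\<in>UNIV. \<Sum>k\<in>UNIV. norm (A $ i $ k) ^ 2) * (\<Sum>j\<in>UNIV. \<Sum>k\<in>UNIV. norm (B $ k $ j) ^ 2)"
    by (simp add: sum_product)
  also have "(\<Sum>j\<in>UNIV. \<Sum>k\<in>UNIV. norm (B $ k $ j) ^ 2) = norm B ^ 2"
    unfolding nv by (rule sum.swap)
  also have "(\<Sum>i\<in>UNIV. \<Sum>k\<in>UNIV. norm (A $ i $ k) ^ 2) = norm A ^ 2"
    unfolding nv ..
  finally have "norm (A ** B) ^ 2 \<le> (norm A * norm B) ^ 2" by (simp add: power_mult_distrib)
  then show ?thesis by (rule power2_le_imp_le) simp
qed

lemma bounded_bilinear_matrix_matrix_mult:
  "bounded_bilinear ((**) :: complex^'n^'m \<Rightarrow> complex^'p^'n \<Rightarrow> complex^'p^'m)"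
proof
  show "\<exists>K. \<forall>a b. norm ((a :: complex^'n^'m) ** (b :: complex^'p^'n)) \<le> norm a * norm b * K"
    by (intro exI[of _ 1]) (simp add: norm_matrix_matrix_mult_le)
  show "(a + a') ** b = a ** b + a' ** b" for a a' :: "complex^'n^'m" and b :: "complex^'p^'n"
    by (simp add: matrix_matrix_mult_def vec_eq_iff distrib_right sum.distrib)
qed (simp_all only: matrix_add_ldistrib scalar_matrix_assoc matrix_scalar_ac)

interpretation matrix_mult: bounded_bilinear "(**) :: complex^'n^'m \<Rightarrow> complex^'p^'n \<Rightarrow> complex^'p^'m"
  by (rule bounded_bilinear_matrix_matrix_mult)

lemmas continuous_on_matrix_mult = matrix_mult.continuous_on

lemma matrix_inv_mult:
  assumes "invertible M"
  shows matrix_inv_right: "M ** matrix_inv M = mat 1" and matrix_inv_left: "matrix_inv M ** M = mat 1"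
proof -
  have "M ** matrix_inv M = mat 1 \<and> matrix_inv M ** M = mat 1"
    unfolding matrix_inv_def by (rule someI_ex) (use assms in \<open>simp only: invertible_def\<close>)
  then show "M ** matrix_inv M = mat 1" "matrix_inv M ** M = mat 1" by simp_all
qed

lemma matrix_solution_on_has_integral:
  assumes sol: "matrix_solution_on S A Y" and S: "{a..b} \<subseteq> S" and "a \<le> b"
  shows "((\<lambda>x. A x ** Y x) has_integral (Y b - Y a)) {a..b}"
proof -
  from sol have "AE x in lebesgue. x \<in> S \<longrightarrow> (Y has_vector_derivative (A x ** Y x)) (at x within S)"
    by (simp add: matrix_solution_on_def)
  then obtain N where N: "N \<in> null_sets lebesgue"
      "\<And>x. x \<in> space lebesgue - N \<Longrightarrow> x \<in> S \<longrightarrow> (Y has_vector_derivative (A x ** Y x)) (at x within S)"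
    by (rule AE_E3) blast
  show ?thesis
  proof (rule absolutely_continuous_on_has_integral[OF \<open>a \<le> b\<close>])
    show "absolutely_continuous_on {a..b} Y"
      using sol S by (auto simp: matrix_solution_on_def locally_absolutely_continuous_on_def)
    show "negligible N" using N by (simp add: negligible_iff_null_sets)
    fix x assume "x \<in> {a..b} - N"
    then have "(Y has_vector_derivative (A x ** Y x)) (at x within S)"
      using N(2)[of x] S by auto
    then show "(Y has_vector_derivative (A x ** Y x)) (at x within {a..b})"
      by (rule has_vector_derivative_within_subset[OF _ S])
  qed
qed

lemma continuous_on_closed_subintervals:
  fixes S :: "real set" and f :: "real \<Rightarrow> 'a::topological_space"
  assumes S: "S = UNIV \<or> S = {c..}" and f: "\<And>a b. {a..b} \<subseteq> S \<Longrightarrow> continuous_on {a..b} f"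
  shows "continuous_on S f"
  unfolding continuous_on_eq_continuous_within
proof
  fix x assume "x \<in> S"
  define a where "a = (if S = UNIV then x - 1 else c)"
  have sub: "{a..x + 1} \<subseteq> S" "x \<in> {a..x + 1}" "{a..x + 1} \<inter> {x - 1<..<x + 1} = S \<inter> {x - 1<..<x + 1}"
    using S \<open>x \<in> S\<close> by (auto simp: a_def split: if_splits)
  then have "continuous (at x within {a..x + 1}) f"
    using f[OF sub(1)] by (simp add: continuous_on_eq_continuous_within)
  moreover have "at x within {a..x + 1} = at x within S"
    by (rule at_within_nhd[of _ "{x - 1<..<x + 1}"]) (use sub in auto)
  ultimately show "continuous (at x within S) f" by simp
qed

lemma matrix_solution_on_continuous_on:
  assumes "matrix_solution_on S A Y" and S: "S = UNIV \<or> S = {c..}"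
  shows "continuous_on S Y"
  by (rule continuous_on_closed_subintervals[OF S])
    (use assms in \<open>auto simp: matrix_solution_on_def locally_absolutely_continuous_on_def
      intro: absolutely_continuous_on_imp_continuous_on\<close>)

text \<open>Backward uniqueness: the equation at \<open>x = b\<close> forces \<open>Z b = 0\<close>.
  Gronwall's lemma with \<open>a = 0\<close> applies after \<open>A\<close> and \<open>Z\<close>
  have been extended by 0 beyond \<open>b\<close>, which turns the integrals over
  \<open>{x..b}\<close> into tails.\<close>

lemma linear_integral_equation_zero:
  fixes Z :: "real \<Rightarrow> complex^'d^'d"
  assumes A: "A absolutely_integrable_on {0..b}" and Z: "continuous_on {0..b} Z"
    and eq: "\<And>x. x \<in> {0..b} \<Longrightarrow> ((\<lambda>s. A s ** Z s) has_integral (- Z x)) {x..b}"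
    and "0 \<le> b"
  shows "Z 0 = 0"
proof -
  define r where "r = (\<lambda>s. if s \<in> {0..b} then norm (A s) else 0)"
  define u where "u = (\<lambda>s. if s \<in> {0..b} then norm (Z s) else 0)"
  have "bounded (Z ` {0..b})" using Z by (simp add: compact_imp_bounded compact_continuous_image)
  then obtain M where M: "\<And>s. s \<in> {0..b} \<Longrightarrow> norm (Z s) \<le> M" "M > 0" unfolding bounded_pos by blast
  have nA: "(\<lambda>s. norm (A s)) absolutely_integrable_on {0..b}"
    using A by (rule set_integrable_norm)
  have "(\<lambda>s. norm (Z s) * norm (A s)) absolutely_integrable_on {0..b}"
    by (rule absolutely_integrable_bounded_continuous_product[OF bounded_bilinear_mult _ _ _ nA])
      (use M Z in \<open>auto simp: bounded_iff intro!: continuous_intros exI[of _ M]\<close>)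
  then have int: "(\<lambda>s. norm (A s) * norm (Z s)) absolutely_integrable_on {0..b}"
    by (simp add: mult.commute)
  have restrict: "((\<lambda>s. if s \<in> {0..b} then f s else 0) absolutely_integrable_on T) = (f absolutely_integrable_on T \<inter> {0..b})"
    for f :: "real \<Rightarrow> real" and T
    unfolding absolutely_integrable_restrict_UNIV[of T, symmetric] absolutely_integrable_restrict_UNIV[of "T \<inter> {0..b}", symmetric]
    by (intro arg_cong[where f = "\<lambda>g. g absolutely_integrable_on UNIV"]) auto
  have ru: "(\<lambda>s. r s * u s) = (\<lambda>s. if s \<in> {0..b} then norm (A s) * norm (Z s) else 0)"
    by (auto simp: r_def u_def)
  have Int: "{0..} \<inter> {0..b} = {0..b}" by auto
  have "u 0 \<le> 2 * 0 * exp (2 * integral {0..} r)"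
  proof (rule gronwall_tail)
    show "r absolutely_integrable_on {0..}" unfolding r_def restrict Int by (rule nA)
    show "(\<lambda>s. r s * u s) absolutely_integrable_on {0..}" unfolding ru restrict Int by (rule int)
    show "u s \<le> M" for s using M by (auto simp: u_def)
    fix x :: real assume "x \<ge> 0"
    show "u x \<le> 0 + integral {x..} (\<lambda>s. r s * u s)"
    proof (cases "x \<le> b")
      case True
      have e: "((\<lambda>s. A s ** Z s) has_integral (- Z x)) {x..b}" using eq True \<open>x \<ge> 0\<close> by simp
      have "norm (- Z x) = norm (integral {x..b} (\<lambda>s. A s ** Z s))"
        using integral_unique[OF e] by simp
      also have "\<dots> \<le> integral {x..b} (\<lambda>s. norm (A s) * norm (Z s))"
      proof (rule integral_norm_bound_integral)
        show "(\<lambda>s. A s ** Z s) integrable_on {x..b}" using e by blast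
        show "(\<lambda>s. norm (A s) * norm (Z s)) integrable_on {x..b}"
          by (rule set_lebesgue_integral_eq_integral(1), rule set_integrable_subset[OF int]) (use \<open>x \<ge> 0\<close> in auto)
      qed (rule norm_matrix_matrix_mult_le)
      also have "\<dots> = integral ({x..} \<inter> {0..b}) (\<lambda>s. norm (A s) * norm (Z s))"
        using \<open>x \<ge> 0\<close> by (intro arg_cong[where f = "\<lambda>T. integral T _"]) auto
      also have "\<dots> = integral {x..} (\<lambda>s. r s * u s)"
        unfolding ru by (subst integral_restrict_Int) (simp add: Int_commute)
      finally show ?thesis using True \<open>x \<ge> 0\<close> by (simp add: u_def)
    next
      case False
      then show ?thesis
        by (auto simp: u_def r_def intro!: Henstock_Kurzweil_Integration.integral_nonneg
            integrable_eq[OF integrable_0])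
    qed
  qed (auto simp: r_def)
  then show ?thesis using \<open>0 \<le> b\<close> by (simp add: u_def)
qed

text \<open>For \<open>x0 < 0\<close> the Gronwall argument is applied to the reflected system.\<close>

lemma fundamental_matrix_mult_eq_0:
  fixes \<Phi> :: "real \<Rightarrow> complex^'d^'d"
  assumes A: "locally_integrable A" and \<Phi>: "fundamental_matrix A \<Phi>" and z: "\<Phi> x0 ** (V :: complex^'d^'d) = 0"
  shows "V = 0"
proof -
  have sol: "matrix_solution_on UNIV A \<Phi>" and "\<Phi> 0 = mat 1"
    using \<Phi> by (auto simp: fundamental_matrix_def)
  have c: "continuous_on UNIV \<Phi>" by (rule matrix_solution_on_continuous_on[OF sol]) simp
  have int: "((\<lambda>s. A s ** (\<Phi> s ** V)) has_integral (\<Phi> b ** V - \<Phi> a ** V)) {a..b}" if "a \<le> b" for a b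
    using has_integral_linear[OF matrix_solution_on_has_integral[OF sol subset_UNIV that]
        matrix_mult.bounded_linear_left[of V]]
    by (simp add: o_def matrix_mul_assoc matrix_mult.diff_left)
  have AI: "A absolutely_integrable_on {a..b}" for a b
    using A by (auto simp: locally_integrable_def)
  \<comment> \<open>Vanishing at \<open>x0\<close> is transported to 0, where \<open>\<Phi>\<close>
    is the identity.\<close>
  have "\<Phi> 0 ** V = 0"
  proof (cases "x0 \<ge> 0")
    case True
    show ?thesis
      by (rule linear_integral_equation_zero[where Z = "\<lambda>s. \<Phi> s ** V", OF AI _ _ True])
        (use int[of _ x0] z in \<open>auto intro!: continuous_on_matrix_mult continuous_on_subset[OF c] continuous_intros\<close>)
  next
    case False
    have "\<Phi> (- 0) ** V = 0"
    proof (rule linear_integral_equation_zero[where Z = "\<lambda>s. \<Phi> (- s) ** V" and A = "\<lambda>s. - A (- s)" and b = "- x0"])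
      show "(\<lambda>s. - A (- s)) absolutely_integrable_on {0..- x0}"
        using AI[of x0 0] absolutely_integrable_reflect_real[where f = A and a = x0 and b = 0]
        using absolutely_integrable_linear[OF _ bounded_linear_minus[OF bounded_linear_ident]]
        by (simp add: o_def)
      show "continuous_on {0..- x0} (\<lambda>s. \<Phi> (- s) ** V)"
        by (intro continuous_on_matrix_mult continuous_on_compose2[OF c] continuous_intros) auto
      fix x assume x: "x \<in> {0..- x0}"
      then have "((\<lambda>s. A s ** (\<Phi> s ** V)) has_integral (\<Phi> (- x) ** V - \<Phi> x0 ** V)) {x0..- x}"
        by (intro int) auto
      then have "((\<lambda>s. A (- s) ** (\<Phi> (- s) ** V)) has_integral (\<Phi> (- x) ** V)) {x..- x0}"
        using has_integral_reflect_real[where f = "\<lambda>s. A s ** (\<Phi> s ** V)" and a = x0 and b = "- x"] z by simp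
      then show "((\<lambda>s. - A (- s) ** (\<Phi> (- s) ** V)) has_integral - (\<Phi> (- x) ** V)) {x..- x0}"
        by (simp add: matrix_mult.minus_left has_integral_neg_iff)
    qed (use False in auto)
    then show ?thesis by simp
  qed
  then show ?thesis by (simp add: \<open>\<Phi> 0 = mat 1\<close>)
qed

text \<open>A kernel vector of \<open>\<Phi> x\<close> would generate a solution vanishing at
  \<open>x\<close>. The uniqueness result speaks of matrices, so the vector is repeated in every
  column.\<close>

lemma fundamental_matrix_invertible:
  fixes \<Phi> :: "real \<Rightarrow> complex^'d^'d"
  assumes "locally_integrable A" "fundamental_matrix A \<Phi>"
  shows "invertible (\<Phi> x)"
proof -
  have "v = 0" if "\<Phi> x *v v = 0" for v
  proof -
    define V :: "complex^'d^'d" where "V = (\<chi> i j. v $ i)"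
    have "\<Phi> x ** V = 0"
      using that by (simp add: vec_eq_iff V_def matrix_matrix_mult_def matrix_vector_mult_def)
    then have "V = 0" by (rule fundamental_matrix_mult_eq_0[OF assms])
    then show "v = 0" by (simp add: vec_eq_iff V_def)
  qed
  then obtain B where "B ** \<Phi> x = mat 1" using matrix_left_invertible_ker by blast
  then show ?thesis using matrix_left_right_inverse[of B "\<Phi> x"] by (auto simp: invertible_def)
qed

text \<open>The point \<open>x\<close> is joined to 0 by steps of length at most 1; since
  \<open>\<Psi> x = \<Psi> y ** (\<Phi> y ** \<Psi> x)\<close> with \<open>\<Psi>\<close> the
  inverse of \<open>\<Phi>\<close>, each step costs a factor \<open>K\<close>. This yields local
  bounds for the inverse before its continuity is known.\<close>

lemma fundamental_matrix_inv_bounded: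
  fixes \<Phi> :: "real \<Rightarrow> complex^'d^'d"
  assumes A: "locally_integrable A" and \<Phi>: "fundamental_matrix A \<Phi>" and eb: "exp_bounded_propagator \<Phi>"
  obtains K where "K \<ge> 1" "\<And>x x'. \<bar>x - x'\<bar> \<le> 1 \<Longrightarrow> norm (\<Phi> x ** matrix_inv (\<Phi> x')) \<le> K"
    "\<And>n x. \<bar>x\<bar> \<le> real n \<Longrightarrow> norm (matrix_inv (\<Phi> x)) \<le> K ^ n * norm (matrix_inv (\<Phi> 0))"
proof -
  from eb obtain K0 where K0: "\<And>x x'. \<bar>x - x'\<bar> \<le> 1 \<Longrightarrow> norm (\<Phi> x ** matrix_inv (\<Phi> x')) \<le> K0"
    unfolding exp_bounded_propagator_def bdd_above_def by blast
  define K where "K = max K0 1"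
  have K: "K \<ge> 1" and Kb: "\<And>x x'. \<bar>x - x'\<bar> \<le> 1 \<Longrightarrow> norm (\<Phi> x ** matrix_inv (\<Phi> x')) \<le> K"
    using K0 by (auto simp: K_def intro: order_trans[OF _ max.cobounded1])
  note inv = fundamental_matrix_invertible[OF A \<Phi>]
  have "norm (matrix_inv (\<Phi> x)) \<le> K ^ n * norm (matrix_inv (\<Phi> 0))" if "\<bar>x\<bar> \<le> real n" for n x
    using that
  proof (induction n arbitrary: x)
    case 0
    then show ?case by simp
  next
    case (Suc n)
    \<comment> \<open>Moving the fraction \<open>1 / (n + 1)\<close> of the way to 0 is a step of
      length at most 1 that ends at distance at most \<open>n\<close>.\<close>
    define y where "y = x * (real n / (real n + 1))"
    have xy: "x - y = x / (real n + 1)" by (simp add: y_def field_simps)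
    have "\<bar>y - x\<bar> \<le> 1" using Suc.prems by (subst abs_minus_commute) (simp add: xy)
    moreover have "\<bar>y\<bar> \<le> real n"
      using Suc.prems mult_right_mono[of "\<bar>x\<bar>" "real n + 1" "real n / (real n + 1)"]
      by (simp add: y_def abs_mult)
    ultimately have y: "norm (\<Phi> y ** matrix_inv (\<Phi> x)) \<le> K" "norm (matrix_inv (\<Phi> y)) \<le> K ^ n * norm (matrix_inv (\<Phi> 0))"
      using Kb Suc.IH by auto
    have "matrix_inv (\<Phi> x) = matrix_inv (\<Phi> y) ** (\<Phi> y ** matrix_inv (\<Phi> x))"
      by (simp add: matrix_mul_assoc matrix_inv_left[OF inv])
    then have "norm (matrix_inv (\<Phi> x)) \<le> norm (matrix_inv (\<Phi> y)) * norm (\<Phi> y ** matrix_inv (\<Phi> x))"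
      by (metis norm_matrix_matrix_mult_le)
    also have "\<dots> \<le> (K ^ n * norm (matrix_inv (\<Phi> 0))) * K"
      using y K by (intro mult_mono) auto
    finally show ?case by (simp add: algebra_simps)
  qed
  with K Kb show thesis using that by blast
qed

text \<open>The identity \<open>\<Psi> y - \<Psi> x = \<Psi> y ** (\<Phi> x - \<Phi> y) ** \<Psi>
  x\<close>, with \<open>\<Psi>\<close> the inverse of \<open>\<Phi>\<close>, and the local bound on
  \<open>\<Psi>\<close> make its increments at most a constant times those of
  \<open>\<Phi>\<close>.\<close>

lemma fundamental_matrix_inv_absolutely_continuous_on:
  fixes \<Phi> :: "real \<Rightarrow> complex^'d^'d"
  assumes A: "locally_integrable A" and \<Phi>: "fundamental_matrix A \<Phi>" and eb: "exp_bounded_propagator \<Phi>"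
  shows "absolutely_continuous_on {a..b} (\<lambda>x. matrix_inv (\<Phi> x))"
proof -
  obtain K where K: "K \<ge> 1"
    "\<And>n x. \<bar>x\<bar> \<le> real n \<Longrightarrow> norm (matrix_inv (\<Phi> x)) \<le> K ^ n * norm (matrix_inv (\<Phi> 0))"
    using fundamental_matrix_inv_bounded[OF A \<Phi> eb] by metis
  obtain n where n: "max \<bar>a\<bar> \<bar>b\<bar> \<le> real n" using real_arch_simple by blast
  define M where "M = K ^ n * norm (matrix_inv (\<Phi> 0))"
  have M: "norm (matrix_inv (\<Phi> x)) \<le> M" if "x \<in> {a..b}" for x
    unfolding M_def by (rule K) (use that n in auto)
  note inv = fundamental_matrix_invertible[OF A \<Phi>]
  have "absolutely_continuous_on {a..b} \<Phi>"
    using \<Phi> by (auto simp: fundamental_matrix_def matrix_solution_on_def locally_absolutely_continuous_on_def)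
  then show ?thesis
  proof (rule absolutely_continuous_on_lipschitz)
    fix x y assume xy: "x \<in> {a..b}" "y \<in> {a..b}"
    have "matrix_inv (\<Phi> y) - matrix_inv (\<Phi> x) = matrix_inv (\<Phi> y) ** (\<Phi> x - \<Phi> y) ** matrix_inv (\<Phi> x)"
      by (simp add: matrix_mult.diff_left matrix_mult.diff_right matrix_inv_left[OF inv]
          matrix_mul_assoc[symmetric] matrix_inv_right[OF inv])
    then have "norm (matrix_inv (\<Phi> y) - matrix_inv (\<Phi> x)) \<le> norm (matrix_inv (\<Phi> y) ** (\<Phi> x - \<Phi> y)) * norm (matrix_inv (\<Phi> x))"
      by (metis norm_matrix_matrix_mult_le)
    also have "\<dots> \<le> (norm (matrix_inv (\<Phi> y)) * norm (\<Phi> x - \<Phi> y)) * norm (matrix_inv (\<Phi> x))"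
      by (intro mult_right_mono norm_matrix_matrix_mult_le) auto
    also have "\<dots> \<le> (M * norm (\<Phi> x - \<Phi> y)) * M"
    proof (intro mult_mono M xy)
      show "0 \<le> M" using M[OF xy(1)] norm_ge_zero by (rule order_trans[rotated])
      show "0 \<le> M * norm (\<Phi> x - \<Phi> y)" using M[OF xy(1)] norm_ge_zero by (meson mult_nonneg_nonneg order_trans)
    qed auto
    also have "\<dots> = M * M * norm (\<Phi> y - \<Phi> x)" by (simp add: norm_minus_commute)
    finally show "norm (matrix_inv (\<Phi> y) - matrix_inv (\<Phi> x)) \<le> M * M * norm (\<Phi> y - \<Phi> x)" .
  qed
qed

section \<open>Variation of constants\<close>

text \<open>In the product rule the difference quotient of \<open>f\<close> would be multiplied by
  \<open>g x = 0\<close>, so continuity of \<open>f\<close> suffices. The remainder splits into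
  \<open>f y\<close> applied to the remainder of \<open>g\<close>, and \<open>f y - f x\<close>
  applied to \<open>g'\<close>; both tend to 0.\<close>

lemma (in bounded_bilinear) has_vector_derivative_mult_zero:
  assumes f: "continuous (at x within S) f"
    and g: "(g has_vector_derivative g') (at x within S)" and "g x = 0"
  shows "((\<lambda>t. prod (f t) (g t)) has_vector_derivative prod (f x) g') (at x within S)"
  unfolding has_vector_derivative_def has_derivative_within
proof
  have f': "(f \<longlongrightarrow> f x) (at x within S)" using f by (simp add: continuous_within)
  have g': "((\<lambda>y. (1 / norm (y - x)) *\<^sub>R (g y - (y - x) *\<^sub>R g')) \<longlongrightarrow> 0) (at x within S)"
    using g \<open>g x = 0\<close> unfolding has_vector_derivative_def has_derivative_within by simp
  have "((\<lambda>y. prod (f y) ((1 / norm (y - x)) *\<^sub>R (g y - (y - x) *\<^sub>R g'))) \<longlongrightarrow> 0) (at x within S)"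
    using tendsto[OF f' g'] by (simp add: zero_right)
  moreover have "((\<lambda>y. ((y - x) / norm (y - x)) *\<^sub>R prod (f y - f x) g') \<longlongrightarrow> 0) (at x within S)"
  proof (rule tendsto_norm_zero_cancel, rule tendsto_sandwich[OF _ _ tendsto_const])
    have "((\<lambda>y. prod (f y - f x) g') \<longlongrightarrow> prod (f x - f x) g') (at x within S)"
      by (intro tendsto tendsto_diff f' tendsto_const)
    then show "((\<lambda>y. norm (prod (f y - f x) g')) \<longlongrightarrow> 0) (at x within S)"
      by (simp add: zero_left tendsto_norm_zero)
    have "\<bar>(y - x) / norm (y - x)\<bar> \<le> 1" for y by simp
    then show "\<forall>\<^sub>F y in at x within S. norm (((y - x) / norm (y - x)) *\<^sub>R prod (f y - f x) g') \<le> norm (prod (f y - f x) g')"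
      by (intro always_eventually allI) (simp add: mult_left_le_one_le)
  qed (intro always_eventually allI norm_ge_zero)
  ultimately have "((\<lambda>y. prod (f y) ((1 / norm (y - x)) *\<^sub>R (g y - (y - x) *\<^sub>R g')) +
      ((y - x) / norm (y - x)) *\<^sub>R prod (f y - f x) g') \<longlongrightarrow> 0 + 0) (at x within S)"
    by (rule tendsto_add)
  moreover have "prod (f y) ((1 / norm (y - x)) *\<^sub>R (g y - (y - x) *\<^sub>R g')) + ((y - x) / norm (y - x)) *\<^sub>R prod (f y - f x) g' =
      (1 / norm (y - x)) *\<^sub>R (prod (f y) (g y) - (prod (f x) (g x) + (y - x) *\<^sub>R prod (f x) g'))" for y
    using \<open>g x = 0\<close>
    by (simp add: scaleR_right diff_left diff_right zero_right scaleR_diff_right)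
  ultimately show "((\<lambda>y. (1 / norm (y - x)) *\<^sub>R (prod (f y) (g y) - (prod (f x) (g x) + (y - x) *\<^sub>R prod (f x) g'))) \<longlongrightarrow> 0)
     (at x within S)"
    by simp
qed (rule bounded_linear_scaleR_left)

lemma absolutely_integrable_matrix_mult3:
  fixes F R Y :: "real \<Rightarrow> complex^'d^'d"
  assumes "continuous_on S F" "continuous_on S Y" "R \<in> borel_measurable (lebesgue_on S)"
    and S: "S \<in> sets lebesgue" and "g integrable_on S"
    and "\<And>s. s \<in> S \<Longrightarrow> norm (F s ** (R s ** Y s)) \<le> g s"
  shows "(\<lambda>s. F s ** (R s ** Y s)) absolutely_integrable_on S"
proof (rule measurable_bounded_by_integrable_imp_absolutely_integrable)
  have bl: "bilinear ((**) :: complex^'d^'d \<Rightarrow> complex^'d^'d \<Rightarrow> complex^'d^'d)"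
    using bounded_bilinear_matrix_matrix_mult by (simp only: bilinear_conv_bounded_bilinear)
  show "(\<lambda>s. F s ** (R s ** Y s)) \<in> borel_measurable (lebesgue_on S)"
    by (intro borel_measurable_bilinear[OF bl] continuous_imp_measurable_on_sets_lebesgue assms)
qed (use assms in auto)

lemma norm_matrix_mult3_le:
  fixes F R Y :: "complex^'d^'d"
  shows "norm (F ** (R ** Y)) \<le> norm F * (norm R * norm Y)"
  by (rule order_trans[OF norm_matrix_matrix_mult_le mult_left_mono[OF norm_matrix_matrix_mult_le norm_ge_zero]])

lemma absolutely_integrable_matrix_mult3_compact:
  fixes F R Y :: "real \<Rightarrow> complex^'d^'d"
  assumes F: "continuous_on {a..b} F" and Y: "continuous_on {a..b} Y"
    and R: "R absolutely_integrable_on {a..b}"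
  shows "(\<lambda>s. F s ** (R s ** Y s)) absolutely_integrable_on {a..b}"
proof -
  obtain M where M: "M > 0" "\<And>s. s \<in> {a..b} \<Longrightarrow> norm (F s) \<le> M"
    using compact_imp_bounded[OF compact_continuous_image[OF F compact_Icc]] unfolding bounded_pos by blast
  obtain N where N: "N > 0" "\<And>s. s \<in> {a..b} \<Longrightarrow> norm (Y s) \<le> N"
    using compact_imp_bounded[OF compact_continuous_image[OF Y compact_Icc]] unfolding bounded_pos by blast
  show ?thesis
  proof (rule absolutely_integrable_matrix_mult3[OF F Y])
    show "R \<in> borel_measurable (lebesgue_on {a..b})"
      using R by (simp add: absolutely_integrable_imp_borel_measurable)
    show "(\<lambda>s. M * (norm (R s) * N)) integrable_on {a..b}"
      by (rule integrable_on_mult_right, rule integrable_on_mult_left)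
        (use R in \<open>simp add: absolutely_integrable_on_def\<close>)
    fix s assume s: "s \<in> {a..b}"
    have "norm (F s ** (R s ** Y s)) \<le> norm (F s) * (norm (R s) * norm (Y s))"
      by (rule norm_matrix_mult3_le)
    also have "\<dots> \<le> M * (norm (R s) * N)"
      using M(1) N(1) M(2)[OF s] N(2)[OF s] by (intro mult_mono) auto
    finally show "norm (F s ** (R s ** Y s)) \<le> M * (norm (R s) * N)" .
  qed auto
qed

lemma absolutely_continuous_on_subset:
  "absolutely_continuous_on S f \<Longrightarrow> T \<subseteq> S \<Longrightarrow> absolutely_continuous_on T f"
  unfolding absolutely_continuous_on_def by (meson subset_trans)

locale exp_bounded_system =
  fixes A \<Phi> :: "real \<Rightarrow> complex^'d^'d"
  assumes A: "locally_integrable A" and \<Phi>: "fundamental_matrix A \<Phi>"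
    and exp_bounded: "exp_bounded_propagator \<Phi>"
begin

abbreviation "\<Psi> x \<equiv> matrix_inv (\<Phi> x)"

lemmas \<Phi>_invertible = fundamental_matrix_invertible[OF A \<Phi>]
lemmas \<Phi>_\<Psi> = matrix_inv_right[OF \<Phi>_invertible]
lemmas \<Psi>_\<Phi> = matrix_inv_left[OF \<Phi>_invertible]

lemma \<Phi>_0: "\<Phi> 0 = mat 1"
  using \<Phi> by (simp add: fundamental_matrix_def)

lemma \<Psi>_0: "\<Psi> 0 = mat 1"
  using \<Psi>_\<Phi>[of 0] by (simp add: \<Phi>_0)

lemma \<Phi>_absolutely_continuous_on: "absolutely_continuous_on {a..b} \<Phi>"
  using \<Phi> by (auto simp: fundamental_matrix_def matrix_solution_on_def locally_absolutely_continuous_on_def)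

lemmas \<Psi>_absolutely_continuous_on = fundamental_matrix_inv_absolutely_continuous_on[OF A \<Phi> exp_bounded]

lemma continuous_on_\<Phi>: "continuous_on S \<Phi>"
  by (rule continuous_on_subset[OF continuous_on_closed_subintervals[where S = UNIV]])
    (auto intro: absolutely_continuous_on_imp_continuous_on \<Phi>_absolutely_continuous_on)

lemma continuous_on_\<Psi>: "continuous_on S \<Psi>"
  by (rule continuous_on_subset[OF continuous_on_closed_subintervals[where S = UNIV]])
    (auto intro: absolutely_continuous_on_imp_continuous_on \<Psi>_absolutely_continuous_on)

lemma \<Phi>_derivative:
  obtains N where "negligible N" "\<And>x. x \<notin> N \<Longrightarrow> (\<Phi> has_vector_derivative (A x ** \<Phi> x)) (at x)"
proof -
  have "AE x in lebesgue. (\<Phi> has_vector_derivative (A x ** \<Phi> x)) (at x)"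
    using \<Phi> by (simp add: fundamental_matrix_def matrix_solution_on_def)
  then show thesis
    by (rule AE_E3) (use that in \<open>auto simp: negligible_iff_null_sets\<close>)
qed

text \<open>
  Variation of constants. With \<open>c = \<Psi> x ** Y x\<close> one has \<open>\<Psi> t ** Y t = c + \<Psi> t ** (Y t - \<Phi> t ** c)\<close>,
  whose second factor vanishes at \<open>x\<close>; so only continuity of \<open>\<Psi>\<close> is needed to differentiate at \<open>x\<close>.
\<close>

lemma solution_imp_has_integral:
  assumes Y: "matrix_solution_on {0..} (\<lambda>x. A x + R x) Y" and "0 \<le> a" "a \<le> b"
  shows "((\<lambda>x. \<Psi> x ** (R x ** Y x)) has_integral (\<Psi> b ** Y b - \<Psi> a ** Y a)) {a..b}"
proof -
  obtain N1 where N1: "negligible N1" "\<And>x. x \<notin> N1 \<Longrightarrow> (\<Phi> has_vector_derivative (A x ** \<Phi> x)) (at x)"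
    by (rule \<Phi>_derivative) blast
  have "AE x in lebesgue. x \<in> {0..} \<longrightarrow> (Y has_vector_derivative ((A x + R x) ** Y x)) (at x within {0..})"
    using Y by (simp add: matrix_solution_on_def)
  then obtain N2 where N2: "N2 \<in> null_sets lebesgue"
      "\<And>x. x \<in> space lebesgue - N2 \<Longrightarrow> x \<in> {0..} \<longrightarrow> (Y has_vector_derivative ((A x + R x) ** Y x)) (at x within {0..})"
    by (rule AE_E3) blast
  show ?thesis
  proof (rule absolutely_continuous_on_has_integral[OF \<open>a \<le> b\<close>])
    have "absolutely_continuous_on {a..b} Y"
      using Y \<open>0 \<le> a\<close> by (auto simp: matrix_solution_on_def locally_absolutely_continuous_on_def)
    then show "absolutely_continuous_on {a..b} (\<lambda>x. \<Psi> x ** Y x)"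
      by (intro absolutely_continuous_on_bounded_bilinear[OF bounded_bilinear_matrix_matrix_mult]
          \<Psi>_absolutely_continuous_on)
    show "negligible (N1 \<union> N2)" using N1(1) N2(1) by (simp add: negligible_iff_null_sets null_sets.Un)
    fix x assume x: "x \<in> {a..b} - (N1 \<union> N2)"
    define c where "c = \<Psi> x ** Y x"
    have Phi: "(\<Phi> has_vector_derivative (A x ** \<Phi> x)) (at x within {a..b})"
      using N1(2)[of x] x by (auto intro: has_vector_derivative_at_within)
    have "(Y has_vector_derivative ((A x + R x) ** Y x)) (at x within {0..})"
      using N2(2)[of x] x \<open>0 \<le> a\<close> by auto
    then have "(Y has_vector_derivative ((A x + R x) ** Y x)) (at x within {a..b})"
      by (rule has_vector_derivative_within_subset) (use \<open>0 \<le> a\<close> in auto)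
    then have "((\<lambda>t. Y t - \<Phi> t ** c) has_vector_derivative ((A x + R x) ** Y x - (A x ** \<Phi> x) ** c)) (at x within {a..b})"
      by (intro has_vector_derivative_diff bounded_linear.has_vector_derivative[OF matrix_mult.bounded_linear_left] Phi)
    moreover have "(A x + R x) ** Y x - (A x ** \<Phi> x) ** c = R x ** Y x"
    proof -
      have "(A x ** \<Phi> x) ** c = A x ** ((\<Phi> x ** \<Psi> x) ** Y x)" by (simp add: c_def matrix_mul_assoc)
      then show ?thesis by (simp add: \<Phi>_\<Psi> matrix_mult.add_left)
    qed
    ultimately have "((\<lambda>t. Y t - \<Phi> t ** c) has_vector_derivative (R x ** Y x)) (at x within {a..b})"
      by simp
    moreover have "continuous (at x within {a..b}) \<Psi>"
      using continuous_on_\<Psi>[of "{a..b}"] x by (simp add: continuous_on_eq_continuous_within)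
    moreover have "Y x - \<Phi> x ** c = 0"
      by (simp add: c_def matrix_mul_assoc \<Phi>_\<Psi>)
    ultimately have "((\<lambda>t. \<Psi> t ** (Y t - \<Phi> t ** c)) has_vector_derivative (\<Psi> x ** (R x ** Y x))) (at x within {a..b})"
      by (intro matrix_mult.has_vector_derivative_mult_zero)
    then have "((\<lambda>t. \<Psi> t ** (Y t - \<Phi> t ** c) + c) has_vector_derivative (\<Psi> x ** (R x ** Y x))) (at x within {a..b})"
      by (simp add: has_vector_derivative_add_const)
    moreover have "\<Psi> t ** (Y t - \<Phi> t ** c) + c = \<Psi> t ** Y t" for t
      by (simp add: matrix_mult.diff_right matrix_mul_assoc \<Psi>_\<Phi>)
    ultimately show "((\<lambda>x. \<Psi> x ** Y x) has_vector_derivative (\<Psi> x ** (R x ** Y x))) (at x within {a..b})"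
      by simp
  qed
qed

text \<open>The converse direction of variation of constants. Here both factors of
  \<open>\<Phi> x ** J x\<close> are differentiable almost everywhere, so the ordinary product rule
  applies.\<close>

lemma integral_imp_solution:
  assumes R: "\<And>b. R absolutely_integrable_on {0..b}" and Yc: "continuous_on {0..} Y"
    and Y: "\<And>x. x \<ge> 0 \<Longrightarrow> Y x = \<Phi> x ** (c + integral {0..x} (\<lambda>s. \<Psi> s ** (R s ** Y s)))"
  shows "matrix_solution_on {0..} (\<lambda>x. A x + R x) Y"
proof -
  define h where "h = (\<lambda>s. \<Psi> s ** (R s ** Y s))"
  define J where "J = (\<lambda>x. c + integral {0..x} h)"
  have Y': "Y x = \<Phi> x ** J x" if "x \<ge> 0" for x using Y[OF that] by (simp add: J_def h_def)
  have h: "h absolutely_integrable_on {0..b}" for b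
    unfolding h_def
    by (rule absolutely_integrable_matrix_mult3_compact[OF continuous_on_\<Psi> continuous_on_subset[OF Yc] R]) auto
  have J: "absolutely_continuous_on {0..b} J" for b
    by (rule absolutely_continuous_on_lipschitz[OF absolutely_continuous_on_integral[OF h], where L = 1])
      (simp add: J_def)
  have prod: "absolutely_continuous_on {0..b} (\<lambda>x. \<Phi> x ** J x)" for b
    by (rule absolutely_continuous_on_bounded_bilinear[OF bounded_bilinear_matrix_matrix_mult \<Phi>_absolutely_continuous_on J])
  have "absolutely_continuous_on {a..b} Y" if "{a..b} \<subseteq> {0..}" for a b
  proof -
    have "{a..b} \<subseteq> {0..b}" using that by auto
    then show ?thesis
      by (rule absolutely_continuous_on_subset[rotated], intro absolutely_continuous_on_lipschitz[OF prod, where L = 1])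
        (simp add: Y')
  qed
  then have "locally_absolutely_continuous_on {0..} Y"
    by (simp add: locally_absolutely_continuous_on_def)
  moreover
  obtain N1 where N1: "negligible N1" "\<And>x. x \<notin> N1 \<Longrightarrow> (\<Phi> has_vector_derivative (A x ** \<Phi> x)) (at x)"
    by (rule \<Phi>_derivative) blast
  \<comment> \<open>Lebesgue differentiation is available on bounded intervals; countably many of
    them exhaust the half-line.\<close>
  define N2 where "N2 = (\<lambda>n::nat. {x \<in> {0<..<real n}. \<not> ((\<lambda>t. integral {0..t} h) has_vector_derivative h x) (at x)})"
  have "negligible (N2 n)" for n
    unfolding N2_def
    by (rule negligible_not_has_vector_derivative_integral) (rule set_lebesgue_integral_eq_integral(1)[OF h])
  \<comment> \<open>The point 0 is added because the intervals in \<open>N2\<close> are open at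
    0.\<close>
  then have N: "negligible ({0} \<union> N1 \<union> (\<Union>n. N2 n))"
    using N1(1) by (intro negligible_Un negligible_Union_nat) auto
  have der: "(Y has_vector_derivative ((A x + R x) ** Y x)) (at x within {0..})"
    if x: "x \<in> {0..}" "x \<notin> {0} \<union> N1 \<union> (\<Union>n. N2 n)" for x
  proof -
    have "x > 0" using x by auto
    obtain n :: nat where "x < real n" using reals_Archimedean2 by blast
    then have "((\<lambda>t. integral {0..t} h) has_vector_derivative h x) (at x)"
      using x \<open>x > 0\<close> by (auto simp: N2_def)
    then have "(J has_vector_derivative h x) (at x)"
      unfolding J_def by (simp add: has_vector_derivative_add_const add.commute[of c])
    moreover have "(\<Phi> has_vector_derivative (A x ** \<Phi> x)) (at x)"
      using N1(2) x by blast
    ultimately have "((\<lambda>t. \<Phi> t ** J t) has_vector_derivative (\<Phi> x ** h x + (A x ** \<Phi> x) ** J x)) (at x within {0..})"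
      by (rule has_vector_derivative_at_within[OF matrix_mult.has_vector_derivative, rotated])
    moreover have "\<Phi> x ** h x = R x ** Y x"
      by (simp add: h_def matrix_mul_assoc \<Phi>_\<Psi>)
    moreover have "(A x ** \<Phi> x) ** J x = A x ** Y x"
      using \<open>x > 0\<close> by (simp add: Y' matrix_mul_assoc)
    ultimately have "((\<lambda>t. \<Phi> t ** J t) has_vector_derivative ((A x + R x) ** Y x)) (at x within {0..})"
      by (simp add: matrix_mult.add_left add.commute)
    then show ?thesis
      by (rule has_vector_derivative_transform[rotated 2]) (use x Y' in auto)
  qed
  have "AE x in lebesgue. x \<in> {0..} \<longrightarrow> (Y has_vector_derivative ((A x + R x) ** Y x)) (at x within {0..})"
    by (rule AE_I'[where N = "{0} \<union> N1 \<union> (\<Union>n. N2 n)"])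
      (use N der in \<open>auto simp only: negligible_iff_null_sets\<close>)
  ultimately show ?thesis by (simp add: matrix_solution_on_def)
qed

end

section \<open>The Volterra equation\<close>

text \<open>Integrability with respect to \<open>exp_weight \<beta>\<close>, phrased with Lebesgue
  measure so that it combines with gauge integrals over tails;
  \<open>integrable_exp_weight_iff\<close> is the link.\<close>

definition exp_integrable :: "real \<Rightarrow> (real \<Rightarrow> complex^'d^'d) \<Rightarrow> bool" where
  "exp_integrable \<beta> R \<longleftrightarrow> (\<lambda>s. exp (\<beta> * s) *\<^sub>R R s) absolutely_integrable_on {0..}"

text \<open>
  In the application, \<open>G x\<close> and \<open>H x\<close> are \<open>exp (- \<kappa> x) \<Phi> x\<close> and \<open>exp (\<kappa> x) (\<Phi> x)\<^sup>-\<^sup>1\<close> for some \<open>\<kappa>\<close> below the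
  lower Bohl exponent; the rescaled Jost solution differs from \<open>G ** Q\<close> by a bounded function.
\<close>

locale volterra_system =
  fixes G H :: "real \<Rightarrow> complex^'d^'d" and Q :: "complex^'d^'d" and C M \<beta> :: real
  assumes continuous_G: "continuous_on {0..} G" and continuous_H: "continuous_on {0..} H"
    and G_0: "G 0 = mat 1"
    and norm_GH: "\<And>x s. 0 \<le> x \<Longrightarrow> x \<le> s \<Longrightarrow> norm (G x ** H s) \<le> C"
    and norm_GQ: "\<And>s. 0 \<le> s \<Longrightarrow> norm (G s ** Q) \<le> M * exp (\<beta> * s)"
    and \<beta>_nonneg: "0 \<le> \<beta>"
begin

text \<open>The solution class fixes the distance to \<open>G ** Q\<close>, which itself may grow
  like \<open>exp (\<beta> * x)\<close>. Boundedness of the difference supplies the a priori bound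
  for Gronwall's lemma, and after undoing the scaling it is the decay
  \<open>O(exp (\<kappa> x))\<close> of \<open>Y - \<Phi> Q\<close>.\<close>

definition volterra_solution :: "(real \<Rightarrow> complex^'d^'d) \<Rightarrow> (real \<Rightarrow> complex^'d^'d) \<Rightarrow> bool" where
  "volterra_solution R U \<longleftrightarrow> continuous_on {0..} U \<and> bounded ((\<lambda>x. U x - G x ** Q) ` {0..}) \<and>
     (\<forall>x\<ge>0. U x = G x ** (Q - integral {x..} (\<lambda>s. H s ** (R s ** U s))))"

lemma C_nonneg: "0 \<le> C"
  using norm_GH[of 0 0] norm_ge_zero[of "G 0 ** H 0"] by linarith

lemma M_nonneg: "0 \<le> M"
  using order_trans[OF norm_ge_zero norm_GQ[of 0]] by simp

lemma norm_H: "0 \<le> s \<Longrightarrow> norm (H s) \<le> C"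
  using norm_GH[of 0 s] by (simp add: G_0)

lemma exp_\<beta>_ge_1: "0 \<le> s \<Longrightarrow> 1 \<le> exp (\<beta> * s)"
  using \<beta>_nonneg by simp

lemma exp_integrable_imp:
  assumes "exp_integrable \<beta> R"
  shows "R absolutely_integrable_on {0..}"
    and "(\<lambda>s. norm (R s)) absolutely_integrable_on {0..}"
    and "(\<lambda>s. exp (\<beta> * s) * norm (R s)) absolutely_integrable_on {0..}"
proof -
  have R: "(\<lambda>s. exp (\<beta> * s) *\<^sub>R R s) absolutely_integrable_on {0..}"
    using assms by (simp add: exp_integrable_def)
  have c: "continuous_on {0..} (\<lambda>s. exp (- \<beta> * s))" by (intro continuous_intros)
  have "bounded ((\<lambda>s. exp (- \<beta> * s)) ` {0..})"
    using \<beta>_nonneg by (auto simp: bounded_iff intro!: exI[of _ 1])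
  then have "(\<lambda>s. exp (- \<beta> * s) *\<^sub>R (exp (\<beta> * s) *\<^sub>R R s)) absolutely_integrable_on {0..}"
    by (rule absolutely_integrable_bounded_continuous_product[OF bounded_bilinear_scaleR c _ _ R, rotated]) simp
  then show Ri: "R absolutely_integrable_on {0..}"
    by (simp add: mult_exp_exp)
  show "(\<lambda>s. norm (R s)) absolutely_integrable_on {0..}"
    by (rule set_integrable_norm[OF Ri])
  show "(\<lambda>s. exp (\<beta> * s) * norm (R s)) absolutely_integrable_on {0..}"
    using set_integrable_norm[OF R] by simp
qed

lemma exp_integrable_diff: "exp_integrable \<beta> f \<Longrightarrow> exp_integrable \<beta> g \<Longrightarrow> exp_integrable \<beta> (\<lambda>s. f s - g s)"
  unfolding exp_integrable_def scaleR_diff_right by (rule set_integral_diff(1))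

text \<open>The growth permitted for \<open>U\<close> is exactly what the weight on \<open>R\<close>
  pays for, while \<open>H\<close> is bounded because \<open>G 0\<close> is the identity.\<close>

lemma kernel_absolutely_integrable:
  fixes U :: "real \<Rightarrow> complex^'d^'d"
  assumes R: "exp_integrable \<beta> R" and U: "continuous_on {0..} U"
    and N: "\<And>s. 0 \<le> s \<Longrightarrow> norm (U s) \<le> N * exp (\<beta> * s)"
  shows "(\<lambda>s. H s ** (R s ** U s)) absolutely_integrable_on {0..}"
proof (rule absolutely_integrable_matrix_mult3[OF continuous_H U])
  show "R \<in> borel_measurable (lebesgue_on {0..})"
    using exp_integrable_imp(1)[OF R] by (rule absolutely_integrable_imp_borel_measurable) simp
  show "(\<lambda>s. C * N * (exp (\<beta> * s) * norm (R s))) integrable_on {0..}"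
    by (rule integrable_on_mult_right) (rule set_lebesgue_integral_eq_integral(1)[OF exp_integrable_imp(3)[OF R]])
  fix s :: real assume "s \<in> {0..}"
  then have s: "0 \<le> s" by simp
  have "norm (H s ** (R s ** U s)) \<le> norm (H s) * (norm (R s) * norm (U s))"
    by (rule norm_matrix_mult3_le)
  also have "\<dots> \<le> C * (norm (R s) * (N * exp (\<beta> * s)))"
    using norm_H[OF s] N[OF s] C_nonneg by (intro mult_mono mult_left_mono) auto
  also have "\<dots> = C * N * (exp (\<beta> * s) * norm (R s))" by (simp add: algebra_simps)
  finally show "norm (H s ** (R s ** U s)) \<le> C * N * (exp (\<beta> * s) * norm (R s))" .
qed simp

text \<open>\<open>G x\<close> is moved under the integral, where \<open>G x ** H s\<close> is
  bounded by \<open>C\<close>; estimating the two factors separately would lose this, as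
  \<open>G x\<close> may be large. The general \<open>V\<close> covers \<open>R ** U\<close> as well
  as differences of such products.\<close>

lemma norm_kernel_integral_le:
  assumes "0 \<le> x" and V: "(\<lambda>s. H s ** V s) absolutely_integrable_on {0..}" and g: "g integrable_on {x..}"
    and le: "\<And>s. x \<le> s \<Longrightarrow> C * norm (V s) \<le> g s"
  shows "norm (G x ** integral {x..} (\<lambda>s. H s ** V s)) \<le> integral {x..} g"
proof -
  have int: "(\<lambda>s. H s ** V s) integrable_on {x..}"
    by (rule set_lebesgue_integral_eq_integral(1)[OF absolutely_integrable_on_tail[OF V \<open>0 \<le> x\<close>]])
  have eq: "G x ** integral {x..} (\<lambda>s. H s ** V s) = integral {x..} (\<lambda>s. G x ** (H s ** V s))"
    using integral_linear[OF int matrix_mult.bounded_linear_right[of "G x"]] by (simp add: o_def)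
  show ?thesis
    unfolding eq
  proof (rule integral_norm_bound_integral)
    show "(\<lambda>s. G x ** (H s ** V s)) integrable_on {x..}"
      using integrable_linear[OF int matrix_mult.bounded_linear_right[of "G x"]] by (simp add: o_def)
    fix s assume "s \<in> {x..}"
    then have s: "x \<le> s" by simp
    have "norm (G x ** (H s ** V s)) \<le> norm (G x ** H s) * norm (V s)"
      unfolding matrix_mul_assoc by (rule norm_matrix_matrix_mult_le)
    also have "\<dots> \<le> C * norm (V s)"
      using norm_GH[OF \<open>0 \<le> x\<close> s] by (rule mult_right_mono) simp
    also have "\<dots> \<le> g s" by (rule le[OF s])
    finally show "norm (G x ** (H s ** V s)) \<le> g s" .
  qed fact
qed

lemma volterra_solution_bounded_diff:
  assumes "volterra_solution R U"
  obtains B where "B > 0" "\<And>s. 0 \<le> s \<Longrightarrow> norm (U s - G s ** Q) \<le> B"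
proof -
  have "bounded ((\<lambda>x. U x - G x ** Q) ` {0..})"
    using assms by (simp only: volterra_solution_def)
  then obtain B where "B > 0" "\<forall>y \<in> (\<lambda>x. U x - G x ** Q) ` {0..}. norm y \<le> B"
    unfolding bounded_pos by blast
  then show thesis by (intro that[of B]) auto
qed

lemma norm_le_if_bounded_diff:
  assumes s: "0 \<le> s" and B: "norm (V - G s ** Q) \<le> B"
  shows "norm V \<le> (M + B) * exp (\<beta> * s)"
proof -
  have "0 \<le> B" using order_trans[OF norm_ge_zero B] .
  have "norm V \<le> norm (G s ** Q) + norm (V - G s ** Q)"
    by (metis add.commute diff_add_cancel norm_triangle_ineq)
  also have "\<dots> \<le> M * exp (\<beta> * s) + B * exp (\<beta> * s)"
  proof (rule add_mono[OF norm_GQ[OF s]])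
    have "B * 1 \<le> B * exp (\<beta> * s)" using \<open>0 \<le> B\<close> exp_\<beta>_ge_1[OF s] by (intro mult_left_mono) auto
    then show "norm (V - G s ** Q) \<le> B * exp (\<beta> * s)" using B by linarith
  qed
  finally show ?thesis by (simp add: algebra_simps)
qed

lemma volterra_solution_bound:
  assumes "volterra_solution R U"
  obtains N where "0 \<le> N" "\<And>s. 0 \<le> s \<Longrightarrow> norm (U s) \<le> N * exp (\<beta> * s)"
proof -
  obtain B where B: "B > 0" "\<And>s. 0 \<le> s \<Longrightarrow> norm (U s - G s ** Q) \<le> B"
    by (rule volterra_solution_bounded_diff[OF assms]) blast
  show thesis
    by (rule that[of "M + B"]) (use M_nonneg B in \<open>auto intro: norm_le_if_bounded_diff\<close>)
qed

text \<open>Splitting \<open>f U - g V\<close> as \<open>(f - g) U + g (U - V)\<close>, the first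
  part gives the constant in Gronwall's lemma, with the weight \<open>exp (\<beta> * s)\<close>
  because \<open>U\<close> may grow that fast; the second is the Gronwall integral with density
  \<open>C * norm (g s)\<close>. The difference \<open>U - V\<close> is bounded, since both
  functions stay near \<open>G ** Q\<close>. The case \<open>f = g\<close> is uniqueness.\<close>

lemma volterra_stability:
  assumes f: "exp_integrable \<beta> f" and g: "exp_integrable \<beta> g"
    and U: "volterra_solution f U" and V: "volterra_solution g V"
    and N: "\<And>s. 0 \<le> s \<Longrightarrow> norm (U s) \<le> N * exp (\<beta> * s)" "0 \<le> N" and "0 \<le> x"
  shows "norm (U x - V x) \<le> 2 * (C * N * integral {0..} (\<lambda>s. exp (\<beta> * s) * norm (f s - g s))) *
    exp (2 * integral {x..} (\<lambda>s. C * norm (g s)))"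
proof -
  obtain B1 where B1: "\<And>s. 0 \<le> s \<Longrightarrow> norm (U s - G s ** Q) \<le> B1"
    by (rule volterra_solution_bounded_diff[OF U]) blast
  obtain B2 where B2: "\<And>s. 0 \<le> s \<Longrightarrow> norm (V s - G s ** Q) \<le> B2"
    by (rule volterra_solution_bounded_diff[OF V]) blast
  show ?thesis
  proof (rule gronwall_tail[where M = "B1 + B2"])
    note fg = exp_integrable_diff[OF f g]
    obtain N' where N': "\<And>s. 0 \<le> s \<Longrightarrow> norm (V s) \<le> N' * exp (\<beta> * s)"
      by (rule volterra_solution_bound[OF V]) blast
    have cU: "continuous_on {0..} U" and cV: "continuous_on {0..} V"
      using U V by (auto simp: volterra_solution_def)
    note kU = kernel_absolutely_integrable[OF f cU N(1)]
    note kV = kernel_absolutely_integrable[OF g cV N']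
    show r: "(\<lambda>s. C * norm (g s)) absolutely_integrable_on {0..}"
      using exp_integrable_imp(2)[OF g] by (rule set_integrable_mult_right)
    show "0 \<le> C * norm (g s)" for s using C_nonneg by simp
    show bd: "norm (U s - V s) \<le> B1 + B2" if "0 \<le> s" for s
      using norm_triangle_ineq4[of "U s - G s ** Q" "V s - G s ** Q"] B1[OF that] B2[OF that] by simp
    have "(\<lambda>s. norm (U s - V s) * (C * norm (g s))) absolutely_integrable_on {0..}"
      by (rule absolutely_integrable_bounded_continuous_product[OF bounded_bilinear_mult _ _ _ r])
        (use bd in \<open>auto simp: bounded_iff intro!: continuous_intros cU cV exI[of _ "B1 + B2"]\<close>)
    then show ru: "(\<lambda>s. C * norm (g s) * norm (U s - V s)) absolutely_integrable_on {0..}"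
      by (simp add: mult.commute)
    show "0 \<le> C * N * integral {0..} (\<lambda>s. exp (\<beta> * s) * norm (f s - g s))"
      using C_nonneg N(2) by (intro mult_nonneg_nonneg Henstock_Kurzweil_Integration.integral_nonneg
          set_lebesgue_integral_eq_integral(1)[OF exp_integrable_imp(3)[OF fg]]) auto
    fix y :: real assume y: "y \<ge> 0"
    define e where "e = (\<lambda>s. C * N * (exp (\<beta> * s) * norm (f s - g s)))"
    have e0: "e absolutely_integrable_on {0..}"
      unfolding e_def using exp_integrable_imp(3)[OF fg] by (rule set_integrable_mult_right)
    have e: "e integrable_on {y..}"
      by (rule set_lebesgue_integral_eq_integral(1)[OF absolutely_integrable_on_tail[OF e0 y]])
    have ruy: "(\<lambda>s. C * norm (g s) * norm (U s - V s)) integrable_on {y..}"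
      by (rule set_lebesgue_integral_eq_integral(1)[OF absolutely_integrable_on_tail[OF ru y]])
    have split: "(\<lambda>s. H s ** (f s ** U s - g s ** V s)) = (\<lambda>s. H s ** (f s ** U s) - H s ** (g s ** V s))"
      by (simp add: matrix_mult.diff_right)
    have "U y - V y = - (G y ** (integral {y..} (\<lambda>s. H s ** (f s ** U s)) - integral {y..} (\<lambda>s. H s ** (g s ** V s))))"
      using U V y by (simp add: volterra_solution_def matrix_mult.diff_right)
    also have "integral {y..} (\<lambda>s. H s ** (f s ** U s)) - integral {y..} (\<lambda>s. H s ** (g s ** V s)) =
        integral {y..} (\<lambda>s. H s ** (f s ** U s - g s ** V s))"
      unfolding split
      by (intro Henstock_Kurzweil_Integration.integral_diff[symmetric] set_lebesgue_integral_eq_integral(1)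
          absolutely_integrable_on_tail[OF kU y] absolutely_integrable_on_tail[OF kV y])
    finally have "norm (U y - V y) = norm (G y ** integral {y..} (\<lambda>s. H s ** (f s ** U s - g s ** V s)))"
      by simp
    also have "\<dots> \<le> integral {y..} (\<lambda>s. e s + C * norm (g s) * norm (U s - V s))"
    proof (rule norm_kernel_integral_le[OF y])
      show "(\<lambda>s. H s ** (f s ** U s - g s ** V s)) absolutely_integrable_on {0..}"
        unfolding split by (rule set_integral_diff(1)[OF kU kV])
      show "(\<lambda>s. e s + C * norm (g s) * norm (U s - V s)) integrable_on {y..}"
        by (rule integrable_add[OF e ruy])
      fix s assume "y \<le> s"
      then have s: "0 \<le> s" using y by simp
      have "f s ** U s - g s ** V s = (f s - g s) ** U s + g s ** (U s - V s)"
        by (simp add: matrix_mult.diff_left matrix_mult.diff_right)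
      then have "norm (f s ** U s - g s ** V s) \<le> norm (f s - g s) * norm (U s) + norm (g s) * norm (U s - V s)"
        by (metis norm_triangle_le add_mono norm_matrix_matrix_mult_le)
      also have "\<dots> \<le> norm (f s - g s) * (N * exp (\<beta> * s)) + norm (g s) * norm (U s - V s)"
        using N(1)[OF s] by (intro add_right_mono mult_left_mono) auto
      finally have "C * norm (f s ** U s - g s ** V s) \<le> C * (norm (f s - g s) * (N * exp (\<beta> * s)) + norm (g s) * norm (U s - V s))"
        using C_nonneg by (rule mult_left_mono)
      then show "C * norm (f s ** U s - g s ** V s) \<le> e s + C * norm (g s) * norm (U s - V s)"
        by (simp add: e_def algebra_simps)
    qed
    also have "\<dots> = integral {y..} e + integral {y..} (\<lambda>s. C * norm (g s) * norm (U s - V s))"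
      by (rule Henstock_Kurzweil_Integration.integral_add[OF e ruy])
    also have "integral {y..} e \<le> integral {0..} e"
      by (rule integral_tail_antimono[OF e0]) (use C_nonneg N(2) y in \<open>auto simp: e_def\<close>)
    also have "integral {0..} e = C * N * integral {0..} (\<lambda>s. exp (\<beta> * s) * norm (f s - g s))"
      unfolding e_def by (rule integral_mult_right)
    finally show "norm (U y - V y) \<le> C * N * integral {0..} (\<lambda>s. exp (\<beta> * s) * norm (f s - g s)) +
        integral {y..} (\<lambda>s. C * norm (g s) * norm (U s - V s))"
      by simp
  qed fact
qed

lemma volterra_solution_unique:
  assumes f: "exp_integrable \<beta> f" and "volterra_solution f U" "volterra_solution f V" and "0 \<le> x"
  shows "U x = V x"
proof -
  obtain N where N: "0 \<le> N" "\<And>s. 0 \<le> s \<Longrightarrow> norm (U s) \<le> N * exp (\<beta> * s)"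
    by (rule volterra_solution_bound[OF assms(2)]) blast
  show ?thesis
    using volterra_stability[OF f f assms(2,3) N(2,1) \<open>0 \<le> x\<close>] by simp
qed

text \<open>
  The ansatz \<open>U = G ** Q + w v\<close> with the weight \<open>w\<close> makes the fixed point equation for the bounded
  function \<open>v\<close> contractive on all of \<open>[0,\<infinity>)\<close>.
\<close>

lemma volterra_solution_exists:
  assumes R: "exp_integrable \<beta> R"
  shows "\<exists>U. volterra_solution R U"
proof -
  define r where "r = (\<lambda>s. C * norm (R s))"
  have r: "r absolutely_integrable_on {0..}"
    unfolding r_def using exp_integrable_imp(2)[OF R] by (rule set_integrable_mult_right)
  have rnn: "0 \<le> r s" for s using C_nonneg by (simp add: r_def)
  define w where "w = (\<lambda>s. exp (2 * integral {s..} r))"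
  have w1: "1 \<le> w s" if "0 \<le> s" for s
    using integral_tail_nonneg[OF r rnn that] by (simp add: w_def)
  have w0: "w s \<le> w 0" if "0 \<le> s" for s
    using integral_tail_antimono[OF r rnn order_refl that] by (simp add: w_def)
  have wc: "continuous_on {0..} w"
    unfolding w_def by (intro continuous_intros continuous_on_integral_tail r)
  define W where "W = (\<lambda>(v :: real \<Rightarrow> complex^'d^'d) s. G s ** Q + w s *\<^sub>R v s)"
  \<comment> \<open>The Volterra equation for \<open>W v\<close>, solved for \<open>v\<close>: the
    term \<open>G ** Q\<close> cancels and the rest is divided by \<open>w\<close>.\<close>
  define T0 where "T0 = (\<lambda>(v :: real \<Rightarrow> complex^'d^'d) x.
    - ((1 / w x) *\<^sub>R (G x ** integral {x..} (\<lambda>s. H s ** (R s ** W v s)))))"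
  have Wc: "continuous_on {0..} (W (apply_bcontfun v))" for v
    unfolding W_def by (intro continuous_intros continuous_on_matrix_mult continuous_G wc) auto
  have Wb: "\<exists>N\<ge>0. \<forall>s\<ge>0. norm (W (apply_bcontfun v) s) \<le> N * exp (\<beta> * s)" for v
  proof -
    obtain B where B: "B > 0" "\<And>s. norm (apply_bcontfun v s) \<le> B"
      using bounded_apply_bcontfun[of v] unfolding bounded_pos by auto
    have "norm (W (apply_bcontfun v) s) \<le> (M + w 0 * B) * exp (\<beta> * s)" if s: "0 \<le> s" for s
    proof -
      have "norm (W (apply_bcontfun v) s) \<le> norm (G s ** Q) + norm (w s *\<^sub>R apply_bcontfun v s)"
        unfolding W_def by (rule norm_triangle_ineq)
      also have "norm (w s *\<^sub>R apply_bcontfun v s) \<le> w 0 * B"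
        using w0[OF s] w1[OF s] w1[of 0] B(2)[of s] by (simp add: mult_mono)
      also have "\<dots> \<le> w 0 * B * exp (\<beta> * s)"
        using mult_left_mono[OF exp_\<beta>_ge_1[OF s], of "w 0 * B"] w1[of 0] B(1) by (simp only: mult_1_right) simp
      finally show ?thesis using norm_GQ[OF s] by (simp add: algebra_simps)
    qed
    then show ?thesis using M_nonneg w1[of 0] B(1) by (intro exI[of _ "M + w 0 * B"]) simp
  qed
  have k: "(\<lambda>s. H s ** (R s ** W (apply_bcontfun v) s)) absolutely_integrable_on {0..}" for v
  proof -
    obtain N where "\<forall>s\<ge>0. norm (W (apply_bcontfun v) s) \<le> N * exp (\<beta> * s)" using Wb by blast
    then show ?thesis by (intro kernel_absolutely_integrable[OF R Wc]) auto
  qed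
  have T0c: "continuous_on {0..} (T0 (apply_bcontfun v))" for v
    unfolding T0_def
    by (intro continuous_intros continuous_on_matrix_mult continuous_G wc continuous_on_integral_tail k)
      (auto simp: w_def)
  have T0b: "\<exists>B. \<forall>x\<ge>0. norm (T0 (apply_bcontfun v) x) \<le> B" for v
  proof -
    obtain N where N: "0 \<le> N" "\<And>s. s \<ge> 0 \<Longrightarrow> norm (W (apply_bcontfun v) s) \<le> N * exp (\<beta> * s)" using Wb by blast
    define e where "e = (\<lambda>s. C * N * (exp (\<beta> * s) * norm (R s)))"
    have e0: "e absolutely_integrable_on {0..}"
      unfolding e_def using exp_integrable_imp(3)[OF R] by (rule set_integrable_mult_right)
    have "norm (T0 (apply_bcontfun v) x) \<le> integral {0..} e" if x: "0 \<le> x" for x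
    proof -
      have "norm (T0 (apply_bcontfun v) x) \<le> 1 * norm (G x ** integral {x..} (\<lambda>s. H s ** (R s ** W (apply_bcontfun v) s)))"
        unfolding T0_def norm_minus_cancel norm_scaleR using w1[OF x]
        by (intro mult_right_mono) (auto simp: divide_simps)
      also have "\<dots> \<le> integral {x..} e"
        unfolding mult_1
      proof (rule norm_kernel_integral_le[OF x k])
        show "e integrable_on {x..}"
          by (rule set_lebesgue_integral_eq_integral(1)[OF absolutely_integrable_on_tail[OF e0 x]])
        fix s assume "x \<le> s"
        then have s: "0 \<le> s" using x by simp
        have "norm (R s ** W (apply_bcontfun v) s) \<le> norm (R s) * (N * exp (\<beta> * s))"
          by (rule order_trans[OF norm_matrix_matrix_mult_le]) (intro mult_left_mono N s norm_ge_zero)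
        then have "C * norm (R s ** W (apply_bcontfun v) s) \<le> C * (norm (R s) * (N * exp (\<beta> * s)))"
          using C_nonneg by (rule mult_left_mono)
        then show "C * norm (R s ** W (apply_bcontfun v) s) \<le> e s" by (simp add: e_def algebra_simps)
      qed
      also have "\<dots> \<le> integral {0..} e"
        by (rule integral_tail_antimono[OF e0]) (use C_nonneg N(1) x in \<open>auto simp: e_def\<close>)
      finally show ?thesis .
    qed
    then show ?thesis by blast
  qed
  \<comment> \<open>Bounded continuous functions live on the whole line, so the values on the
    half-line are continued by the constant value at 0. The kernel never looks at negative
    arguments.\<close>
  define T where "T = (\<lambda>v. Bcontfun (\<lambda>x. T0 (apply_bcontfun v) (max x 0)))"
  have T: "apply_bcontfun (T v) x = T0 (apply_bcontfun v) (max x 0)" for v x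
  proof -
    have "continuous_on UNIV (\<lambda>x. T0 (apply_bcontfun v) (max x 0))"
      by (rule continuous_on_compose2[OF T0c]) (auto intro!: continuous_intros)
    moreover obtain B where "\<forall>x\<ge>0. norm (T0 (apply_bcontfun v) x) \<le> B" using T0b by blast
    then have "bounded (range (\<lambda>x. T0 (apply_bcontfun v) (max x 0)))"
      by (auto simp: bounded_iff intro!: exI[of _ B])
    ultimately show ?thesis
      unfolding T_def by (subst Bcontfun_inverse) (auto simp: bcontfun_def)
  qed
  have "dist (T v) (T v') \<le> 1 / 2 * dist v v'" for v v'
  proof (rule dist_bound)
    fix y :: real
    define x where "x = max y 0"
    have x: "0 \<le> x" by (simp add: x_def)
    let ?K = "\<lambda>v s. H s ** (R s ** W (apply_bcontfun v) s)"
    \<comment> \<open>The common term \<open>G ** Q\<close> cancels, leaving \<open>w\<close> times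
      the difference of the two bounded functions. The integral of \<open>r w\<close> over a tail is
      at most \<open>w x / 2\<close>, and the division by \<open>w x\<close> in \<open>T0\<close>
      leaves the factor \<open>1 / 2\<close>.\<close>
    have diff: "(\<lambda>s. H s ** (R s ** (w s *\<^sub>R (apply_bcontfun v s - apply_bcontfun v' s)))) = (\<lambda>s. ?K v s - ?K v' s)"
      by (simp add: W_def matrix_mult.diff_right matrix_mult.add_right scaleR_diff_right)
    note key = integral_tail_exp_weight[OF r rnn x]
    have "T0 (apply_bcontfun v) x - T0 (apply_bcontfun v') x =
        - ((1 / w x) *\<^sub>R (G x ** (integral {x..} (?K v) - integral {x..} (?K v'))))"
      by (simp add: T0_def matrix_mult.diff_right scaleR_diff_right)
    also have "integral {x..} (?K v) - integral {x..} (?K v') = integral {x..} (\<lambda>s. ?K v s - ?K v' s)"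
      by (intro Henstock_Kurzweil_Integration.integral_diff[symmetric] set_lebesgue_integral_eq_integral(1)
        absolutely_integrable_on_tail[OF k x])
    also have "norm (- ((1 / w x) *\<^sub>R (G x ** integral {x..} (\<lambda>s. ?K v s - ?K v' s)))) =
        (1 / w x) * norm (G x ** integral {x..} (\<lambda>s. ?K v s - ?K v' s))"
      using w1[OF x] by simp
    also have "norm (G x ** integral {x..} (\<lambda>s. ?K v s - ?K v' s)) \<le> integral {x..} (\<lambda>s. dist v v' * (r s * w s))"
      unfolding diff[symmetric]
    proof (rule norm_kernel_integral_le[OF x])
      show "(\<lambda>s. H s ** (R s ** (w s *\<^sub>R (apply_bcontfun v s - apply_bcontfun v' s)))) absolutely_integrable_on {0..}"
        unfolding diff by (rule set_integral_diff(1)[OF k k])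
      show "(\<lambda>s. dist v v' * (r s * w s)) integrable_on {x..}"
        unfolding w_def by (rule integrable_on_mult_right[OF set_lebesgue_integral_eq_integral(1)[OF key(1)]])
      fix s assume "x \<le> s"
      then have s: "0 \<le> s" using x by simp
      have "norm (R s ** (w s *\<^sub>R (apply_bcontfun v s - apply_bcontfun v' s))) \<le> norm (R s) * (w s * dist v v')"
        using w1[OF s] dist_bounded[of v s v']
        by (intro order_trans[OF norm_matrix_matrix_mult_le] mult_left_mono) (auto simp: dist_norm)
      then have "C * norm (R s ** (w s *\<^sub>R (apply_bcontfun v s - apply_bcontfun v' s))) \<le> C * (norm (R s) * (w s * dist v v'))"
        using C_nonneg by (rule mult_left_mono)
      then show "C * norm (R s ** (w s *\<^sub>R (apply_bcontfun v s - apply_bcontfun v' s))) \<le> dist v v' * (r s * w s)"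
        by (simp add: r_def algebra_simps)
    qed
    also have "integral {x..} (\<lambda>s. dist v v' * (r s * w s)) = dist v v' * integral {x..} (\<lambda>s. r s * w s)"
      by (rule integral_mult_right)
    also have "\<dots> \<le> dist v v' * (w x / 2)"
      using key(2) by (intro mult_left_mono) (auto simp: w_def)
    finally have "norm (T0 (apply_bcontfun v) x - T0 (apply_bcontfun v') x) \<le> (1 / w x) * (dist v v' * (w x / 2))"
      using w1[OF x] by (simp add: divide_right_mono)
    also have "\<dots> = 1 / 2 * dist v v'" using w1[OF x] by simp
    finally show "dist (apply_bcontfun (T v) y) (apply_bcontfun (T v') y) \<le> 1 / 2 * dist v v'"
      by (simp add: T x_def dist_norm)
  qed
  then have "\<exists>!v. T v = v" by (intro banach_fix_type[of "1 / 2"]) auto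
  then obtain v where v: "T v = v" by blast
  have fix_v: "apply_bcontfun v x = T0 (apply_bcontfun v) x" if "0 \<le> x" for x
    using T[of v x] v that by simp
  have eq: "W (apply_bcontfun v) x - G x ** Q = - (G x ** integral {x..} (\<lambda>s. H s ** (R s ** W (apply_bcontfun v) s)))"
    if "0 \<le> x" for x
  proof -
    have "W (apply_bcontfun v) x - G x ** Q = w x *\<^sub>R T0 (apply_bcontfun v) x"
      using fix_v[OF that] by (simp add: W_def)
    then show ?thesis using w1[OF that] by (simp add: T0_def)
  qed
  have "volterra_solution R (W (apply_bcontfun v))"
    unfolding volterra_solution_def
  proof (intro conjI allI impI)
    show "continuous_on {0..} (W (apply_bcontfun v))" by (rule Wc)
    obtain B where B: "B > 0" "\<And>s. norm (apply_bcontfun v s) \<le> B"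
      using bounded_apply_bcontfun[of v] unfolding bounded_pos by auto
    have "norm (W (apply_bcontfun v) s - G s ** Q) \<le> w 0 * B" if s: "0 \<le> s" for s
      using w0[OF s] w1[OF s] w1[of 0] B(2)[of s] by (simp add: W_def mult_mono)
    then show "bounded ((\<lambda>x. W (apply_bcontfun v) x - G x ** Q) ` {0..})"
      by (auto simp: bounded_iff intro!: exI[of _ "w 0 * B"])
    fix x :: real assume "0 \<le> x"
    from eq[OF this] show "W (apply_bcontfun v) x = G x ** (Q - integral {x..} (\<lambda>s. H s ** (R s ** W (apply_bcontfun v) s)))"
      by (simp add: matrix_mult.diff_right diff_eq_eq)
  qed
  then show ?thesis by blast
qed

end

section \<open>Exponents\<close>

lemma elog_divide_less_imp:
  assumes "elog r / ereal x < ereal \<mu>" "0 < x" "0 \<le> r"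
  shows "r < exp (\<mu> * x)"
proof (cases "r = 0")
  case False
  then have "ln r / x < \<mu>" using assms by (simp add: elog_def)
  then have "ln r < \<mu> * x" using \<open>0 < x\<close> by (simp add: field_simps)
  then have "exp (ln r) < exp (\<mu> * x)" by (simp only: exp_less_cancel_iff)
  then show ?thesis using False \<open>0 \<le> r\<close> by simp
qed simp

lemma elog_divide_le:
  assumes "r \<le> M * exp (\<mu> * x)" "0 < x" "0 \<le> r" "0 < M"
  shows "elog r / ereal x \<le> ereal (\<mu> + ln M / x)"
proof (cases "r = 0")
  case True
  then show ?thesis using \<open>0 < x\<close> by (simp add: elog_def)
next
  case False
  then have "r > 0" using \<open>0 \<le> r\<close> by simp
  then have "ln r \<le> ln (M * exp (\<mu> * x))" using assms by (subst ln_le_cancel_iff) auto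
  also have "\<dots> = ln M + \<mu> * x" using \<open>0 < M\<close> by (simp add: ln_mult)
  finally have "ln r / x \<le> \<mu> + ln M / x" using \<open>0 < x\<close> by (simp add: field_simps)
  then show ?thesis using False \<open>0 < x\<close> by (simp add: elog_def)
qed

text \<open>The strict inequality gives the exponential bound with constant 1 beyond some point;
  continuity handles the compact rest at the price of a larger constant.\<close>

lemma Limsup_elog_less_imp_bound:
  fixes f :: "real \<Rightarrow> 'a::real_normed_vector"
  assumes less: "Limsup at_top (\<lambda>x. elog (norm (f x)) / ereal x) < ereal \<mu>" and f: "continuous_on {0..} f"
  obtains M where "0 < M" "\<And>x. 0 \<le> x \<Longrightarrow> norm (f x) \<le> M * exp (\<mu> * x)"
proof -
  have "\<forall>\<^sub>F x in at_top. elog (norm (f x)) / ereal x < ereal \<mu>"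
    using less by (rule Limsup_lessD)
  then obtain x0 where x0: "\<And>x. x \<ge> x0 \<Longrightarrow> elog (norm (f x)) / ereal x < ereal \<mu>"
    unfolding eventually_at_top_linorder by blast
  define b where "b = max x0 1"
  have large: "norm (f x) \<le> 1 * exp (\<mu> * x)" if "x \<ge> b" for x
    using elog_divide_less_imp[OF x0, of x] that by (simp add: b_def)
  have cont: "continuous_on {0..b} f" by (rule continuous_on_subset[OF f]) auto
  then obtain B where B: "B > 0" "\<And>x. x \<in> {0..b} \<Longrightarrow> norm (f x) \<le> B"
    using compact_imp_bounded[OF compact_continuous_image[OF cont compact_Icc]] unfolding bounded_pos by blast
  show thesis
  proof
    \<comment> \<open>On \<open>{0..b}\<close> the exponential \<open>exp (\<mu> * x)\<close> is at
      least \<open>exp (- \<bar>\<mu>\<bar> * b)\<close>; the second entry compensates for this, the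
      first serves the range beyond \<open>b\<close>.\<close>
    show "0 < max 1 (B * exp (\<bar>\<mu>\<bar> * b))" by simp
    fix x :: real assume "0 \<le> x"
    show "norm (f x) \<le> max 1 (B * exp (\<bar>\<mu>\<bar> * b)) * exp (\<mu> * x)"
    proof (cases "x \<ge> b")
      case True
      have "1 * exp (\<mu> * x) \<le> max 1 (B * exp (\<bar>\<mu>\<bar> * b)) * exp (\<mu> * x)"
        by (rule mult_right_mono) auto
      then show ?thesis using large[OF True] by linarith
    next
      case False
      have "- (\<mu> * x) \<le> \<bar>\<mu>\<bar> * b"
        using False \<open>0 \<le> x\<close> mult_mono[of "\<bar>\<mu>\<bar>" "\<bar>\<mu>\<bar>" x b] abs_ge_minus_self[of "\<mu> * x"] by (simp add: abs_mult)
      then have "1 \<le> exp (\<bar>\<mu>\<bar> * b) * exp (\<mu> * x)" by (simp add: mult_exp_exp)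
      then have "B * 1 \<le> B * (exp (\<bar>\<mu>\<bar> * b) * exp (\<mu> * x))"
        using B(1) by (intro mult_left_mono) auto
      also have "\<dots> = (B * exp (\<bar>\<mu>\<bar> * b)) * exp (\<mu> * x)" by simp
      also have "\<dots> \<le> max 1 (B * exp (\<bar>\<mu>\<bar> * b)) * exp (\<mu> * x)"
        by (rule mult_right_mono) auto
      finally show ?thesis using B(2)[of x] False \<open>0 \<le> x\<close> by simp
    qed
  qed
qed

lemma Limsup_elog_le:
  fixes f :: "real \<Rightarrow> 'a::real_normed_vector"
  assumes "0 < M" and f: "\<And>x. 0 \<le> x \<Longrightarrow> norm (f x) \<le> M * exp (\<mu> * x)"
  shows "Limsup at_top (\<lambda>x. elog (norm (f x)) / ereal x) \<le> ereal \<mu>"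
proof -
  have "\<forall>\<^sub>F x in at_top. elog (norm (f x)) / ereal x \<le> ereal (\<mu> + ln M / x)"
    using eventually_gt_at_top[of 0]
    by eventually_elim (intro elog_divide_le f \<open>0 < M\<close> less_imp_le norm_ge_zero; simp)
  then have "Limsup at_top (\<lambda>x. elog (norm (f x)) / ereal x) \<le> Limsup at_top (\<lambda>x. ereal (\<mu> + ln M / x))"
    by (rule Limsup_mono)
  also have "((\<lambda>x. \<mu> + ln M / x) \<longlongrightarrow> \<mu> + 0) at_top"
    by (intro tendsto_add tendsto_const tendsto_divide_0[OF tendsto_const] filterlim_at_top_imp_at_infinity filterlim_ident)
  then have "Limsup at_top (\<lambda>x. ereal (\<mu> + ln M / x)) = ereal \<mu>"
    by (intro lim_imp_Limsup) auto
  finally show ?thesis .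
qed

section \<open>The weighted measure in terms of integrals over the half-line\<close>

lemma integrable_exp_weight_iff:
  fixes f :: "real \<Rightarrow> 'a::euclidean_space"
  assumes "f \<in> borel_measurable (lebesgue_on {0..})"
  shows "integrable (exp_weight \<beta>) f \<longleftrightarrow> (\<lambda>s. exp (\<beta> * s) *\<^sub>R f s) absolutely_integrable_on {0..}"
proof -
  have "(\<lambda>s. exp (\<beta> * s)) \<in> borel_measurable (lebesgue_on {0..})"
    by (intro continuous_imp_measurable_on_sets_lebesgue continuous_intros) auto
  then have "integrable (exp_weight \<beta>) f \<longleftrightarrow> integrable (lebesgue_on {0..}) (\<lambda>s. exp (\<beta> * s) *\<^sub>R f s)"
    unfolding exp_weight_def by (intro integrable_density assms) auto
  then show ?thesis
    by (simp add: set_integrable_def integrable_restrict_space)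
qed

lemma borel_measurable_exp_weight [simp]: "borel_measurable (exp_weight \<beta>) = borel_measurable (lebesgue_on {0..})"
  by (rule measurable_cong_sets) (simp_all add: exp_weight_def)

lemma integral_exp_weight:
  fixes f :: "real \<Rightarrow> real"
  assumes "integrable (exp_weight \<beta>) f"
  shows "integral\<^sup>L (exp_weight \<beta>) f = integral {0..} (\<lambda>s. exp (\<beta> * s) * f s)"
proof -
  have f: "f \<in> borel_measurable (lebesgue_on {0..})"
    using borel_measurable_integrable[OF assms] by simp
  have "(\<lambda>s. exp (\<beta> * s)) \<in> borel_measurable (lebesgue_on {0..})"
    by (intro continuous_imp_measurable_on_sets_lebesgue continuous_intros) auto
  then have "integral\<^sup>L (exp_weight \<beta>) f = integral\<^sup>L (lebesgue_on {0..}) (\<lambda>s. exp (\<beta> * s) *\<^sub>R f s)"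
    unfolding exp_weight_def by (intro integral_density f) auto
  also have "\<dots> = integral {0..} (\<lambda>s. exp (\<beta> * s) *\<^sub>R f s)"
  proof (rule lebesgue_integral_eq_integral)
    show "integrable (lebesgue_on {0..}) (\<lambda>s. exp (\<beta> * s) *\<^sub>R f s)"
      using assms by (simp add: integrable_exp_weight_iff[OF f] set_integrable_def integrable_restrict_space)
  qed simp
  finally show ?thesis by simp
qed

text \<open>Integrability with respect to the weight is assumed for \<open>norm (R x)\<close>; the
  measurability of \<open>R\<close> required to pass to \<open>R\<close> itself is obtained here,
  from the restrictions to bounded intervals.\<close>

lemma locally_integrable_imp_borel_measurable:
  assumes "locally_integrable R"
  shows "R \<in> borel_measurable (lebesgue_on {0..})"
proof (rule borel_measurable_LIMSEQ_metric)
  fix n :: nat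
  have "set_integrable lebesgue {0..real n} R" using assms by (simp add: locally_integrable_def)
  then have "(\<lambda>x. indicator {0..real n} x *\<^sub>R R x) \<in> borel_measurable lebesgue"
    unfolding set_integrable_def by (rule borel_measurable_integrable)
  then show "(\<lambda>x. indicator {0..real n} x *\<^sub>R R x) \<in> borel_measurable (lebesgue_on {0..})"
    by (rule measurable_restrict_space1)
next
  fix x :: real assume "x \<in> space (lebesgue_on {0..})"
  then have "0 \<le> x" by simp
  obtain N :: nat where "x \<le> real N" using real_arch_simple by blast
  then have "\<forall>\<^sub>F n in sequentially. indicator {0..real n} x *\<^sub>R R x = R x"
    using \<open>0 \<le> x\<close> unfolding eventually_sequentially by (intro exI[of _ N]) auto
  then show "(\<lambda>n. indicator {0..real n} x *\<^sub>R R x) \<longlonglongrightarrow> R x"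
    by (rule tendsto_eventually)
qed

section \<open>Sign and finiteness of the lower Bohl exponent, and bounds for the propagator\<close>

context exp_bounded_system
begin

text \<open>The way from \<open>x'\<close> to \<open>x\<close> is cut into short steps, each costing
  a factor \<open>K\<close> by the cocycle property. The exponent is \<open>n + 1\<close> because
  the base case already uses one factor.\<close>

lemma norm_propagator_le_power:
  assumes K: "K \<ge> 1" "\<And>x x'. \<bar>x - x'\<bar> \<le> 1 \<Longrightarrow> norm (\<Phi> x ** \<Psi> x') \<le> K" and "\<bar>x - x'\<bar> \<le> real n"
  shows "norm (\<Phi> x ** \<Psi> x') \<le> K ^ (n + 1)"
  using assms(3)
proof (induction n arbitrary: x)
  case 0
  then show ?case using K(2)[of x x'] by simp
next
  case (Suc n)
  define y where "y = x' + (x - x') * (real n / (real n + 1))"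
  have xy: "x - y = (x - x') / (real n + 1)" by (simp add: y_def field_simps)
  have "\<bar>x - y\<bar> \<le> 1" using Suc.prems by (simp add: xy)
  moreover have "\<bar>y - x'\<bar> \<le> real n"
    using Suc.prems mult_right_mono[of "\<bar>x - x'\<bar>" "real n + 1" "real n / (real n + 1)"]
    by (simp add: y_def abs_mult)
  ultimately have y: "norm (\<Phi> x ** \<Psi> y) \<le> K" "norm (\<Phi> y ** \<Psi> x') \<le> K ^ (n + 1)"
    using K(2) Suc.IH by auto
  have "\<Phi> x ** \<Psi> x' = \<Phi> x ** (\<Psi> y ** \<Phi> y) ** \<Psi> x'" by (simp add: \<Psi>_\<Phi>)
  also have "\<dots> = (\<Phi> x ** \<Psi> y) ** (\<Phi> y ** \<Psi> x')" by (simp only: matrix_mul_assoc)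
  finally have "norm (\<Phi> x ** \<Psi> x') \<le> norm (\<Phi> x ** \<Psi> y) * norm (\<Phi> y ** \<Psi> x')"
    by (simp only: norm_matrix_matrix_mult_le)
  also have "\<dots> \<le> K * K ^ (n + 1)"
    using y K(1) by (intro mult_mono) auto
  finally show ?case by simp
qed

end

definition Bohl_bound :: "(real \<Rightarrow> complex^'d^'d) \<Rightarrow> complex^'d^'d \<Rightarrow> real \<Rightarrow> bool" where
  "Bohl_bound \<Phi> Q \<kappa> \<longleftrightarrow> (\<exists>C. \<forall>x x'. 0 \<le> x \<and> x \<le> x' \<longrightarrow>
            norm (\<Phi> x ** Q ** matrix_inv (\<Phi> x')) \<le> C * exp (\<kappa> * (x - x')))"

lemma lower_Bohl_eq: "lower_Bohl \<Phi> Q = Sup (ereal ` {\<kappa>. Bohl_bound \<Phi> Q \<kappa>})"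
  by (simp add: lower_Bohl_def Bohl_bound_def)

lemma Bohl_bound_mono:
  assumes "Bohl_bound \<Phi> Q \<kappa>" "\<kappa>' \<le> \<kappa>"
  shows "Bohl_bound \<Phi> Q \<kappa>'"
proof -
  obtain C where C: "\<And>x x'. 0 \<le> x \<and> x \<le> x' \<Longrightarrow> norm (\<Phi> x ** Q ** matrix_inv (\<Phi> x')) \<le> C * exp (\<kappa> * (x - x'))"
    using assms(1) unfolding Bohl_bound_def by blast
  have "0 \<le> C" using order_trans[OF norm_ge_zero C[of 0 0]] by simp
  have "norm (\<Phi> x ** Q ** matrix_inv (\<Phi> x')) \<le> C * exp (\<kappa>' * (x - x'))" if "0 \<le> x \<and> x \<le> x'" for x x'
  proof -
    have "\<kappa> * (x - x') \<le> \<kappa>' * (x - x')" using that assms(2) by (intro mult_right_mono_neg) auto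
    then have "C * exp (\<kappa> * (x - x')) \<le> C * exp (\<kappa>' * (x - x'))" using \<open>0 \<le> C\<close> by (intro mult_left_mono) auto
    then show ?thesis using C[OF that] by linarith
  qed
  then show ?thesis unfolding Bohl_bound_def by blast
qed

lemma less_lower_Bohl_imp_Bohl_bound:
  assumes "ereal \<kappa> < lower_Bohl \<Phi> Q"
  shows "Bohl_bound \<Phi> Q \<kappa>"
proof -
  obtain \<kappa>' where "Bohl_bound \<Phi> Q \<kappa>'" "\<kappa> < \<kappa>'"
    using assms unfolding lower_Bohl_eq less_Sup_iff by auto
  then show ?thesis using Bohl_bound_mono less_imp_le by blast
qed

locale dichotomy_system = exp_bounded_system A \<Phi> for A \<Phi> :: "real \<Rightarrow> complex^'d^'d" +
  fixes Q :: "complex^'d^'d"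
  assumes dichotomy: "exponential_dichotomy \<Phi> Q" and Q_nonzero: "Q \<noteq> 0"
begin

lemma QQ: "Q ** Q = Q"
  using dichotomy by (simp add: exponential_dichotomy_def)

text \<open>Since \<open>Q\<close> is a projection, it is the product of
  \<open>\<Phi> 0 ** Q ** \<Psi> x\<close> and \<open>\<Phi> x ** Q ** \<Psi> 0\<close>. The Bohl
  bound controls the first by \<open>exp (- \<kappa> * x)\<close>, the dichotomy the second by
  \<open>exp (- k * x)\<close>. With \<open>\<kappa> > - k\<close> the product would tend to 0,
  contradicting \<open>Q \<noteq> 0\<close>; so \<open>- k\<close> is the bound.\<close>

lemma Bohl_bound_negative:
  obtains \<kappa>0 where "\<kappa>0 < 0" "\<And>\<kappa>. Bohl_bound \<Phi> Q \<kappa> \<Longrightarrow> \<kappa> \<le> \<kappa>0"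
proof -
  obtain k C0 where k: "k > 0"
    and C0: "\<And>x x'. x \<ge> x' \<Longrightarrow> norm (\<Phi> x ** Q ** \<Psi> x') \<le> C0 * exp (- k * (x - x'))"
    using dichotomy unfolding exponential_dichotomy_def by blast
  have "\<kappa> \<le> - k" if bohl: "Bohl_bound \<Phi> Q \<kappa>" for \<kappa>
  proof (rule ccontr)
    assume "\<not> \<kappa> \<le> - k"
    define c where "c = \<kappa> + k"
    have c: "c > 0" using \<open>\<not> \<kappa> \<le> - k\<close> by (simp add: c_def)
    obtain C where C: "\<And>x x'. 0 \<le> x \<and> x \<le> x' \<Longrightarrow> norm (\<Phi> x ** Q ** \<Psi> x') \<le> C * exp (\<kappa> * (x - x'))"
      using bohl unfolding Bohl_bound_def by blast
    have "0 \<le> C" using order_trans[OF norm_ge_zero C[of 0 0]] by simp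
    have bd: "norm Q * (1 + c * x) \<le> C * C0" if "0 \<le> x" for x
    proof -
      have "(\<Phi> 0 ** Q ** \<Psi> x) ** (\<Phi> x ** Q ** \<Psi> 0) = \<Phi> 0 ** Q ** (\<Psi> x ** \<Phi> x) ** Q ** \<Psi> 0"
        by (simp only: matrix_mul_assoc)
      then have "Q = (\<Phi> 0 ** Q ** \<Psi> x) ** (\<Phi> x ** Q ** \<Psi> 0)"
        by (simp add: \<Psi>_\<Phi> \<Phi>_0 \<Psi>_0[unfolded \<Phi>_0] QQ)
      then have "norm Q \<le> norm (\<Phi> 0 ** Q ** \<Psi> x) * norm (\<Phi> x ** Q ** \<Psi> 0)"
        by (metis norm_matrix_matrix_mult_le)
      also have "\<dots> \<le> (C * exp (\<kappa> * (0 - x))) * (C0 * exp (- k * (x - 0)))"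
        using C[of 0 x] C0[of 0 x] that \<open>0 \<le> C\<close> by (intro mult_mono) auto
      also have "\<dots> = C * C0 * exp (- (c * x))"
        by (simp add: c_def mult_exp_exp algebra_simps exp_add[symmetric])
      finally have "norm Q * exp (c * x) \<le> C * C0 * exp (- (c * x)) * exp (c * x)"
        by (rule mult_right_mono) simp
      also have "\<dots> = C * C0" by (simp add: exp_minus)
      finally have "norm Q * exp (c * x) \<le> C * C0" .
      moreover have "norm Q * (1 + c * x) \<le> norm Q * exp (c * x)"
        by (intro mult_left_mono exp_ge_add_one_self) simp
      ultimately show ?thesis by linarith
    qed
    have "norm Q > 0" using Q_nonzero by simp
    \<comment> \<open>Chosen to make \<open>norm Q * c * x\<close> equal to
      \<open>\<bar>C * C0\<bar>\<close>; the left side of \<open>bd\<close> then exceeds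
      \<open>C * C0\<close> by at least \<open>norm Q\<close>.\<close>
    define x where "x = \<bar>C * C0\<bar> / (norm Q * c)"
    have "0 \<le> x" using c by (simp add: x_def)
    have "norm Q * (1 + c * x) = norm Q + \<bar>C * C0\<bar>"
      using c \<open>norm Q > 0\<close> by (simp add: x_def field_simps)
    then show False using bd[OF \<open>0 \<le> x\<close>] \<open>norm Q > 0\<close> by linarith
  qed
  then show thesis using that[of "- k"] k by simp
qed

text \<open>Going back by one unit costs at most a factor \<open>K\<close>, so \<open>- ln K\<close>
  is an admissible rate. The factor \<open>\<Phi> x' ** Q ** \<Psi> x'\<close> that remains is
  bounded by the dichotomy on the diagonal.\<close>

lemma Bohl_bound_exists: "\<exists>\<kappa>. Bohl_bound \<Phi> Q \<kappa>"
proof -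
  obtain k C0 where k: "k > 0" and C01: "C0 \<ge> 1"
    and C0: "\<And>x x'. x \<ge> x' \<Longrightarrow> norm (\<Phi> x ** Q ** \<Psi> x') \<le> C0 * exp (- k * (x - x'))"
    using dichotomy unfolding exponential_dichotomy_def by blast
  obtain K where K: "K \<ge> 1" "\<And>x x'. \<bar>x - x'\<bar> \<le> 1 \<Longrightarrow> norm (\<Phi> x ** \<Psi> x') \<le> K"
    using fundamental_matrix_inv_bounded[OF A \<Phi> exp_bounded] by metis
  have "norm (\<Phi> x ** Q ** \<Psi> x') \<le> (K ^ 2 * C0) * exp (- ln K * (x - x'))" if x: "0 \<le> x \<and> x \<le> x'" for x x'
  proof -
    \<comment> \<open>Rounding up costs at most 1 and the propagator bound has exponent
      \<open>n + 1\<close>, so the exponent is at most \<open>x' - x + 2\<close>; the surplus 2 is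
      the \<open>K ^ 2\<close> in the constant.\<close>
    define n where "n = nat \<lceil>x' - x\<rceil>"
    have n: "x' - x \<le> real n" "real n \<le> x' - x + 1"
      using x by (auto simp: n_def)
    have "\<Phi> x ** Q ** \<Psi> x' = \<Phi> x ** (\<Psi> x' ** \<Phi> x') ** Q ** \<Psi> x'" by (simp add: \<Psi>_\<Phi>)
    also have "\<dots> = (\<Phi> x ** \<Psi> x') ** (\<Phi> x' ** Q ** \<Psi> x')" by (simp only: matrix_mul_assoc)
    finally have "norm (\<Phi> x ** Q ** \<Psi> x') \<le> norm (\<Phi> x ** \<Psi> x') * norm (\<Phi> x' ** Q ** \<Psi> x')"
      by (simp only: norm_matrix_matrix_mult_le)
    also have "\<dots> \<le> K ^ (n + 1) * C0"
      using norm_propagator_le_power[OF K, of x x' n] C0[of x' x'] n x K(1)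
      by (intro mult_mono) auto
    also have "K ^ (n + 1) = exp (ln K * real (n + 1))"
      using K(1) unfolding exp_of_nat2_mult by simp
    also have "\<dots> \<le> exp (ln K * (x' - x + 2))"
      using n(2) K(1) by (intro exp_mono mult_left_mono) auto
    also have "\<dots> = K ^ 2 * exp (- ln K * (x - x'))"
    proof -
      have "exp (ln K * (x' - x + 2)) = exp (ln K * 2) * exp (- ln K * (x - x'))"
        by (simp add: mult_exp_exp algebra_simps)
      also have "exp (ln K * 2) = K ^ 2" using exp_of_nat2_mult[of "ln K" 2] K(1) by simp
      finally show ?thesis .
    qed
    finally show ?thesis using C01 by (simp add: mult_right_mono algebra_simps)
  qed
  then show ?thesis unfolding Bohl_bound_def by blast
qed

text \<open>Finiteness gives the extended real difference in the condition on \<open>\<beta>\<close>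
  its intended meaning; negativity lets the complementary part of the dichotomy obey the same bound
  as the \<open>Q\<close> part.\<close>

lemma lower_Bohl_real: obtains b where "lower_Bohl \<Phi> Q = ereal b" "b < 0"
proof -
  obtain \<kappa>0 where \<kappa>0: "\<kappa>0 < 0" "\<And>\<kappa>. Bohl_bound \<Phi> Q \<kappa> \<Longrightarrow> \<kappa> \<le> \<kappa>0"
    by (rule Bohl_bound_negative) blast
  have le: "lower_Bohl \<Phi> Q \<le> ereal \<kappa>0"
    unfolding lower_Bohl_eq using \<kappa>0(2) by (intro Sup_least) auto
  obtain \<kappa> where "Bohl_bound \<Phi> Q \<kappa>" using Bohl_bound_exists by blast
  then have ge: "ereal \<kappa> \<le> lower_Bohl \<Phi> Q"
    unfolding lower_Bohl_eq by (intro Sup_upper) auto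
  show thesis
    using le ge \<kappa>0(1) that by (cases "lower_Bohl \<Phi> Q") auto
qed

lemma propagator_bound:
  assumes "ereal \<kappa> < lower_Bohl \<Phi> Q"
  obtains C where "\<And>x s. 0 \<le> x \<Longrightarrow> x \<le> s \<Longrightarrow> norm (\<Phi> x ** \<Psi> s) \<le> C * exp (\<kappa> * (x - s))"
proof -
  obtain b where b: "lower_Bohl \<Phi> Q = ereal b" "b < 0" by (rule lower_Bohl_real) blast
  have "\<kappa> < 0" using assms b by simp
  obtain C where C: "\<And>x x'. 0 \<le> x \<and> x \<le> x' \<Longrightarrow> norm (\<Phi> x ** Q ** \<Psi> x') \<le> C * exp (\<kappa> * (x - x'))"
    using less_lower_Bohl_imp_Bohl_bound[OF assms] unfolding Bohl_bound_def by blast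
  obtain k C1 where k: "k > 0" and C1: "C1 \<ge> 1"
     "\<And>x x'. x \<le> x' \<Longrightarrow> norm (\<Phi> x ** (mat 1 - Q) ** \<Psi> x') \<le> C1 * exp (k * (x - x'))"
    using dichotomy unfolding exponential_dichotomy_def by blast
  show thesis
  proof
    fix x s :: real assume xs: "0 \<le> x" "x \<le> s"
    have "k * (x - s) \<le> \<kappa> * (x - s)"
      using xs k \<open>\<kappa> < 0\<close> by (intro mult_right_mono_neg) auto
    then have "C1 * exp (k * (x - s)) \<le> C1 * exp (\<kappa> * (x - s))"
      using C1(1) by (intro mult_left_mono) auto
    then have 2: "norm (\<Phi> x ** (mat 1 - Q) ** \<Psi> s) \<le> C1 * exp (\<kappa> * (x - s))"
      using C1(2)[OF xs(2)] by linarith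
    have "\<Phi> x ** \<Psi> s = \<Phi> x ** Q ** \<Psi> s + \<Phi> x ** (mat 1 - Q) ** \<Psi> s"
      by (simp add: matrix_mult.diff_right matrix_mult.diff_left)
    then have "norm (\<Phi> x ** \<Psi> s) \<le> C * exp (\<kappa> * (x - s)) + C1 * exp (\<kappa> * (x - s))"
      using C[of x s] xs 2 by (metis add_mono norm_triangle_le)
    then show "norm (\<Phi> x ** \<Psi> s) \<le> (C + C1) * exp (\<kappa> * (x - s))" by (simp add: algebra_simps)
  qed
qed

end

section \<open>Jost solutions\<close>

context dichotomy_system
begin

abbreviation "scaled_\<Phi> \<kappa> \<equiv> \<lambda>x. exp (- (\<kappa> * x)) *\<^sub>R \<Phi> x"
abbreviation "scaled_\<Psi> \<kappa> \<equiv> \<lambda>x. exp (\<kappa> * x) *\<^sub>R \<Psi> x"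

text \<open>The scaling cancels \<open>exp (\<kappa> * (x - s))\<close> in the propagator bound. It
  turns the growth \<open>exp (\<nu> * s)\<close> of \<open>\<Phi> s ** Q\<close> into
  \<open>exp ((\<nu> - \<kappa>) * s)\<close>, and this is where
  \<open>\<nu> - \<kappa> \<le> \<beta>\<close> is used.\<close>

lemma volterra_system_scaled:
  assumes \<kappa>: "ereal \<kappa> < lower_Bohl \<Phi> Q" and \<nu>: "upper_Lyapunov \<Phi> Q < ereal \<nu>"
    and le: "\<nu> - \<kappa> \<le> \<beta>" and "0 \<le> \<beta>"
  obtains C M where "volterra_system (scaled_\<Phi> \<kappa>) (scaled_\<Psi> \<kappa>) Q C M \<beta>"
proof -
  obtain C where C: "\<And>x s. 0 \<le> x \<Longrightarrow> x \<le> s \<Longrightarrow> norm (\<Phi> x ** \<Psi> s) \<le> C * exp (\<kappa> * (x - s))"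
    by (rule propagator_bound[OF \<kappa>]) blast
  have cont: "continuous_on {0..} (\<lambda>x. \<Phi> x ** Q)"
    by (intro continuous_on_matrix_mult continuous_on_\<Phi> continuous_intros)
  obtain M where M: "0 < M" "\<And>x. 0 \<le> x \<Longrightarrow> norm (\<Phi> x ** Q) \<le> M * exp (\<nu> * x)"
    by (rule Limsup_elog_less_imp_bound[OF \<nu>[unfolded upper_Lyapunov_def] cont]) blast
  show thesis
  proof (rule that[of C M], unfold_locales)
    show "continuous_on {0..} (scaled_\<Phi> \<kappa>)" "continuous_on {0..} (scaled_\<Psi> \<kappa>)"
      by (intro continuous_intros continuous_on_\<Phi> continuous_on_\<Psi>)+
    show "scaled_\<Phi> \<kappa> 0 = mat 1" by (simp add: \<Phi>_0)
    fix x s :: real assume "0 \<le> x" "x \<le> s"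
    have "norm (scaled_\<Phi> \<kappa> x ** scaled_\<Psi> \<kappa> s) = exp (- (\<kappa> * (x - s))) * norm (\<Phi> x ** \<Psi> s)"
      by (simp add: matrix_mult.scaleR_left matrix_mult.scaleR_right mult_exp_exp algebra_simps)
    also have "\<dots> \<le> exp (- (\<kappa> * (x - s))) * (C * exp (\<kappa> * (x - s)))"
      by (intro mult_left_mono C \<open>0 \<le> x\<close> \<open>x \<le> s\<close>) simp
    also have "\<dots> = C" by (simp add: exp_minus)
    finally show "norm (scaled_\<Phi> \<kappa> x ** scaled_\<Psi> \<kappa> s) \<le> C" .
  next
    fix s :: real assume s: "0 \<le> s"
    have "norm (scaled_\<Phi> \<kappa> s ** Q) = exp (- (\<kappa> * s)) * norm (\<Phi> s ** Q)"
      by (simp add: matrix_mult.scaleR_left)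
    also have "\<dots> \<le> exp (- (\<kappa> * s)) * (M * exp (\<nu> * s))"
      by (intro mult_left_mono M s) simp
    also have "\<dots> = M * exp ((\<nu> - \<kappa>) * s)" by (simp add: mult_exp_exp algebra_simps)
    also have "\<dots> \<le> M * exp (\<beta> * s)"
      using M(1) le s by (simp add: mult_right_mono)
    finally show "norm (scaled_\<Phi> \<kappa> s ** Q) \<le> M * exp (\<beta> * s)" .
  qed fact
qed

text \<open>Variation of constants on \<open>{x..t}\<close> followed by
  \<open>t \<rightarrow> \<infinity>\<close>. The boundary term \<open>\<Psi> t ** Y t\<close> tends
  to \<open>Q\<close>: its deviation is \<open>\<Psi> t ** (Y t - \<Phi> t ** Q)\<close>, where the
  first factor is at most \<open>C * exp (- \<kappa> * t)\<close> and the second decays like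
  \<open>exp (\<mu> * t)\<close>. The strict inequality \<open>\<mu> < \<kappa>\<close> makes the
  product vanish in the limit.\<close>

lemma solution_imp_volterra_solution:
  assumes vs: "volterra_system (scaled_\<Phi> \<kappa>) (scaled_\<Psi> \<kappa>) Q C M \<beta>"
    and R: "exp_integrable \<beta> R"
    and Y: "matrix_solution_on {0..} (\<lambda>x. A x + R x) Y"
    and bound: "\<And>x. 0 \<le> x \<Longrightarrow> norm (Y x - \<Phi> x ** Q) \<le> N * exp (\<mu> * x)" and "\<mu> < \<kappa>"
  shows "volterra_system.volterra_solution (scaled_\<Phi> \<kappa>) (scaled_\<Psi> \<kappa>) Q R (\<lambda>x. exp (- (\<kappa> * x)) *\<^sub>R Y x)"
proof -
  interpret volterra_system "scaled_\<Phi> \<kappa>" "scaled_\<Psi> \<kappa>" Q C M \<beta> by (rule vs)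
  define U where "U = (\<lambda>x. exp (- (\<kappa> * x)) *\<^sub>R Y x)"
  define h where "h = (\<lambda>s. \<Psi> s ** (R s ** Y s))"
  have h_eq: "(\<lambda>s. scaled_\<Psi> \<kappa> s ** (R s ** U s)) = h"
    by (simp add: h_def U_def matrix_mult.scaleR_left matrix_mult.scaleR_right mult_exp_exp)
  have "0 \<le> N" using order_trans[OF norm_ge_zero bound[of 0]] by simp
  have Yc: "continuous_on {0..} Y" by (rule matrix_solution_on_continuous_on[OF Y]) simp
  then have Uc: "continuous_on {0..} U" unfolding U_def by (intro continuous_intros)
  have diff: "norm (U x - scaled_\<Phi> \<kappa> x ** Q) \<le> N" if x: "0 \<le> x" for x
  proof -
    have "U x - scaled_\<Phi> \<kappa> x ** Q = exp (- (\<kappa> * x)) *\<^sub>R (Y x - \<Phi> x ** Q)"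
      by (simp add: U_def matrix_mult.scaleR_left scaleR_diff_right)
    then have "norm (U x - scaled_\<Phi> \<kappa> x ** Q) \<le> exp (- (\<kappa> * x)) * (N * exp (\<mu> * x))"
      using mult_left_mono[OF bound[OF x], of "exp (- (\<kappa> * x))"] by simp
    also have "\<dots> = N * exp ((\<mu> - \<kappa>) * x)" by (simp add: mult_exp_exp algebra_simps)
    also have "\<dots> \<le> N * 1"
      using \<open>0 \<le> N\<close> x \<open>\<mu> < \<kappa>\<close> by (intro mult_left_mono) (auto simp: mult_nonpos_nonneg)
    finally show ?thesis by simp
  qed
  have h: "h absolutely_integrable_on {0..}"
    unfolding h_eq[symmetric]
    by (rule kernel_absolutely_integrable[OF R Uc norm_le_if_bounded_diff[OF _ diff]])
  have "((\<lambda>t. \<Psi> t ** (Y t - \<Phi> t ** Q)) \<longlongrightarrow> 0) at_top"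
  proof (rule Lim_null_comparison)
    show "\<forall>\<^sub>F t in at_top. norm (\<Psi> t ** (Y t - \<Phi> t ** Q)) \<le> C * N * exp ((\<mu> - \<kappa>) * t)"
      using eventually_ge_at_top[of 0]
    proof eventually_elim
      case (elim t)
      have "norm (\<Psi> t) = (exp (- (\<kappa> * t)) * exp (\<kappa> * t)) * norm (\<Psi> t)"
        by (simp add: mult_exp_exp)
      also have "\<dots> = exp (- (\<kappa> * t)) * norm (scaled_\<Psi> \<kappa> t)" by simp
      also have "\<dots> \<le> exp (- (\<kappa> * t)) * C" by (intro mult_left_mono norm_H elim) simp
      finally have "norm (\<Psi> t) \<le> exp (- (\<kappa> * t)) * C" .
      then have "norm (\<Psi> t) * norm (Y t - \<Phi> t ** Q) \<le> (exp (- (\<kappa> * t)) * C) * (N * exp (\<mu> * t))"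
        using C_nonneg by (intro mult_mono bound elim) auto
      also have "\<dots> = C * N * exp ((\<mu> - \<kappa>) * t)" by (simp add: mult_exp_exp algebra_simps)
      finally show ?case using norm_matrix_matrix_mult_le order_trans by blast
    qed
    have "((\<lambda>t. exp ((\<mu> - \<kappa>) * t)) \<longlongrightarrow> 0) at_top"
      using \<open>\<mu> < \<kappa>\<close>
      by (intro filterlim_compose[OF exp_at_bot] filterlim_tendsto_neg_mult_at_bot[OF tendsto_const] filterlim_ident) auto
    then show "((\<lambda>t. C * N * exp ((\<mu> - \<kappa>) * t)) \<longlongrightarrow> 0) at_top"
      by (rule tendsto_mult_right_zero)
  qed
  then have "((\<lambda>t. \<Psi> t ** (Y t - \<Phi> t ** Q) + Q) \<longlongrightarrow> 0 + Q) at_top"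
    by (intro tendsto_add tendsto_const)
  then have lim: "((\<lambda>t. \<Psi> t ** Y t) \<longlongrightarrow> Q) at_top"
    by (simp add: matrix_mult.diff_right matrix_mul_assoc \<Psi>_\<Phi>)
  have tail: "integral {x..} h = Q - \<Psi> x ** Y x" if x: "0 \<le> x" for x
  proof (rule tendsto_unique)
    show "((\<lambda>t. integral {x..t} h) \<longlongrightarrow> integral {x..} h) at_top"
      by (rule tendsto_integral_tail[OF absolutely_integrable_on_tail[OF h x]])
    have "\<forall>\<^sub>F t in at_top. \<Psi> t ** Y t - \<Psi> x ** Y x = integral {x..t} h"
      using eventually_ge_at_top[of x]
    proof eventually_elim
      case (elim t)
      show ?case
        using integral_unique[OF solution_imp_has_integral[OF Y x elim]] by (simp add: h_def)
    qed
    then show "((\<lambda>t. integral {x..t} h) \<longlongrightarrow> Q - \<Psi> x ** Y x) at_top"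
      by (rule Lim_transform_eventually[rotated]) (intro tendsto_diff lim tendsto_const)
  qed simp
  have "volterra_solution R U"
    unfolding volterra_solution_def h_eq
  proof (intro conjI allI impI Uc)
    show "bounded ((\<lambda>x. U x - scaled_\<Phi> \<kappa> x ** Q) ` {0..})"
      using diff by (auto simp: bounded_iff intro!: exI[of _ N])
    fix x :: real assume x: "0 \<le> x"
    show "U x = scaled_\<Phi> \<kappa> x ** (Q - integral {x..} h)"
      by (simp add: tail[OF x] U_def matrix_mult.scaleR_left matrix_mul_assoc \<Phi>_\<Psi>)
  qed
  then show ?thesis by (simp add: U_def)
qed

text \<open>The tail integral is the integral over the half-line minus the one over
  \<open>{0..x}\<close>, so the Volterra equation becomes an initial value equation with constant
  \<open>Q - integral {0..} h\<close>. The bounded distance to \<open>G ** Q\<close> bounds the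
  upper exponent of \<open>Y - \<Phi> Q\<close> by \<open>\<kappa>\<close>, which is strictly below
  the lower Bohl exponent.\<close>

lemma volterra_solution_imp_Jost:
  assumes vs: "volterra_system (scaled_\<Phi> \<kappa>) (scaled_\<Psi> \<kappa>) Q C M \<beta>"
    and \<kappa>: "ereal \<kappa> < lower_Bohl \<Phi> Q"
    and R: "exp_integrable \<beta> R"
    and U: "volterra_system.volterra_solution (scaled_\<Phi> \<kappa>) (scaled_\<Psi> \<kappa>) Q R U"
  shows "is_Jost_solution A \<Phi> Q R (restrict (\<lambda>x. exp (\<kappa> * x) *\<^sub>R U x) {0..})"
proof -
  interpret volterra_system "scaled_\<Phi> \<kappa>" "scaled_\<Psi> \<kappa>" Q C M \<beta> by (rule vs)
  define Y where "Y = restrict (\<lambda>x. exp (\<kappa> * x) *\<^sub>R U x) {0..}"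
  define h where "h = (\<lambda>s. scaled_\<Psi> \<kappa> s ** (R s ** U s))"
  have Uc: "continuous_on {0..} U" using U by (simp add: volterra_solution_def)
  obtain N where N: "\<And>s. 0 \<le> s \<Longrightarrow> norm (U s) \<le> N * exp (\<beta> * s)"
    by (rule volterra_solution_bound[OF U]) blast
  have h: "h absolutely_integrable_on {0..}"
    unfolding h_def by (rule kernel_absolutely_integrable[OF R Uc N])
  have h_eq: "h s = \<Psi> s ** (R s ** Y s)" if "0 \<le> s" for s
    using that by (simp add: h_def Y_def matrix_mult.scaleR_left matrix_mult.scaleR_right)
  have "matrix_solution_on {0..} (\<lambda>x. A x + R x) Y"
  proof (rule integral_imp_solution[where c = "Q - integral {0..} h"])
    show "R absolutely_integrable_on {0..b}" for b
      by (rule set_integrable_subset[OF exp_integrable_imp(1)[OF R]]) auto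
    have "continuous_on {0..} (\<lambda>x. exp (\<kappa> * x) *\<^sub>R U x)" by (intro continuous_intros Uc)
    then show "continuous_on {0..} Y" by (rule continuous_on_eq) (simp add: Y_def)
    fix x :: real assume x: "x \<ge> 0"
    have "Y x = exp (\<kappa> * x) *\<^sub>R (scaled_\<Phi> \<kappa> x ** (Q - integral {x..} h))"
      using U x unfolding volterra_solution_def h_def[symmetric] by (simp add: Y_def)
    also have "\<dots> = \<Phi> x ** (Q - integral {x..} h)"
      by (simp add: matrix_mult.scaleR_left mult_exp_exp)
    also have "Q - integral {x..} h = Q - integral {0..} h + integral {0..x} h"
      using integral_tail_split[OF h order_refl x] by simp
    also have "integral {0..x} h = integral {0..x} (\<lambda>s. \<Psi> s ** (R s ** Y s))"
      by (rule Henstock_Kurzweil_Integration.integral_cong) (simp add: h_eq)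
    finally show "Y x = \<Phi> x ** (Q - integral {0..} h + integral {0..x} (\<lambda>s. \<Psi> s ** (R s ** Y s)))" .
  qed
  moreover
  obtain B where B: "B > 0" "\<And>s. 0 \<le> s \<Longrightarrow> norm (U s - scaled_\<Phi> \<kappa> s ** Q) \<le> B"
    by (rule volterra_solution_bounded_diff[OF U]) blast
  have "Limsup at_top (\<lambda>x. elog (norm (Y x - \<Phi> x ** Q)) / ereal x) \<le> ereal \<kappa>"
  proof (rule Limsup_elog_le[OF B(1)])
    fix x :: real assume x: "0 \<le> x"
    have "Y x - \<Phi> x ** Q = exp (\<kappa> * x) *\<^sub>R (U x - scaled_\<Phi> \<kappa> x ** Q)"
      using x by (simp add: Y_def matrix_mult.scaleR_left scaleR_diff_right mult_exp_exp)
    then show "norm (Y x - \<Phi> x ** Q) \<le> B * exp (\<kappa> * x)"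
      using mult_left_mono[OF B(2)[OF x], of "exp (\<kappa> * x)"] by (simp add: mult.commute)
  qed
  ultimately show ?thesis
    using \<kappa> unfolding is_Jost_solution_def Y_def by auto
qed

text \<open>A real \<open>\<mu>\<close> fits strictly between the limsup and the lower Bohl
  exponent, which turns the asymptotic condition into a bound on the whole half-line.\<close>

lemma Jost_solution_bound:
  assumes "is_Jost_solution A \<Phi> Q R Y"
  obtains N \<mu> where "ereal \<mu> < lower_Bohl \<Phi> Q"
    "\<And>x. 0 \<le> x \<Longrightarrow> norm (Y x - \<Phi> x ** Q) \<le> N * exp (\<mu> * x)"
proof -
  have Y: "matrix_solution_on {0..} (\<lambda>x. A x + R x) Y"
    and "Limsup at_top (\<lambda>x. elog (norm (Y x - \<Phi> x ** Q)) / ereal x) < lower_Bohl \<Phi> Q"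
    using assms by (auto simp: is_Jost_solution_def)
  then obtain \<mu> where \<mu>: "Limsup at_top (\<lambda>x. elog (norm (Y x - \<Phi> x ** Q)) / ereal x) < ereal \<mu>"
    "ereal \<mu> < lower_Bohl \<Phi> Q"
    using ereal_dense2 by blast
  have "continuous_on {0..} (\<lambda>x. Y x - \<Phi> x ** Q)"
    by (intro continuous_intros continuous_on_matrix_mult continuous_on_\<Phi> matrix_solution_on_continuous_on[OF Y]) simp
  from Limsup_elog_less_imp_bound[OF \<mu>(1) this] show thesis using that \<mu>(2) by blast
qed

text \<open>
  Two Jost solutions come with rates below the lower Bohl exponent that need not be below \<open>\<kappa>\<close>, so
  the Volterra equation is used with a larger \<open>\<kappa>'\<close>.
\<close>

lemma Jost_solution_unique:
  assumes \<nu>: "upper_Lyapunov \<Phi> Q < ereal \<nu>" and \<kappa>: "ereal \<kappa> < lower_Bohl \<Phi> Q"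
    and le: "\<nu> - \<kappa> \<le> \<beta>" and "0 \<le> \<beta>"
    and R: "exp_integrable \<beta> R"
    and Y1: "is_Jost_solution A \<Phi> Q R Y1" and Y2: "is_Jost_solution A \<Phi> Q R Y2" and x: "0 \<le> x"
  shows "Y1 x = Y2 x"
proof -
  obtain N1 \<mu>1 where 1: "ereal \<mu>1 < lower_Bohl \<Phi> Q"
    "\<And>x. 0 \<le> x \<Longrightarrow> norm (Y1 x - \<Phi> x ** Q) \<le> N1 * exp (\<mu>1 * x)"
    by (rule Jost_solution_bound[OF Y1]) blast
  obtain N2 \<mu>2 where 2: "ereal \<mu>2 < lower_Bohl \<Phi> Q"
    "\<And>x. 0 \<le> x \<Longrightarrow> norm (Y2 x - \<Phi> x ** Q) \<le> N2 * exp (\<mu>2 * x)"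
    by (rule Jost_solution_bound[OF Y2]) blast
  have "ereal (max \<kappa> (max \<mu>1 \<mu>2)) < lower_Bohl \<Phi> Q"
    using \<kappa> 1(1) 2(1) by (simp add: max_def)
  then obtain \<kappa>' where \<kappa>': "ereal (max \<kappa> (max \<mu>1 \<mu>2)) < ereal \<kappa>'" "ereal \<kappa>' < lower_Bohl \<Phi> Q"
    using ereal_dense2 by blast
  then have gt: "\<kappa> < \<kappa>'" "\<mu>1 < \<kappa>'" "\<mu>2 < \<kappa>'" by auto
  \<comment> \<open>Raising \<open>\<kappa>\<close> only shrinks the difference, so the same
    \<open>\<beta>\<close> still serves.\<close>
  then have "\<nu> - \<kappa>' \<le> \<beta>" using le by simp
  then obtain C M where vs: "volterra_system (scaled_\<Phi> \<kappa>') (scaled_\<Psi> \<kappa>') Q C M \<beta>"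
    by (rule volterra_system_scaled[OF \<kappa>'(2) \<nu> _ \<open>0 \<le> \<beta>\<close>]) blast
  then interpret volterra_system "scaled_\<Phi> \<kappa>'" "scaled_\<Psi> \<kappa>'" Q C M \<beta> .
  have "exp (- (\<kappa>' * x)) *\<^sub>R Y1 x = exp (- (\<kappa>' * x)) *\<^sub>R Y2 x"
  proof (rule volterra_solution_unique[OF R _ _ x])
    show "volterra_solution R (\<lambda>x. exp (- (\<kappa>' * x)) *\<^sub>R Y1 x)"
      by (rule solution_imp_volterra_solution[OF vs R _ 1(2) gt(2)]) (use Y1 in \<open>simp_all add: is_Jost_solution_def\<close>)
    show "volterra_solution R (\<lambda>x. exp (- (\<kappa>' * x)) *\<^sub>R Y2 x)"
      by (rule solution_imp_volterra_solution[OF vs R _ 2(2) gt(3)]) (use Y2 in \<open>simp_all add: is_Jost_solution_def\<close>)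
  qed
  then show ?thesis by simp
qed

lemma exponents_gap:
  assumes "ereal \<beta> > upper_Lyapunov \<Phi> Q - lower_Bohl \<Phi> Q"
  obtains \<kappa> \<nu> where "ereal \<kappa> < lower_Bohl \<Phi> Q" "upper_Lyapunov \<Phi> Q < ereal \<nu>" "\<nu> - \<kappa> \<le> \<beta>"
proof -
  obtain b where b: "lower_Bohl \<Phi> Q = ereal b" by (rule lower_Bohl_real) blast
  have "upper_Lyapunov \<Phi> Q < ereal (\<beta> + b)"
    using assms b by (cases "upper_Lyapunov \<Phi> Q") auto
  then obtain \<nu> where \<nu>: "upper_Lyapunov \<Phi> Q < ereal \<nu>" "ereal \<nu> < ereal (\<beta> + b)"
    using ereal_dense2 by blast
  then obtain \<kappa> where "\<nu> - \<beta> < \<kappa>" "\<kappa> < b"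
    using dense[of "\<nu> - \<beta>" b] by auto
  then show thesis using that[of \<kappa> \<nu>] \<nu>(1) b by simp
qed

lemma Jost_solution_exists1:
  assumes gap: "ereal \<beta> > upper_Lyapunov \<Phi> Q - lower_Bohl \<Phi> Q" and "0 \<le> \<beta>"
    and R: "exp_integrable \<beta> R"
  shows "\<exists>!Y. Y \<in> extensional {0..} \<and> is_Jost_solution A \<Phi> Q R Y"
proof -
  obtain \<kappa> \<nu> where \<kappa>: "ereal \<kappa> < lower_Bohl \<Phi> Q" and \<nu>: "upper_Lyapunov \<Phi> Q < ereal \<nu>" and le: "\<nu> - \<kappa> \<le> \<beta>"
    by (rule exponents_gap[OF gap]) blast
  obtain C M where vs: "volterra_system (scaled_\<Phi> \<kappa>) (scaled_\<Psi> \<kappa>) Q C M \<beta>"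
    by (rule volterra_system_scaled[OF \<kappa> \<nu> le \<open>0 \<le> \<beta>\<close>]) blast
  then interpret volterra_system "scaled_\<Phi> \<kappa>" "scaled_\<Psi> \<kappa>" Q C M \<beta> .
  obtain U where "volterra_solution R U" using volterra_solution_exists[OF R] by blast
  then have "is_Jost_solution A \<Phi> Q R (restrict (\<lambda>x. exp (\<kappa> * x) *\<^sub>R U x) {0..})"
    by (rule volterra_solution_imp_Jost[OF vs \<kappa> R])
  then show ?thesis
    by (intro ex1I[of _ "restrict (\<lambda>x. exp (\<kappa> * x) *\<^sub>R U x) {0..}"])
      (auto intro!: extensionalityI[of _ "{0..}"] Jost_solution_unique[OF \<nu> \<kappa> le \<open>0 \<le> \<beta>\<close> R])
qed

text \<open>Stability is applied with the growth bound \<open>N\<close> of the solution for the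
  fixed \<open>f\<close>. The exponential factor involves the varying \<open>g\<close>, but the norm
  of \<open>g\<close> in the unweighted space is at most that of \<open>f\<close> plus the weighted
  distance, because the weight is at least 1 on the half-line.\<close>

lemma continuous_on_L1_Jost_solution:
  assumes gap: "ereal \<beta> > upper_Lyapunov \<Phi> Q - lower_Bohl \<Phi> Q" and "0 \<le> \<beta>"
  shows "continuous_on_L1 (exp_weight \<beta>) (\<lambda>R. Jost_solution A \<Phi> Q R 0)"
  unfolding continuous_on_L1_def
proof (intro allI impI)
  fix f :: "real \<Rightarrow> complex^'d^'d" and \<epsilon> :: real
  assume f: "integrable (exp_weight \<beta>) f" and "0 < \<epsilon>"
  obtain \<kappa> \<nu> where \<kappa>: "ereal \<kappa> < lower_Bohl \<Phi> Q" and \<nu>: "upper_Lyapunov \<Phi> Q < ereal \<nu>" and le: "\<nu> - \<kappa> \<le> \<beta>"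
    by (rule exponents_gap[OF gap]) blast
  obtain C M where vs: "volterra_system (scaled_\<Phi> \<kappa>) (scaled_\<Psi> \<kappa>) Q C M \<beta>"
    by (rule volterra_system_scaled[OF \<kappa> \<nu> le \<open>0 \<le> \<beta>\<close>]) blast
  then interpret volterra_system "scaled_\<Phi> \<kappa>" "scaled_\<Psi> \<kappa>" Q C M \<beta> .
  have adm: "exp_integrable \<beta> R" if "integrable (exp_weight \<beta>) R" for R
    using that borel_measurable_integrable[OF that] by (simp add: exp_integrable_def integrable_exp_weight_iff)
  \<comment> \<open>One \<open>\<kappa>\<close> serves all perturbations, as it depends on the
    unperturbed equation and \<open>\<beta>\<close> alone; at 0 the scaling factor is 1.\<close>
  have Jost_0: "Jost_solution A \<Phi> Q R 0 = U 0" if R: "exp_integrable \<beta> R" and U: "volterra_solution R U" for R U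
  proof -
    have "Jost_solution A \<Phi> Q R = restrict (\<lambda>x. exp (\<kappa> * x) *\<^sub>R U x) {0..}"
      unfolding Jost_solution_def
      by (rule the1_equality[OF Jost_solution_exists1[OF gap \<open>0 \<le> \<beta>\<close> R]])
        (use volterra_solution_imp_Jost[OF vs \<kappa> R U] in auto)
    then show ?thesis by simp
  qed
  obtain U where U: "volterra_solution f U" using volterra_solution_exists[OF adm[OF f]] by blast
  obtain N where N: "0 \<le> N" "\<And>s. 0 \<le> s \<Longrightarrow> norm (U s) \<le> N * exp (\<beta> * s)"
    by (rule volterra_solution_bound[OF U]) blast
  define I where "I = integral {0..} (\<lambda>s. norm (f s))"
  define L where "L = 2 * C * N * exp (2 * (C * (I + 1)))"
  have "0 \<le> L" using C_nonneg N(1) by (simp add: L_def)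
  \<comment> \<open>The entry 1 yields the bound \<open>I + 1\<close> for the integral of
    \<open>norm (g s)\<close> that is built into \<open>L\<close>; the denominator
    \<open>L + 1\<close> is positive even when \<open>L = 0\<close>.\<close>
  define \<delta> where "\<delta> = min 1 (\<epsilon> / (L + 1))"
  show "\<exists>\<delta>>0. \<forall>g. integrable (exp_weight \<beta>) g \<and> (\<integral>x. norm (g x - f x) \<partial>exp_weight \<beta>) < \<delta> \<longrightarrow>
      dist (Jost_solution A \<Phi> Q g 0) (Jost_solution A \<Phi> Q f 0) < \<epsilon>"
  proof (intro exI[of _ \<delta>] conjI allI impI)
    show "0 < \<delta>" using \<open>0 \<le> L\<close> \<open>0 < \<epsilon>\<close> by (simp add: \<delta>_def)
    fix g assume *: "integrable (exp_weight \<beta>) g \<and> (\<integral>x. norm (g x - f x) \<partial>exp_weight \<beta>) < \<delta>"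
    then have g: "integrable (exp_weight \<beta>) g" by simp
    define d where "d = integral {0..} (\<lambda>s. exp (\<beta> * s) * norm (f s - g s))"
    have "d = (\<integral>x. norm (f x - g x) \<partial>exp_weight \<beta>)"
      unfolding d_def using f g by (intro integral_exp_weight[symmetric]) simp
    then have d: "d < \<delta>" using * by (simp add: norm_minus_commute)
    note fg = exp_integrable_imp(3)[OF exp_integrable_diff[OF adm[OF f] adm[OF g]]]
    note abs_f = exp_integrable_imp(2)[OF adm[OF f]] and abs_g = exp_integrable_imp(2)[OF adm[OF g]]
    have "integral {0..} (\<lambda>s. norm (g s)) \<le> integral {0..} (\<lambda>s. norm (f s) + exp (\<beta> * s) * norm (f s - g s))"
    proof (rule integral_le)
      fix s :: real assume "s \<in> {0..}"
      then have "1 * norm (f s - g s) \<le> exp (\<beta> * s) * norm (f s - g s)"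
        by (intro mult_right_mono exp_\<beta>_ge_1) auto
      then show "norm (g s) \<le> norm (f s) + exp (\<beta> * s) * norm (f s - g s)"
        using norm_triangle_sub[of "g s" "f s"] by (simp add: norm_minus_commute)
    qed (intro integrable_add set_lebesgue_integral_eq_integral(1) abs_f abs_g fg)+
    also have "\<dots> = I + d"
      unfolding I_def d_def
      by (intro Henstock_Kurzweil_Integration.integral_add set_lebesgue_integral_eq_integral(1) abs_f fg)
    finally have "integral {0..} (\<lambda>s. norm (g s)) \<le> I + 1" using d by (simp add: \<delta>_def)
    then have "C * integral {0..} (\<lambda>s. norm (g s)) \<le> C * (I + 1)"
      using C_nonneg by (rule mult_left_mono)
    then have e: "exp (2 * integral {0..} (\<lambda>s. C * norm (g s))) \<le> exp (2 * (C * (I + 1)))"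
      by simp
    have "0 \<le> d"
      unfolding d_def by (intro Henstock_Kurzweil_Integration.integral_nonneg set_lebesgue_integral_eq_integral(1) fg) auto
    obtain V where V: "volterra_solution g V" using volterra_solution_exists[OF adm[OF g]] by blast
    have "norm (U 0 - V 0) \<le> 2 * (C * N * d) * exp (2 * integral {0..} (\<lambda>s. C * norm (g s)))"
      unfolding d_def by (rule volterra_stability[OF adm[OF f] adm[OF g] U V N(2,1) order_refl])
    also have "\<dots> \<le> 2 * (C * N * d) * exp (2 * (C * (I + 1)))"
      using e C_nonneg N(1) \<open>0 \<le> d\<close> by (intro mult_left_mono) auto
    also have "\<dots> = L * d" by (simp add: L_def)
    also have "\<dots> \<le> (L + 1) * d" using \<open>0 \<le> d\<close> by (simp add: mult_right_mono)
    also have "\<dots> < (L + 1) * (\<epsilon> / (L + 1))"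
      using d \<open>0 \<le> L\<close> by (intro mult_strict_left_mono) (auto simp: \<delta>_def)
    also have "\<dots> = \<epsilon>" using \<open>0 \<le> L\<close> by simp
    finally show "dist (Jost_solution A \<Phi> Q g 0) (Jost_solution A \<Phi> Q f 0) < \<epsilon>"
      by (simp add: Jost_0[OF adm[OF f] U] Jost_0[OF adm[OF g] V] dist_norm norm_minus_commute)
  qed
qed

end

theorem theorem3p2:
  fixes A R \<Phi> :: "real \<Rightarrow> complex^'d^'d" and Q :: "complex^'d^'d" and \<beta> :: real
  assumes "locally_integrable A"
    and "fundamental_matrix A \<Phi>"
    and "exp_bounded_propagator \<Phi>"
    and "exponential_dichotomy \<Phi> Q"
    and "Q \<noteq> 0"
    and "\<beta> > 0"
    and "ereal \<beta> > upper_Lyapunov \<Phi> Q - lower_Bohl \<Phi> Q"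
    and "locally_integrable R"
    and "integrable (exp_weight \<beta>) (\<lambda>x. norm (R x))"
  shows "(\<exists>!Y. Y \<in> extensional {0..} \<and> is_Jost_solution A \<Phi> Q R Y) \<and>
    continuous_on_L1 (exp_weight \<beta>) (\<lambda>R. Jost_solution A \<Phi> Q R 0)"
proof
  interpret dichotomy_system A \<Phi> Q
    by unfold_locales fact+
  have R: "R \<in> borel_measurable (lebesgue_on {0..})"
    by (rule locally_integrable_imp_borel_measurable) fact
  then have "integrable (exp_weight \<beta>) R"
    using assms(9) by (subst integrable_norm_iff[symmetric]) simp_all
  then have "exp_integrable \<beta> R"
    by (simp add: exp_integrable_def integrable_exp_weight_iff[OF R])
  then show "\<exists>!Y. Y \<in> extensional {0..} \<and> is_Jost_solution A \<Phi> Q R Y"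
    using assms(6,7) by (intro Jost_solution_exists1) auto
  show "continuous_on_L1 (exp_weight \<beta>) (\<lambda>R. Jost_solution A \<Phi> Q R 0)"
    using assms(6,7) by (intro continuous_on_L1_Jost_solution) auto
qed

end
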